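(* Let $\phi$ be convex and twice differentiable on $\mathbb{R}^{d_1 \times d_2}$ (asymmetric case) or on $\mathbb{S}_d^+$ (symmetric case). For integers $r \ge r_* \ge 1$, denote $$\mu := \mu_{r + r_*}(\phi), \quad L := L_{r + r_*}(\phi), \quad L_2 := L_2^{(r + r_* )}(\phi),$$ and suppose $$\mu > \frac{L_2}{2 \sqrt{r/r_*} + L_2/L}.$$ Set $$\mu_{\mathrm{eff}} := \frac{1}{2} \left( \sqrt{(L + \mu)^2 + \frac{r_*}{r} L_2^2} - \sqrt{\frac{r_*}{r}}\, L_2 - (L - \mu) \right),$$ which satisfies $\mu_{\mathrm{eff}} > 0$, and let $\lambda \ge 0$. Finally, suppose that - (Asymmetric case) $M_*$ is any matrix in $\mathbb{R}^{d_1 \times d_2}$ with rank at most $r_*$, $(U, V) \in \mathbb{R}^{d_1 \times r} \times \mathbb{R}^{d_2 \times r}$ is any second-order critical point of $f_\lambda(U, V) = \phi(U V^\top) + \lambda \frac{\|U\|_F^2 + \|V\|_F^2}{2}$, and $M = U V^\top$; or - (Symmetric case) $M_*$ is any matrix in $\mathbb{S}_d^+$ with rank at most $r_*$, $U \in \mathbb{R}^{d \times r}$ is any second-order critical point of $f_\lambda(U) = \phi(U U^\top) + \lambda \|U\|_F^2$, and $M = U U^\top$. Then $$\| M - M_* \|_F \le \frac{6 \sqrt{r_*}\, \lambda + \sqrt{r + r_*}\, \big( \|\nabla \phi(M_* )\|_{\mathrm{op}} - \lambda \big)_+}{\mu_{\mathrm{eff}}}.$$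
   Context: $\mathbb{S}_d$ is the space of symmetric $d \times d$ real matrices and $\mathbb{S}_d^+ \subset \mathbb{S}_d$ the set of positive semidefinite ones. Matrix spaces carry the trace inner product; $\|\cdot\|_F$ is the Frobenius norm, $\|\cdot\|_{\mathrm{op}}$ the operator (spectral) norm, and $x_+ = \max\{x, 0\}$. For $\phi$ on $\mathbb{S}_d^+$, derivatives are taken relative to $\mathbb{S}_d^+$, so $\nabla \phi(M) \in \mathbb{S}_d$ and $\nabla^2 \phi(M)$ is a symmetric bilinear form on $\mathbb{S}_d$. Restricted strong convexity and smoothness: for integers $k, \ell \ge 1$ and reals $L \ge \mu \ge 0$, $\phi$ on $\mathbb{R}^{d_1 \times d_2}$ (resp. $\mathbb{S}_d^+$) has $(k, \ell, \mu, L)$-restricted strong convexity and smoothness if it is twice differentiable and, for all $M, E \in \mathbb{R}^{d_1 \times d_2}$ (resp. $M \in \mathbb{S}_d^+$, $E \in \mathbb{S}_d$) with $\operatorname{rank}(M) \le \ell$ and $\operatorname{rank}(E) \le k$, $$\mu \|E\|_F^2 \le \nabla^2 \phi(M)[E, E] \le L \|E\|_F^2.$$ $\mu_k^{(\ell)}(\phi)$ and $L_k^{(\ell)}(\phi)$ denote the optimal (largest, respectively smallest) values of $\mu$ and $L$ for which this holds (the values used are finite), and $\mu_k(\phi) := \mu_k^{(k)}(\phi)$, $L_k(\phi) := L_k^{(k)}(\phi)$. A second-order critical point of a function $f$ is a point where $\nabla f = 0$ and $\nabla^2 f \succeq 0$. *)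

theory Defs
  imports "HOL-Analysis.Analysis"
begin

text \<open>
  Matrices with \<^term>\<open>m\<close> rows and \<^term>\<open>n\<close> columns have type \<^typ>\<open>real^'n^'m\<close>. The library
  inner product on this type is the trace inner product, so \<^const>\<open>norm\<close> is the Frobenius norm.
\<close>

definition sym_mats :: "(real^'d^'d) set" where
  "sym_mats = {A. transpose A = A}"

definition psd_mats :: "(real^'d^'d) set" where
  "psd_mats = {A. transpose A = A \<and> (\<forall>x. 0 \<le> x \<bullet> (A *v x))}"

definition op_norm :: "real^'n^'m \<Rightarrow> real" where
  "op_norm A = onorm ((*v) A)"

text \<open>
  Derivatives relative to a set \<^term>\<open>S\<close> lying in a linear subspace \<^term>\<open>T\<close>. Only the pairs
  \<open>(T, S) = (UNIV, UNIV)\<close> and \<open>(sym_mats, psd_mats)\<close> are used. In both, \<^term>\<open>S\<close> is convex with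
  nonempty interior relative to \<^term>\<open>T\<close>. Hence at every point of \<^term>\<open>S\<close>, including boundary
  points, the derivative within \<^term>\<open>S\<close> is unique as a linear map on \<^term>\<open>T\<close>: the gradient
  in \<^term>\<open>T\<close> is unique, and the Hessian form does not depend on the choice made by
  \<^const>\<open>frechet_derivative\<close> as long as its arguments are in \<^term>\<open>T\<close>.
\<close>

definition grad_on :: "'a set \<Rightarrow> 'a set \<Rightarrow> ('a::euclidean_space \<Rightarrow> real) \<Rightarrow> 'a \<Rightarrow> 'a" where
  "grad_on T S f x = (THE g. g \<in> T \<and> (f has_derivative (\<lambda>h. g \<bullet> h)) (at x within S))"

definition hess_on :: "'a set \<Rightarrow> 'a set \<Rightarrow> ('a::euclidean_space \<Rightarrow> real) \<Rightarrow> 'a \<Rightarrow> 'a \<Rightarrow> 'a \<Rightarrow> real" where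
  "hess_on T S f x h k = frechet_derivative (grad_on T S f) (at x within S) h \<bullet> k"

definition twice_differentiable_on :: "'a set \<Rightarrow> 'a set \<Rightarrow> ('a::euclidean_space \<Rightarrow> real) \<Rightarrow> bool" where
  "twice_differentiable_on T S f \<longleftrightarrow> f differentiable_on S \<and> grad_on T S f differentiable_on S"

definition second_order_critical :: "('a::euclidean_space \<Rightarrow> real) \<Rightarrow> 'a \<Rightarrow> bool" where
  "second_order_critical f x \<longleftrightarrow>
     grad_on UNIV UNIV f x = 0 \<and> (\<forall>h. 0 \<le> hess_on UNIV UNIV f x h h)"

definition restricted_sc_smooth ::
  "(real^'n^'m) set \<Rightarrow> (real^'n^'m) set \<Rightarrow> nat \<Rightarrow> nat \<Rightarrow> real \<Rightarrow> real \<Rightarrow> (real^'n^'m \<Rightarrow> real) \<Rightarrow> bool"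
where
  "restricted_sc_smooth T S k l \<mu> L \<phi> \<longleftrightarrow>
     1 \<le> k \<and> 1 \<le> l \<and> 0 \<le> \<mu> \<and> \<mu> \<le> L \<and> twice_differentiable_on T S \<phi> \<and>
     (\<forall>M\<in>S. \<forall>E\<in>T. rank M \<le> l \<and> rank E \<le> k \<longrightarrow>
        \<mu> * (norm E)\<^sup>2 \<le> hess_on T S \<phi> M E E \<and> hess_on T S \<phi> M E E \<le> L * (norm E)\<^sup>2)"

text \<open>
  The next two are meaningful only if \<^const>\<open>restricted_sc_smooth\<close> holds for some pair of
  constants. In that case both optima are attained (by the same pair).
\<close>

definition rsc_mu ::
  "(real^'n^'m) set \<Rightarrow> (real^'n^'m) set \<Rightarrow> nat \<Rightarrow> nat \<Rightarrow> (real^'n^'m \<Rightarrow> real) \<Rightarrow> real" where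
  "rsc_mu T S k l \<phi> = (GREATEST \<mu>. \<exists>L. restricted_sc_smooth T S k l \<mu> L \<phi>)"

definition rsc_L ::
  "(real^'n^'m) set \<Rightarrow> (real^'n^'m) set \<Rightarrow> nat \<Rightarrow> nat \<Rightarrow> (real^'n^'m \<Rightarrow> real) \<Rightarrow> real" where
  "rsc_L T S k l \<phi> = (LEAST L. \<exists>\<mu>. restricted_sc_smooth T S k l \<mu> L \<phi>)"

definition mu_eff :: "nat \<Rightarrow> nat \<Rightarrow> real \<Rightarrow> real \<Rightarrow> real \<Rightarrow> real" where
  "mu_eff r rs \<mu> L L2 =
     (sqrt ((L + \<mu>)\<^sup>2 + real rs / real r * L2\<^sup>2) - sqrt (real rs / real r) * L2 - (L - \<mu>)) / 2"

end

theory Submission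
  imports Defs
begin

text \<open>
  Write \<open>X = M - M\<^sub>*\<close>, let \<open>P\<close>, \<open>Q\<close> project onto the column and row space of \<open>M\<close>, and let
  \<open>N = (1 - P) M\<^sub>* (1 - Q)\<close>. The first-order condition says that \<open>\<nabla>\<phi>(M)\<close> is \<open>-\<lambda>\<close> times the polar
  factor of \<open>M\<close> plus a corner term. Testing the Hessian on rank-one perturbations bounds that corner
  term by \<open>\<lambda> + L\<^sub>2 \<sigma>\<close> in operator norm (one-sidedly in the symmetric case), where \<open>\<sigma>\<close> is the
  \<open>r\<close>-th singular value of \<open>M\<close>, zero if the rank is smaller.

  For a test matrix \<open>Y = X + (1 - c) N\<close> with \<open>c \<ge> 0\<close>, the mean value theorem and symmetry of the Hessian
  bound \<open>\<langle>\<nabla>\<phi>(M) - \<nabla>\<phi>(M\<^sub>*), Y\<rangle>\<close> from below by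
  \<open>(L + \<mu>) / 2 \<langle>X, Y\<rangle> - (L - \<mu>) / 2 |X| |Y|\<close>. If \<open>M\<close> has rank \<open>r\<close>, then
  \<open>|X + N|\<^sup>2 \<ge> (r - r\<^sub>*) \<sigma>\<^sup>2 + 2 t \<sigma> |N|\<^sub>1 - t\<^sup>2 |N|\<^sup>2\<close> for \<open>0 \<le> t \<le> 1\<close>, with \<open>|N|\<^sub>1\<close> the nuclear norm.
  Optimising over \<open>c\<close> then gives \<open>\<mu>\<^sub>e\<^sub>f\<^sub>f |X| |Y|\<close> up to terms in \<open>\<lambda>\<close> and \<open>\<nabla>\<phi>(M\<^sub>*)\<close>; splitting
  \<open>\<nabla>\<phi>(M\<^sub>*)\<close> into a part of operator norm at most \<open>\<lambda>\<close> and an excess, these contribute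
  \<open>6 \<surd>r\<^sub>* \<lambda> |Y|\<close> and \<open>\<surd>(r + r\<^sub>*) |Y|\<close> times the excess.
\<close>

section \<open>Rank-one sums and singular value decomposition\<close>

text \<open>Testing with X alone (c = 1) gives \<open>\<mu>\<close> |X|^2 up to a loss
  \<open>L2 * s\<close> |N|_1, where \<open>s\<close> is the \<sigma> of the overview. The loss
  comes from the corner of the gradient at M, which second-order criticality controls only weakly.
  Scaling the corner part of the test matrix by c scales this loss, at the price of an angle between
  X and Y. The loss is affordable because a large \<open>s\<close> keeps M away from Ms: Ms has rank
  at most \<open>rs\<close>, so M has \<open>r - rs\<close> singular directions that Ms cannot
  match, and this puts the ratio \<open>rs / r\<close> in front of \<open>L2\<close>. With m = (L +
  \<mu>) / 2 and \<kappa> = sqrt (rs / r) * L2, a suitable c leaves the factor \<tau> > 0 with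
  \<tau> (\<tau> + \<kappa>) = m^2, and \<open>mu_eff\<close> is \<tau> - (L - \<mu>) / 2. Two
  constraints shape the arguments. The Hessian bounds hold only for base points and directions of
  rank at most \<open>r + rs\<close>, so N must be shown to add no rank to that of M and Ms. And
  \<phi> need not be twice continuously differentiable, nor M interior to the cone, so even the
  symmetry of the Hessian has to be proved.\<close>

definition outer :: "real^'m \<Rightarrow> real^'n \<Rightarrow> real^'n^'m" where
  "outer x y = (\<chi> i j. x $ i * y $ j)"

lemma outer_mult_vec: "outer x y *v z = (y \<bullet> z) *\<^sub>R x"
  by (simp add: outer_def matrix_vector_mult_def vec_eq_iff inner_vec_def sum_distrib_left mult_ac)

lemma transpose_outer [simp]: "transpose (outer x y) = outer y x"
  by (simp add: outer_def transpose_def vec_eq_iff mult_ac)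

lemma inner_transpose_mult: "(transpose A *v x) \<bullet> y = x \<bullet> (A *v y)" for A :: "real^'n^'m"
  by (simp add: dot_lmul_matrix)

lemma inner_outer_right: "A \<bullet> outer x y = x \<bullet> (A *v y)" for A :: "real^'n^'m"
  by (simp add: inner_vec_def outer_def matrix_vector_mult_def sum_distrib_left mult_ac)

lemma inner_outer_outer: "outer x y \<bullet> outer x' y' = (x \<bullet> x') * (y \<bullet> y')"
  by (simp add: inner_outer_right outer_mult_vec inner_commute mult_ac)

lemma norm_outer: "norm (outer x y) = norm x * norm y"
  by (simp add: norm_eq_sqrt_inner inner_outer_outer real_sqrt_mult)

lemma mult_outer: "A ** outer x y = outer (A *v x) y"
  by (simp add: outer_def matrix_matrix_mult_def matrix_vector_mult_def vec_eq_iff sum_distrib_left mult_ac)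

lemma outer_mult: "outer x y ** A = outer x (transpose A *v y)"
  by (simp add: outer_def matrix_matrix_mult_def matrix_vector_mult_def transpose_def vec_eq_iff sum_distrib_left mult_ac)

lemma outer_zero [simp]: "outer 0 y = 0" "outer x 0 = 0"
  by (simp_all add: outer_def vec_eq_iff)

lemma outer_minus_left: "outer (- x) y = - outer x y"
  and outer_minus_right: "outer x (- y) = - outer x y"
  and outer_scaleR_left: "outer (c *\<^sub>R x) y = c *\<^sub>R outer x y"
  and outer_scaleR_right: "outer x (c *\<^sub>R y) = c *\<^sub>R outer x y"
  by (simp_all add: outer_def vec_eq_iff algebra_simps)

lemma inner_matrix_mult_left: "(A ** B) \<bullet> C = B \<bullet> (transpose A ** C)"
  for A :: "real^'k^'m" and B :: "real^'n^'k"
proof -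
  have "(A ** B) \<bullet> C = (\<Sum>i\<in>UNIV. \<Sum>j\<in>UNIV. \<Sum>k\<in>UNIV. A$i$k * B$k$j * C$i$j)"
    by (simp add: inner_vec_def matrix_matrix_mult_def sum_distrib_right)
  also have "\<dots> = (\<Sum>i\<in>UNIV. \<Sum>k\<in>UNIV. \<Sum>j\<in>UNIV. A$i$k * B$k$j * C$i$j)"
    by (intro sum.cong refl sum.swap)
  also have "\<dots> = (\<Sum>k\<in>UNIV. \<Sum>i\<in>UNIV. \<Sum>j\<in>UNIV. A$i$k * B$k$j * C$i$j)"
    by (rule sum.swap)
  also have "\<dots> = (\<Sum>k\<in>UNIV. \<Sum>j\<in>UNIV. \<Sum>i\<in>UNIV. A$i$k * B$k$j * C$i$j)"
    by (intro sum.cong refl sum.swap)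
  also have "\<dots> = B \<bullet> (transpose A ** C)"
    by (simp add: inner_vec_def matrix_matrix_mult_def transpose_def sum_distrib_left mult_ac)
  finally show ?thesis .
qed

lemma inner_transpose_transpose: "transpose A \<bullet> transpose B = A \<bullet> B" for A B :: "real^'n^'m"
  unfolding inner_vec_def transpose_def by (simp, rule sum.swap)

lemma inner_matrix_mult_right: "(A ** B) \<bullet> C = A \<bullet> (C ** transpose B)"
  for A :: "real^'k^'m" and B :: "real^'n^'k"
proof -
  have "(A ** B) \<bullet> C = (transpose B ** transpose A) \<bullet> transpose C"
    by (metis inner_transpose_transpose matrix_transpose_mul)
  also have "\<dots> = transpose A \<bullet> transpose (C ** transpose B)"
    by (simp add: inner_matrix_mult_left matrix_transpose_mul)
  finally show ?thesis by (simp add: inner_transpose_transpose)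
qed

lemma
  fixes A A' :: "real^'k^'m" and B B' :: "real^'n^'k"
  shows matrix_mult_scaleR_left: "(c *\<^sub>R A) ** B = c *\<^sub>R (A ** B)"
    and matrix_mult_scaleR_right: "A ** (c *\<^sub>R B) = c *\<^sub>R (A ** B)"
    and matrix_mult_uminus_left: "(- A) ** B = - (A ** B)"
    and matrix_mult_uminus_right: "A ** (- B) = - (A ** B)"
    and matrix_mult_diff_left: "(A - A') ** B = A ** B - A' ** B"
    and matrix_mult_diff_right: "A ** (B - B') = A ** B - A ** B'"
    and matrix_mult_add_left: "(A + A') ** B = A ** B + A' ** B"
    and matrix_mult_add_right: "A ** (B + B') = A ** B + A ** B'"
    and matrix_mult_zero_left: "0 ** B = (0 :: real^'n^'m)"
    and matrix_mult_zero_right: "A ** 0 = (0 :: real^'n^'m)"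
  by (simp_all add: matrix_matrix_mult_def vec_eq_iff sum_distrib_left sum_negf sum_subtractf
      sum.distrib algebra_simps)

lemma transpose_diff: "transpose (A - B) = transpose A - transpose B"
  and transpose_add: "transpose (A + B) = transpose A + transpose B"
  and transpose_zero: "transpose 0 = 0"
  for A B :: "real^'n^'m"
  by (simp_all add: transpose_def vec_eq_iff)

lemmas matrix_mult_simps = matrix_mult_scaleR_left matrix_mult_scaleR_right
  matrix_mult_diff_left matrix_mult_diff_right matrix_mult_add_left matrix_mult_add_right
  matrix_mult_zero_left matrix_mult_zero_right matrix_mult_uminus_left matrix_mult_uminus_right

lemma linear_transpose: "linear (transpose :: real^'n^'m \<Rightarrow> real^'m^'n)"
  by (rule linearI) (simp_all add: transpose_add transpose_scalar)

lemma matrix_mult_sum_left: "(\<Sum>i\<in>I. f i) ** B = (\<Sum>i\<in>I. f i ** B)" for B :: "real^'n^'k"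
  by (induction I rule: infinite_finite_induct) (simp_all add: matrix_mult_simps)

lemma matrix_mult_sum_right: "B ** (\<Sum>i\<in>I. f i) = (\<Sum>i\<in>I. B ** f i)" for B :: "real^'n^'k"
  by (induction I rule: infinite_finite_induct) (simp_all add: matrix_mult_simps)

lemma matrix_vector_sum_left: "(\<Sum>i\<in>I. f i) *v x = (\<Sum>i\<in>I. f i *v x)" for x :: "real^'n"
  by (induction I rule: infinite_finite_induct) (simp_all add: matrix_vector_mult_add_rdistrib)

lemma transpose_sum: "transpose (\<Sum>i\<in>I. f i) = (\<Sum>i\<in>I. transpose (f i))"
  for f :: "'i \<Rightarrow> real^'n^'m"
  using linear_sum[OF linear_transpose] by blast

lemma scaleR_matrix_vector: "(c *\<^sub>R A) *v x = c *\<^sub>R (A *v x)" for A :: "real^'n^'m"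
  by (simp add: scaleR_matrix_vector_assoc)

lemma uminus_matrix_vector: "(- A) *v x = - (A *v x)" for A :: "real^'n^'m"
  by (metis scaleR_matrix_vector scaleR_minus1_left)

section \<open>Rank inequalities\<close>

lemma rank_le_subspace:
  fixes A :: "real^'n^'m"
  assumes "\<And>x. A *v x \<in> S"
  shows "rank A \<le> dim S"
  unfolding rank_dim_range using assms by (intro dim_subset) auto

lemma rank_add_le: "rank (A + B) \<le> rank A + rank B" for A B :: "real^'n^'m"
proof -
  let ?S = "range ((*v) A)" and ?T = "range ((*v) B)"
  have sub: "subspace ?S" "subspace ?T"
    by (auto intro!: linear_subspace_image matrix_vector_mul_linear subspace_UNIV)
  have "rank (A + B) \<le> dim {x + y |x y. x \<in> ?S \<and> y \<in> ?T}"
    by (rule rank_le_subspace) (auto simp: matrix_vector_mult_add_rdistrib)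
  also have "\<dots> \<le> rank A + rank B"
    unfolding rank_dim_range using dim_sums_Int[OF sub] by linarith
  finally show ?thesis .
qed

lemma rank_scaleR_le: "rank (c *\<^sub>R A) \<le> rank A" for A :: "real^'n^'m"
  unfolding rank_dim_range[of A]
  by (rule rank_le_subspace) (simp add: scaleR_matrix_vector flip: matrix_vector_mult_scaleR)

lemma rank_outer_le: "rank (outer x y) \<le> 1"
proof -
  have "rank (outer x y) \<le> dim (span {x})"
    by (rule rank_le_subspace) (simp add: outer_mult_vec span_base span_mul)
  also have "\<dots> \<le> 1"
    using dim_le_card[of "span {x}" "{x}"] by simp
  finally show ?thesis .
qed

lemma rank_sum_outer_le: "finite I \<Longrightarrow> rank (\<Sum>i\<in>I. c i *\<^sub>R outer (x i) (y i)) \<le> card I"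
proof (induction I rule: finite_induct)
  case (insert i I)
  have "rank (c i *\<^sub>R outer (x i) (y i)) \<le> 1"
    using rank_scaleR_le rank_outer_le order_trans by blast
  then show ?case
    using insert rank_add_le[of "c i *\<^sub>R outer (x i) (y i)" "\<Sum>i\<in>I. c i *\<^sub>R outer (x i) (y i)"]
    by simp
qed simp

section \<open>Thin singular value decomposition and its consequences\<close>

definition orthonormal :: "nat \<Rightarrow> (nat \<Rightarrow> 'a::real_inner) \<Rightarrow> bool" where
  "orthonormal k u \<longleftrightarrow> (\<forall>i<k. \<forall>j<k. u i \<bullet> u j = (if i = j then 1 else 0))"

text \<open>Thin form: only strictly positive singular values are listed, so \<open>k\<close> is the
  rank and division by \<open>\<sigma> i\<close> is safe. Families are indexed by naturals below
  \<open>k\<close> because the rank is a value, not the cardinality of a type. The descending order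
  makes \<open>\<sigma> (k - 1)\<close> the smallest one.\<close>

definition svd :: "real^'n^'m \<Rightarrow> nat \<Rightarrow> (nat \<Rightarrow> real) \<Rightarrow> (nat \<Rightarrow> real^'m) \<Rightarrow> (nat \<Rightarrow> real^'n) \<Rightarrow> bool"
where
  "svd A k \<sigma> u v \<longleftrightarrow> (\<forall>i<k. 0 < \<sigma> i) \<and> (\<forall>i<k. \<forall>j<k. i \<le> j \<longrightarrow> \<sigma> j \<le> \<sigma> i) \<and>
     orthonormal k u \<and> orthonormal k v \<and> A = (\<Sum>i<k. \<sigma> i *\<^sub>R outer (u i) (v i))"

lemma sum_lessThan_delta:
  fixes f :: "nat \<Rightarrow> 'a::real_vector"
  assumes "j < k" "\<And>i. i < k \<Longrightarrow> g i = (if i = j then (1::real) else 0)"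
  shows "(\<Sum>i<k. g i *\<^sub>R f i) = f j"
proof -
  have "(\<Sum>i<k. g i *\<^sub>R f i) = (\<Sum>i<k. if i = j then f i else 0)"
    by (rule sum.cong) (auto simp: assms(2))
  then show ?thesis using assms(1) by simp
qed

text \<open>\<open>v\<close> maximises |A x| on the unit sphere and \<open>u\<close> is its
  normalised image. The transpose obeys the same bound \<open>s\<close>, so expanding |A^T u - s
  v|^2 leaves at most s^2 - 2 s^2 + s^2 = 0.\<close>

lemma top_singular_vectors:
  fixes A :: "real^'n^'m"
  assumes "A \<noteq> 0"
  obtains s u v where "s > 0" "norm u = 1" "norm v = 1" "A *v v = s *\<^sub>R u" "transpose A *v u = s *\<^sub>R v"
    "\<And>x. norm (A *v x) \<le> s * norm x"
proof -
  have "compact (sphere (0::real^'n) 1)" by simp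
  moreover have "sphere (0::real^'n) 1 \<noteq> {}" by simp
  moreover have "continuous_on (sphere (0::real^'n) 1) (\<lambda>x. norm (A *v x))"
    by (intro continuous_intros)
  ultimately obtain v where v: "norm v = 1" "\<And>x. norm x = 1 \<Longrightarrow> norm (A *v x) \<le> norm (A *v v)"
    using continuous_attains_sup[of "sphere (0::real^'n) 1" "\<lambda>x. norm (A *v x)"] by auto
  define s where "s = norm (A *v v)"
  have bound: "norm (A *v x) \<le> s * norm x" for x
  proof (cases "x = 0")
    case False
    have "norm (A *v (x /\<^sub>R norm x)) \<le> s"
      unfolding s_def by (rule v(2)) (use False in simp)
    then have "norm (A *v x) / norm x \<le> s"
      by (simp add: matrix_vector_mult_scaleR divide_inverse mult.commute)
    then show ?thesis using False by (simp add: divide_le_eq)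
  qed simp
  have s: "s > 0"
  proof (rule ccontr)
    assume "\<not> s > 0"
    then have "s = 0" by (simp add: s_def)
    then have "A *v x = 0" for x using bound[of x] by simp
    then have "A = 0" by (metis matrix_eq matrix_vector_mult_0)
    with assms show False by simp
  qed
  define u where "u = (A *v v) /\<^sub>R s"
  have Av: "A *v v = s *\<^sub>R u" using s by (simp add: u_def)
  have nu: "norm u = 1" using s by (simp add: u_def s_def)
  have boundT: "norm (transpose A *v z) \<le> s * norm z" for z
  proof -
    let ?w = "transpose A *v z"
    have "norm ?w * norm ?w = ?w \<bullet> ?w" by (simp add: dot_square_norm power2_eq_square)
    also have "\<dots> = z \<bullet> (A *v ?w)" by (rule inner_transpose_mult)
    also have "\<dots> \<le> norm z * norm (A *v ?w)" by (rule norm_cauchy_schwarz)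
    also have "\<dots> \<le> norm z * (s * norm ?w)" using bound by (intro mult_left_mono) auto
    finally have "norm ?w * norm ?w \<le> (s * norm z) * norm ?w" by (simp add: mult_ac)
    then show ?thesis
      by (cases "norm ?w = 0") (use s in \<open>auto simp: mult_le_cancel_right\<close>)
  qed
  have "(norm (transpose A *v u - s *\<^sub>R v))\<^sup>2
      = (norm (transpose A *v u))\<^sup>2 - 2 * s * ((transpose A *v u) \<bullet> v) + s\<^sup>2 * (norm v)\<^sup>2"
    unfolding power2_norm_eq_inner
    by (simp add: inner_diff_left inner_diff_right inner_commute algebra_simps power2_eq_square)
  also have "(transpose A *v u) \<bullet> v = s"
    using nu by (simp add: inner_transpose_mult Av dot_square_norm del: transpose_matrix_vector)
  also have "(norm (transpose A *v u))\<^sup>2 \<le> s\<^sup>2"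
    using boundT[of u] nu by (intro power_mono) auto
  finally have "(norm (transpose A *v u - s *\<^sub>R v))\<^sup>2 \<le> 0"
    using v by (simp add: power2_eq_square)
  then have "transpose A *v u = s *\<^sub>R v" by simp
  with that s nu v(1) Av bound show thesis by blast
qed

text \<open>Deflation: subtracting the top singular pair lowers the rank, because \<open>u\<close>
  lies in the range of \<open>A\<close> but is orthogonal to the range of the remainder
  \<open>B\<close>. The singular vectors of \<open>B\<close> are orthogonal to \<open>u\<close> and
  \<open>v\<close> and its singular values are at most \<open>s\<close>, so they extend the list in
  order.\<close>

lemma svd_exists:
  fixes A :: "real^'n^'m"
  shows "\<exists>k \<sigma> u v. svd A k \<sigma> u v \<and> k \<le> rank A"
proof (induction "rank A" arbitrary: A rule: less_induct)
  case less
  show ?case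
  proof (cases "A = 0")
    case True
    then have "svd A 0 (\<lambda>_. 0) (\<lambda>_. 0) (\<lambda>_. 0)" by (simp add: svd_def orthonormal_def)
    then show ?thesis by blast
  next
    case False
    then obtain s u v where s: "s > 0" and nu: "norm u = 1" and nv: "norm v = 1"
      and Av: "A *v v = s *\<^sub>R u" and Au: "transpose A *v u = s *\<^sub>R v"
      and bd: "\<And>x. norm (A *v x) \<le> s * norm x"
      using top_singular_vectors[OF False] by blast
    define B where "B = A - s *\<^sub>R outer u v"
    have Bx: "B *v x = A *v x - (s * (v \<bullet> x)) *\<^sub>R u" for x
      by (simp add: B_def matrix_vector_mult_diff_rdistrib scaleR_matrix_vector outer_mult_vec)
    have uu: "u \<bullet> u = 1" and vv: "v \<bullet> v = 1" using nu nv by (simp_all add: dot_square_norm)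
    have uB: "u \<bullet> (B *v x) = 0" for x
    proof -
      have "u \<bullet> (A *v x) = s * (v \<bullet> x)"
        by (metis Au inner_transpose_mult inner_scaleR_left)
      then show ?thesis by (simp add: Bx inner_diff_right uu)
    qed
    have Bv: "B *v v = 0" by (simp add: Bx Av vv)
    have u_eq: "u = A *v (v /\<^sub>R s)" using s by (simp add: matrix_vector_mult_scaleR Av)
    have rank_less: "rank B < rank A"
    proof -
      have B_eq: "B *v x = A *v (x - (v \<bullet> x) *\<^sub>R v)" for x
        by (simp add: Bx matrix_vector_mult_diff_distrib matrix_vector_mult_scaleR Av mult.commute)
      have "range ((*v) B) \<subset> range ((*v) A)"
      proof
        show "range ((*v) B) \<subseteq> range ((*v) A)" using B_eq by auto
        have "u \<in> range ((*v) A)" using u_eq by blast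
        moreover have "u \<notin> range ((*v) B)" using uB uu by force
        ultimately show "range ((*v) B) \<noteq> range ((*v) A)" by blast
      qed
      moreover have "subspace (range ((*v) A))" "subspace (range ((*v) B))"
        by (auto intro!: linear_subspace_image matrix_vector_mul_linear subspace_UNIV)
      ultimately have "span (range ((*v) B)) \<subset> span (range ((*v) A))" by (metis span_eq_iff)
      then show ?thesis unfolding rank_dim_range by (rule dim_psubset)
    qed
    then obtain k \<sigma> a b where svd: "svd B k \<sigma> a b" and k: "k \<le> rank B"
      using less by blast
    have pos: "\<And>i. i < k \<Longrightarrow> 0 < \<sigma> i" and mono: "\<And>i j. i < k \<Longrightarrow> j < k \<Longrightarrow> i \<le> j \<Longrightarrow> \<sigma> j \<le> \<sigma> i"
      and oa: "orthonormal k a" and ob: "orthonormal k b"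
      and B: "B = (\<Sum>i<k. \<sigma> i *\<^sub>R outer (a i) (b i))"
      using svd by (auto simp: svd_def)
    have Bb: "B *v b i = \<sigma> i *\<^sub>R a i" if "i < k" for i
    proof -
      have "B *v b i = (\<Sum>j<k. (b j \<bullet> b i) *\<^sub>R (\<sigma> j *\<^sub>R a j))"
        by (simp add: B matrix_vector_sum_left scaleR_matrix_vector outer_mult_vec mult.commute)
      also have "\<dots> = \<sigma> i *\<^sub>R a i"
        by (rule sum_lessThan_delta) (use that ob in \<open>auto simp: orthonormal_def\<close>)
      finally show ?thesis .
    qed
    have ua: "u \<bullet> a i = 0" if "i < k" for i
      using uB[of "b i"] pos[OF that] by (simp add: Bb[OF that])
    have vb: "v \<bullet> b i = 0" if "i < k" for i
    proof -
      have "transpose B *v a i = (\<Sum>j<k. (a j \<bullet> a i) *\<^sub>R (\<sigma> j *\<^sub>R b j))"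
        by (simp add: B transpose_sum transpose_scalar matrix_vector_sum_left scaleR_matrix_vector
            outer_mult_vec mult.commute del: transpose_matrix_vector)
      also have "\<dots> = \<sigma> i *\<^sub>R b i"
        by (rule sum_lessThan_delta) (use that oa in \<open>auto simp: orthonormal_def\<close>)
      finally have "(\<sigma> i *\<^sub>R b i) \<bullet> v = 0" by (metis inner_transpose_mult Bv inner_zero_right)
      then show ?thesis using pos[OF that] by (simp add: inner_commute)
    qed
    have le_s: "\<sigma> i \<le> s" if "i < k" for i
    proof -
      have "norm (B *v b i) \<le> s * norm (b i)"
        using vb[OF that] bd[of "b i"] by (simp add: Bx)
      moreover have "norm (a i) = 1" "norm (b i) = 1"
        using oa ob that by (auto simp: orthonormal_def norm_eq_1)
      ultimately show ?thesis using pos[OF that] by (simp add: Bb[OF that])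
    qed
    define \<sigma>' where "\<sigma>' = case_nat s \<sigma>"
    define u' where "u' = case_nat u a"
    define v' where "v' = case_nat v b"
    have "svd A (Suc k) \<sigma>' u' v'"
      unfolding svd_def
    proof (intro conjI allI impI)
      fix i assume "i < Suc k" then show "0 < \<sigma>' i"
        using s pos by (auto simp: \<sigma>'_def split: nat.split)
    next
      fix i j assume "i < Suc k" "j < Suc k" "i \<le> j" then show "\<sigma>' j \<le> \<sigma>' i"
        using le_s mono by (auto simp: \<sigma>'_def split: nat.split)
    next
      show "orthonormal (Suc k) u'"
        using oa ua uu by (auto simp: orthonormal_def u'_def inner_commute split: nat.split)
      show "orthonormal (Suc k) v'"
        using ob vb vv by (auto simp: orthonormal_def v'_def inner_commute split: nat.split)
      have "A = s *\<^sub>R outer u v + B" by (simp add: B_def)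
      then show "A = (\<Sum>i<Suc k. \<sigma>' i *\<^sub>R outer (u' i) (v' i))"
        by (simp add: sum.lessThan_Suc_shift \<sigma>'_def u'_def v'_def B del: sum.lessThan_Suc)
    qed
    moreover have "Suc k \<le> rank A" using k rank_less by simp
    ultimately show ?thesis by blast
  qed
qed

context
  fixes A :: "real^'n^'m" and k \<sigma> u v
  assumes svd: "svd A k \<sigma> u v"
begin

lemma svd_pos: "i < k \<Longrightarrow> 0 < \<sigma> i"
  and svd_mono: "i < k \<Longrightarrow> j < k \<Longrightarrow> i \<le> j \<Longrightarrow> \<sigma> j \<le> \<sigma> i"
  and svd_orthonormal_left: "orthonormal k u"
  and svd_orthonormal_right: "orthonormal k v"
  and svd_eq: "A = (\<Sum>i<k. \<sigma> i *\<^sub>R outer (u i) (v i))"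
  using svd by (auto simp: svd_def)

lemma svd_mult_right: "i < k \<Longrightarrow> A *v v i = \<sigma> i *\<^sub>R u i"
proof -
  assume i: "i < k"
  have "A *v v i = (\<Sum>j<k. (v j \<bullet> v i) *\<^sub>R (\<sigma> j *\<^sub>R u j))"
    by (simp add: svd_eq matrix_vector_sum_left scaleR_matrix_vector outer_mult_vec mult.commute)
  also have "\<dots> = \<sigma> i *\<^sub>R u i"
    by (rule sum_lessThan_delta) (use i svd_orthonormal_right in \<open>auto simp: orthonormal_def\<close>)
  finally show ?thesis .
qed

lemma svd_transpose: "svd (transpose A) k \<sigma> v u"
  using svd by (auto simp: svd_def transpose_sum transpose_scalar)

lemma svd_rank: "rank A \<le> k"
  using rank_sum_outer_le[of "{..<k}" \<sigma> u v] by (simp flip: svd_eq)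

lemma svd_norm: "(norm A)\<^sup>2 = (\<Sum>i<k. (\<sigma> i)\<^sup>2)"
proof -
  have "A \<bullet> A = (\<Sum>i<k. \<sigma> i * (A \<bullet> outer (u i) (v i)))"
    by (subst (2) svd_eq) (simp add: inner_sum_right)
  also have "\<dots> = (\<Sum>i<k. \<sigma> i * \<sigma> i)"
    using svd_orthonormal_left
    by (intro sum.cong refl) (simp add: inner_outer_right svd_mult_right orthonormal_def)
  finally show ?thesis unfolding power2_norm_eq_inner by (simp add: power2_eq_square)
qed

end

lemma svd_mult_left: "svd A k \<sigma> u v \<Longrightarrow> i < k \<Longrightarrow> transpose A *v u i = \<sigma> i *\<^sub>R v i"
  using svd_mult_right svd_transpose by blast

lemma orthonormal_norm: "orthonormal k u \<Longrightarrow> i < k \<Longrightarrow> norm (u i) = 1"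
  by (simp add: orthonormal_def norm_eq_1)

lemma sum_le_sqrt_mult_norm:
  assumes "\<And>i. i < k \<Longrightarrow> (0::real) \<le> n i"
  shows "(\<Sum>i<k. n i) \<le> sqrt (real k) * sqrt (\<Sum>i<k. (n i)\<^sup>2)"
proof -
  have "(\<Sum>i<k. 1 * n i)\<^sup>2 \<le> (\<Sum>i<k. 1\<^sup>2) * (\<Sum>i<k. (n i)\<^sup>2)"
    by (rule Cauchy_Schwarz_ineq_sum)
  then show ?thesis
    by (simp add: real_le_rsqrt flip: real_sqrt_mult)
qed

text \<open>Duality of operator and nuclear norm, then nuclear norm at most sqrt (rank) times
  Frobenius norm. The operator norm enters as a pointwise bound \<open>g\<close>, which suits the
  scaled pieces of a gradient used later.\<close>

lemma inner_le_rank: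
  fixes G Z :: "real^'n^'m"
  assumes G: "\<And>x. norm (G *v x) \<le> g * norm x" and g: "0 \<le> g" and r: "rank Z \<le> r"
  shows "\<bar>G \<bullet> Z\<bar> \<le> g * sqrt (real r) * norm Z"
proof -
  obtain k \<sigma> u v where svd: "svd Z k \<sigma> u v" and k: "k \<le> rank Z" using svd_exists by blast
  have "\<bar>G \<bullet> Z\<bar> = \<bar>\<Sum>i<k. \<sigma> i * (u i \<bullet> (G *v v i))\<bar>"
    by (simp add: svd_eq[OF svd] inner_sum_right inner_outer_right)
  also have "\<dots> \<le> (\<Sum>i<k. \<bar>\<sigma> i * (u i \<bullet> (G *v v i))\<bar>)" by (rule sum_abs)
  also have "\<dots> \<le> (\<Sum>i<k. \<sigma> i * g)"
  proof (rule sum_mono)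
    fix i assume "i \<in> {..<k}"
    then have i: "i < k" by simp
    have "\<bar>u i \<bullet> (G *v v i)\<bar> \<le> norm (u i) * norm (G *v v i)" by (rule Cauchy_Schwarz_ineq2)
    also have "\<dots> \<le> g"
      using G[of "v i"] orthonormal_norm[OF svd_orthonormal_left[OF svd] i]
        orthonormal_norm[OF svd_orthonormal_right[OF svd] i] by simp
    finally show "\<bar>\<sigma> i * (u i \<bullet> (G *v v i))\<bar> \<le> \<sigma> i * g"
      using svd_pos[OF svd i] by (simp add: abs_mult)
  qed
  also have "\<dots> = g * (\<Sum>i<k. \<sigma> i)" by (simp add: sum_distrib_left mult.commute)
  also have "\<dots> \<le> g * (sqrt (real k) * sqrt (\<Sum>i<k. (\<sigma> i)\<^sup>2))"
    using svd_pos[OF svd] g by (intro mult_left_mono sum_le_sqrt_mult_norm) (auto intro: less_imp_le)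
  also have "sqrt (\<Sum>i<k. (\<sigma> i)\<^sup>2) = norm Z"
    by (simp flip: svd_norm[OF svd])
  also have "g * (sqrt (real k) * norm Z) \<le> g * (sqrt (real r) * norm Z)"
    using k r g by (intro mult_left_mono mult_right_mono) auto
  finally show ?thesis by (simp add: mult.assoc)
qed

text \<open>\<open>F\<close> is the orthogonal projection onto the column space and \<open>C\<close>
  the Moore-Penrose inverse. The factorisation \<open>F = A ** C\<close> transfers left identities
  of \<open>A\<close> to \<open>F\<close>.\<close>

lemma range_projection_exists:
  fixes A :: "real^'n^'m"
  obtains F C where "transpose F = F" "F ** F = F" "F ** A = A" "F = A ** C" "rank F \<le> rank A"
proof -
  obtain k \<sigma> u v where svd: "svd A k \<sigma> u v" and k: "k \<le> rank A" using svd_exists by blast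
  define F where "F = (\<Sum>i<k. outer (u i) (u i))"
  define C where "C = (\<Sum>i<k. (1 / \<sigma> i) *\<^sub>R outer (v i) (u i))"
  have Fu: "F *v u i = u i" if "i < k" for i
    unfolding F_def matrix_vector_sum_left outer_mult_vec
    by (rule sum_lessThan_delta) (use that svd_orthonormal_left[OF svd] in \<open>auto simp: orthonormal_def\<close>)
  have "transpose F = F" by (simp add: F_def transpose_sum)
  moreover have "F ** F = F"
    by (subst (2) F_def) (simp add: matrix_mult_sum_right mult_outer Fu, simp add: F_def)
  moreover have "F ** A = A"
    by (subst (1 2) svd_eq[OF svd]) (simp add: matrix_mult_sum_right mult_outer Fu matrix_mult_simps)
  moreover have "F = A ** C"
    unfolding C_def F_def matrix_mult_sum_right
    by (intro sum.cong refl)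
      (use svd_pos[OF svd] in \<open>force simp: matrix_mult_simps mult_outer svd_mult_right[OF svd] outer_scaleR_left\<close>)
  moreover have "rank F \<le> rank A"
    using rank_sum_outer_le[of "{..<k}" "\<lambda>_. 1" u u] k by (simp add: F_def)
  ultimately show thesis using that by blast
qed

lemma op_norm_bound: "norm (A *v x) \<le> op_norm A * norm x" for A :: "real^'n^'m"
  unfolding op_norm_def by (rule onorm[OF matrix_vector_mul_bounded_linear])

lemma op_norm_nonneg: "0 \<le> op_norm A" for A :: "real^'n^'m"
  unfolding op_norm_def by (rule onorm_pos_le[OF matrix_vector_mul_bounded_linear])

section \<open>Derivatives relative to a cone\<close>

lemma has_derivative_along_line:
  assumes "(f has_derivative D) (at (x + t *\<^sub>R h) within S)" "\<And>u. u \<in> A \<Longrightarrow> x + u *\<^sub>R h \<in> S"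
  shows "((\<lambda>u. f (x + u *\<^sub>R h)) has_derivative (\<lambda>u. D (u *\<^sub>R h))) (at t within A)"
proof -
  have "((\<lambda>u. x + u *\<^sub>R h) has_derivative (\<lambda>u. u *\<^sub>R h)) (at t within A)"
    by (auto intro!: derivative_eq_intros)
  moreover have "(f has_derivative D) (at (x + t *\<^sub>R h) within (\<lambda>u. x + u *\<^sub>R h) ` A)"
    by (rule has_derivative_subset[OF assms(1)]) (use assms(2) in auto)
  ultimately show ?thesis by (rule has_derivative_in_compose)
qed

text \<open>
  Both cases of the theorem are instances: \<open>S\<close> is a convex cone spanning the subspace \<open>T\<close>. Since
  \<open>x + p\<close> stays in \<open>S\<close> for all \<open>x, p \<in> S\<close>, derivatives at boundary points are determined by the
  directions \<open>p \<in> S\<close>.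
\<close>

locale cone_pair =
  fixes T S :: "'a::euclidean_space set"
  assumes subspace_T: "subspace T"
    and S_subset: "S \<subseteq> T"
    and S_add: "x \<in> S \<Longrightarrow> y \<in> S \<Longrightarrow> x + y \<in> S"
    and S_scale: "x \<in> S \<Longrightarrow> 0 \<le> t \<Longrightarrow> t *\<^sub>R x \<in> S"
    and S_generates: "h \<in> T \<Longrightarrow> \<exists>p\<in>S. \<exists>q\<in>S. h = p - q"
begin

lemma derivative_unique_on:
  fixes f :: "'a \<Rightarrow> 'b::real_normed_vector"
  assumes D: "(f has_derivative D1) (at x within S)" "(f has_derivative D2) (at x within S)"
    and x: "x \<in> S" and h: "h \<in> T"
  shows "D1 h = D2 h"
proof -
  have *: "D1 p = D2 p" if p: "p \<in> S" for p
  proof -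
    have dir: "((\<lambda>u. f (x + u *\<^sub>R p)) has_derivative (\<lambda>u. E (u *\<^sub>R p))) (at 0 within cbox 0 1)"
      if "(f has_derivative E) (at x within S)" for E
      by (rule has_derivative_along_line[where S = S]) (use that x p in \<open>auto intro!: S_add S_scale\<close>)
    have "(\<lambda>u::real. D1 (u *\<^sub>R p)) = (\<lambda>u. D2 (u *\<^sub>R p))"
      by (rule frechet_derivative_unique_within_closed_interval[OF _ _ dir[OF D(1)] dir[OF D(2)]]) auto
    from fun_cong[OF this, of 1] show ?thesis by simp
  qed
  obtain p q where "p \<in> S" "q \<in> S" "h = p - q" using S_generates[OF h] by blast
  then show ?thesis
    using * linear_diff[OF has_derivative_linear[OF D(1)]] linear_diff[OF has_derivative_linear[OF D(2)]]
    by simp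
qed

text \<open>A derivative within \<open>S\<close> is only tested on differences of points of
  \<open>S\<close>, which lie in \<open>T\<close>. Dropping the part of its Riesz vector orthogonal
  to \<open>T\<close> leaves a gradient in \<open>T\<close>, and uniqueness on \<open>T\<close>
  makes the \<open>THE\<close> in \<open>grad_on\<close> well defined.\<close>

lemma
  assumes f: "f differentiable_on S" and x: "x \<in> S"
  shows grad_on_mem: "grad_on T S f x \<in> T"
    and has_derivative_grad_on: "(f has_derivative (\<lambda>h. grad_on T S f x \<bullet> h)) (at x within S)"
proof -
  obtain D where D: "(f has_derivative D) (at x within S)"
    using f x by (auto simp: differentiable_on_def differentiable_def)
  have lin: "linear D" using D by (rule has_derivative_linear)
  define g0 where "g0 = adjoint D 1"
  have g0: "D h = g0 \<bullet> h" for h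
    using adjoint_works[OF lin, of h 1] by (simp add: g0_def inner_commute)
  obtain g z where g: "g \<in> span T" and z: "\<And>w. w \<in> span T \<Longrightarrow> orthogonal z w" and gz: "g0 = g + z"
    using orthogonal_subspace_decomp_exists[of T g0] by metis
  have spanT: "span T = T" using subspace_T by (metis span_eq_iff)
  have eq: "D h = g \<bullet> h" if "h \<in> T" for h
    using z[of h] that by (simp add: g0 gz spanT inner_add_left orthogonal_def)
  have "(f has_derivative (\<lambda>h. g \<bullet> h)) (at x within S)"
    unfolding has_derivative_within_alt
  proof (intro conjI allI impI)
    show "bounded_linear (\<lambda>h. g \<bullet> h)" by (rule bounded_linear_inner_right)
    fix e :: real assume "e > 0"
    then obtain d where d: "d > 0" "\<And>y. y \<in> S \<Longrightarrow> norm (y - x) < d \<Longrightarrow>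
        norm (f y - f x - D (y - x)) \<le> e * norm (y - x)"
      using D unfolding has_derivative_within_alt by meson
    have "y - x \<in> T" if "y \<in> S" for y
      using that x S_subset subspace_diff[OF subspace_T] by blast
    then show "\<exists>d>0. \<forall>y\<in>S. norm (y - x) < d \<longrightarrow> norm (f y - f x - g \<bullet> (y - x)) \<le> e * norm (y - x)"
      using d eq by (intro exI[of _ d]) auto
  qed
  moreover have "g \<in> T" using g spanT by simp
  moreover have "g' = g" if "g' \<in> T" "(f has_derivative (\<lambda>h. g' \<bullet> h)) (at x within S)" for g'
  proof -
    have "g' - g \<in> T" using that(1) \<open>g \<in> T\<close> subspace_diff[OF subspace_T] by blast
    then have "g' \<bullet> (g' - g) = g \<bullet> (g' - g)"
      using derivative_unique_on[OF that(2) calculation(1) x] by simp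
    then have "(g' - g) \<bullet> (g' - g) = 0" by (simp only: inner_diff_left)
    then show ?thesis by simp
  qed
  ultimately have "\<exists>!g. g \<in> T \<and> (f has_derivative (\<lambda>h. g \<bullet> h)) (at x within S)" by blast
  from theI'[OF this] show "grad_on T S f x \<in> T"
    and "(f has_derivative (\<lambda>h. grad_on T S f x \<bullet> h)) (at x within S)"
    unfolding grad_on_def by blast+
qed

context
  fixes f :: "'a \<Rightarrow> real"
  assumes f: "twice_differentiable_on T S f"
begin

abbreviation (input) "grad \<equiv> grad_on T S f"
abbreviation (input) "hess x \<equiv> frechet_derivative (grad_on T S f) (at x within S)"

lemma has_derivative_grad: "x \<in> S \<Longrightarrow> (f has_derivative (\<lambda>h. grad x \<bullet> h)) (at x within S)"
  using f has_derivative_grad_on by (auto simp: twice_differentiable_on_def)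

lemma grad_mem: "x \<in> S \<Longrightarrow> grad x \<in> T"
  using f grad_on_mem by (auto simp: twice_differentiable_on_def)

lemma has_derivative_hess: "x \<in> S \<Longrightarrow> (grad has_derivative hess x) (at x within S)"
  using f by (auto simp: twice_differentiable_on_def differentiable_on_def frechet_derivative_works)

lemma linear_hess: "x \<in> S \<Longrightarrow> linear (hess x)"
  using has_derivative_hess has_derivative_linear by blast

text \<open>The gradient takes values in \<open>T\<close>, so its pairing with a vector
  \<open>z\<close> orthogonal to \<open>T\<close> vanishes on \<open>S\<close>; hence so does the
  pairing of \<open>z\<close> with the derivative of the gradient.\<close>

lemma hess_mem:
  assumes x: "x \<in> S" and h: "h \<in> T"
  shows "hess x h \<in> T"
proof -
  have spanT: "span T = T" using subspace_T by (metis span_eq_iff)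
  obtain g z where g: "g \<in> span T" and z: "\<And>w. w \<in> span T \<Longrightarrow> orthogonal z w"
    and gz: "hess x h = g + z"
    using orthogonal_subspace_decomp_exists[of T "hess x h"] by metis
  have "((\<lambda>y. grad y \<bullet> z) has_derivative (\<lambda>h. hess x h \<bullet> z)) (at x within S)"
    by (rule has_derivative_inner_left[OF has_derivative_hess[OF x]])
  moreover have "((\<lambda>y. grad y \<bullet> z) has_derivative (\<lambda>h. 0)) (at x within S)"
  proof (rule has_derivative_transform[OF x, of _ "\<lambda>_. 0"])
    show "grad y \<bullet> z = 0" if "y \<in> S" for y
      using z[of "grad y"] grad_mem[OF that] by (metis spanT orthogonal_def inner_commute)
  qed simp
  ultimately have "hess x h \<bullet> z = 0" by (rule derivative_unique_on[OF _ _ x h])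
  moreover have "g \<bullet> z = 0" using z[OF g] by (simp add: orthogonal_def inner_commute)
  ultimately have "z = 0" by (simp add: gz inner_add_left)
  then show ?thesis using g gz spanT by simp
qed

text \<open>Peano's route to a symmetric second derivative without continuity: the mean value
  theorem is applied to the difference of \<open>f\<close> along two parallel segments, and of the
  gradient only differentiability at \<open>x\<close> itself is used. Both directions lie in the
  cone, so all four corners stay in \<open>S\<close> even for \<open>x\<close> on the
  boundary.\<close>

lemma second_difference:
  assumes x: "x \<in> S" and h: "h \<in> S" and k: "k \<in> S" and e: "e > 0"
  shows "\<exists>d>0. \<forall>s. 0 < s \<and> s < d \<longrightarrow>
    \<bar>(f (x + s *\<^sub>R h + s *\<^sub>R k) - f (x + s *\<^sub>R h) - f (x + s *\<^sub>R k) + f x) - s\<^sup>2 * (hess x k \<bullet> h)\<bar>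
      \<le> e * s\<^sup>2 * (2 * norm h + norm k) * norm h"
proof -
  obtain d where d: "d > 0" "\<And>y. y \<in> S \<Longrightarrow> norm (y - x) < d \<Longrightarrow>
      norm (grad y - grad x - hess x (y - x)) \<le> e * norm (y - x)"
    using has_derivative_hess[OF x] e unfolding has_derivative_within_alt by meson
  define c where "c = norm h + norm k + 1"
  have c: "c > 0" by (simp add: c_def add_nonneg_pos)
  note lin = linear_hess[OF x]
  show ?thesis
  proof (intro exI[of _ "d / c"] conjI allI impI)
    show "d / c > 0" using d c by simp
    fix s assume s: "0 < s \<and> s < d / c"
    then have sc: "s * c < d" using c by (simp add: less_divide_eq)
    define g where "g t = f ((x + s *\<^sub>R k) + t *\<^sub>R h) - f (x + t *\<^sub>R h)" for t
    define g' where "g' t = grad ((x + s *\<^sub>R k) + t *\<^sub>R h) - grad (x + t *\<^sub>R h)" for t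
    have mem: "x + t *\<^sub>R h \<in> S" "(x + s *\<^sub>R k) + t *\<^sub>R h \<in> S" if "t \<ge> 0" for t
      using that s x h k by (auto intro!: S_add S_scale)
    have "\<exists>t\<in>{0<..<s}. g s - g 0 = (s - 0) *\<^sub>R (g' t \<bullet> h)"
    proof (rule mvt_simple[where f' = "\<lambda>t u. u *\<^sub>R (g' t \<bullet> h)"])
      show "0 < s" using s by simp
      fix t assume t: "0 \<le> t" "t \<le> s"
      have "((\<lambda>u. f ((x + s *\<^sub>R k) + u *\<^sub>R h)) has_derivative
          (\<lambda>u. grad ((x + s *\<^sub>R k) + t *\<^sub>R h) \<bullet> (u *\<^sub>R h))) (at t within {0..s})"
        by (rule has_derivative_along_line[OF has_derivative_grad]) (use mem t in auto)
      moreover have "((\<lambda>u. f (x + u *\<^sub>R h)) has_derivative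
          (\<lambda>u. grad (x + t *\<^sub>R h) \<bullet> (u *\<^sub>R h))) (at t within {0..s})"
        by (rule has_derivative_along_line[OF has_derivative_grad]) (use mem t in auto)
      ultimately show "(g has_derivative (\<lambda>u. u *\<^sub>R (g' t \<bullet> h))) (at t within {0..s})"
        unfolding g_def g'_def
        by (rule has_derivative_diff[THEN has_derivative_eq_rhs])
          (simp add: inner_diff_left algebra_simps)
    qed
    then obtain t where t: "0 < t" "t < s" and gt: "g s - g 0 = s * (g' t \<bullet> h)" by auto
    define y1 where "y1 = (x + s *\<^sub>R k) + t *\<^sub>R h"
    define y2 where "y2 = x + t *\<^sub>R h"
    have n2: "norm (y2 - x) \<le> s * norm h"
      using t by (simp add: y2_def mult_right_mono)
    have n1: "norm (y1 - x) \<le> s * (norm h + norm k)"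
    proof -
      have "norm (y1 - x) \<le> norm (s *\<^sub>R k) + norm (t *\<^sub>R h)"
        unfolding y1_def using norm_triangle_ineq[of "s *\<^sub>R k" "t *\<^sub>R h"] by simp
      also have "\<dots> \<le> s * norm k + s * norm h"
        using t by (simp add: mult_right_mono)
      finally show ?thesis by (simp add: algebra_simps)
    qed
    have lt: "s * (norm h + norm k) < d" "s * norm h < d"
    proof -
      have "s * (norm h + norm k) \<le> s * c" "s * norm h \<le> s * c"
        using s by (auto intro!: mult_left_mono simp: c_def)
      with sc show "s * (norm h + norm k) < d" "s * norm h < d" by auto
    qed
    have e1: "norm (grad y1 - grad x - hess x (y1 - x)) \<le> e * (s * (norm h + norm k))"
    proof -
      have "norm (grad y1 - grad x - hess x (y1 - x)) \<le> e * norm (y1 - x)"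
        using d(2)[of y1] mem(2)[of t] t n1 lt by (simp add: y1_def)
      also have "\<dots> \<le> e * (s * (norm h + norm k))" using n1 e by (intro mult_left_mono) auto
      finally show ?thesis .
    qed
    have e2: "norm (grad y2 - grad x - hess x (y2 - x)) \<le> e * (s * norm h)"
    proof -
      have "norm (grad y2 - grad x - hess x (y2 - x)) \<le> e * norm (y2 - x)"
        using d(2)[of y2] mem(1)[of t] t n2 lt by (simp add: y2_def)
      also have "\<dots> \<le> e * (s * norm h)" using n2 e by (intro mult_left_mono) auto
      finally show ?thesis .
    qed
    \<comment> \<open>Holds by linearity, since \<open>y1 - y2 = s *\<^sub>R k\<close>.\<close>
    have split: "g' t - s *\<^sub>R hess x k = (grad y1 - grad x - hess x (y1 - x)) - (grad y2 - grad x - hess x (y2 - x))"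
      unfolding g'_def y1_def y2_def
      by (simp add: linear_add[OF lin] linear_diff[OF lin] linear_scale[OF lin])
    have "norm (g' t - s *\<^sub>R hess x k) \<le> e * s * (2 * norm h + norm k)"
    proof -
      have "norm (g' t - s *\<^sub>R hess x k) \<le> e * (s * (norm h + norm k)) + e * (s * norm h)"
        unfolding split by (rule norm_triangle_le_diff) (use e1 e2 in linarith)
      then show ?thesis by (simp add: algebra_simps)
    qed
    then have "\<bar>(g' t - s *\<^sub>R hess x k) \<bullet> h\<bar> \<le> e * s * (2 * norm h + norm k) * norm h"
      by (meson Cauchy_Schwarz_ineq2 mult_right_mono norm_ge_zero order_trans)
    then have "s * \<bar>(g' t - s *\<^sub>R hess x k) \<bullet> h\<bar> \<le> s * (e * s * (2 * norm h + norm k) * norm h)"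
      using s by (intro mult_left_mono) auto
    moreover have "(f (x + s *\<^sub>R h + s *\<^sub>R k) - f (x + s *\<^sub>R h) - f (x + s *\<^sub>R k) + f x) = g s - g 0"
      by (simp add: g_def add_ac)
    moreover have "s * \<bar>(g' t - s *\<^sub>R hess x k) \<bullet> h\<bar> = \<bar>s * (g' t \<bullet> h) - s\<^sup>2 * (hess x k \<bullet> h)\<bar>"
    proof -
      have "s * \<bar>(g' t - s *\<^sub>R hess x k) \<bullet> h\<bar> = \<bar>s * ((g' t - s *\<^sub>R hess x k) \<bullet> h)\<bar>"
        using s by (simp add: abs_mult)
      then show ?thesis by (simp add: inner_diff_left algebra_simps power2_eq_square)
    qed
    ultimately show "\<bar>(f (x + s *\<^sub>R h + s *\<^sub>R k) - f (x + s *\<^sub>R h) - f (x + s *\<^sub>R k) + f x)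
        - s\<^sup>2 * (hess x k \<bullet> h)\<bar> \<le> e * s\<^sup>2 * (2 * norm h + norm k) * norm h"
      using gt by (simp add: power2_eq_square mult_ac)
  qed
qed

text \<open>The second difference does not change when \<open>h\<close> and \<open>k\<close> are
  exchanged, so both Hessian values approximate the same number; the error is \<open>e\<close> times
  a constant, for every \<open>e > 0\<close>.\<close>

lemma hess_symmetric_cone:
  assumes x: "x \<in> S" and h: "h \<in> S" and k: "k \<in> S"
  shows "hess x k \<bullet> h = hess x h \<bullet> k"
proof -
  define C where "C = (2 * norm h + norm k) * norm h + (2 * norm k + norm h) * norm k"
  have C: "C \<ge> 0" by (simp add: C_def)
  have bd: "\<bar>hess x k \<bullet> h - hess x h \<bullet> k\<bar> \<le> e * C" if e: "e > 0" for e
  proof -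
    obtain d1 where d1: "d1 > 0" "\<And>s. 0 < s \<Longrightarrow> s < d1 \<Longrightarrow>
      \<bar>(f (x + s *\<^sub>R h + s *\<^sub>R k) - f (x + s *\<^sub>R h) - f (x + s *\<^sub>R k) + f x) - s\<^sup>2 * (hess x k \<bullet> h)\<bar>
      \<le> e * s\<^sup>2 * (2 * norm h + norm k) * norm h"
      using second_difference[OF x h k e] by auto
    obtain d2 where d2: "d2 > 0" "\<And>s. 0 < s \<Longrightarrow> s < d2 \<Longrightarrow>
      \<bar>(f (x + s *\<^sub>R k + s *\<^sub>R h) - f (x + s *\<^sub>R k) - f (x + s *\<^sub>R h) + f x) - s\<^sup>2 * (hess x h \<bullet> k)\<bar>
      \<le> e * s\<^sup>2 * (2 * norm k + norm h) * norm k"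
      using second_difference[OF x k h e] by auto
    define s where "s = min d1 d2 / 2"
    have s: "0 < s" "s < d1" "s < d2" using d1(1) d2(1) by (auto simp: s_def)
    have comm: "x + s *\<^sub>R k + s *\<^sub>R h = x + s *\<^sub>R h + s *\<^sub>R k" by simp
    have "\<bar>s\<^sup>2 * (hess x k \<bullet> h) - s\<^sup>2 * (hess x h \<bullet> k)\<bar>
      \<le> e * s\<^sup>2 * (2 * norm h + norm k) * norm h + e * s\<^sup>2 * (2 * norm k + norm h) * norm k"
      using d1(2)[OF s(1,2)] d2(2)[OF s(1,3)] unfolding comm by linarith
    moreover have "\<bar>s\<^sup>2 * (hess x k \<bullet> h) - s\<^sup>2 * (hess x h \<bullet> k)\<bar> = s\<^sup>2 * \<bar>hess x k \<bullet> h - hess x h \<bullet> k\<bar>"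
      by (metis abs_mult abs_power2 right_diff_distrib)
    moreover have "e * s\<^sup>2 * (2 * norm h + norm k) * norm h + e * s\<^sup>2 * (2 * norm k + norm h) * norm k
        = s\<^sup>2 * (e * C)"
      by (simp add: C_def algebra_simps)
    ultimately have "s\<^sup>2 * \<bar>hess x k \<bullet> h - hess x h \<bullet> k\<bar> \<le> s\<^sup>2 * (e * C)" by simp
    then show ?thesis using s(1) by simp
  qed
  have "\<bar>hess x k \<bullet> h - hess x h \<bullet> k\<bar> \<le> 0 + e" if "e > 0" for e
  proof -
    have "\<bar>hess x k \<bullet> h - hess x h \<bullet> k\<bar> \<le> (e / (C + 1)) * C"
      using that C by (intro bd) simp
    also have "\<dots> \<le> e" using that C by (simp add: field_simps)
    finally show ?thesis by simp
  qed
  then have "\<bar>hess x k \<bullet> h - hess x h \<bullet> k\<bar> \<le> 0" by (rule field_le_epsilon)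
  then show ?thesis by simp
qed

lemma hess_symmetric:
  assumes x: "x \<in> S" and h: "h \<in> T" and k: "k \<in> T"
  shows "hess x h \<bullet> k = hess x k \<bullet> h"
proof -
  obtain p q where pq: "p \<in> S" "q \<in> S" "h = p - q" using S_generates[OF h] by blast
  obtain p' q' where pq': "p' \<in> S" "q' \<in> S" "k = p' - q'" using S_generates[OF k] by blast
  note sym = hess_symmetric_cone[OF x]
  show ?thesis
    unfolding pq(3) pq'(3) linear_diff[OF linear_hess[OF x]] inner_diff_left inner_diff_right
    using sym[OF pq(1) pq'(1)] sym[OF pq(1) pq'(2)] sym[OF pq(2) pq'(1)] sym[OF pq(2) pq'(2)]
    by simp
qed

text \<open>There is no vector-valued mean value equality, so the gradient is paired with a fixed
  \<open>k\<close>, and \<open>\<xi>\<close> depends on it. This suffices where a single test matrix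
  is used at a time.\<close>

lemma grad_mean_value:
  assumes x: "x \<in> S" and y: "y \<in> S"
  obtains \<xi> where "0 < \<xi>" "\<xi> < 1" "(grad y - grad x) \<bullet> k = hess (x + \<xi> *\<^sub>R (y - x)) (y - x) \<bullet> k"
proof -
  have mem: "x + t *\<^sub>R (y - x) \<in> S" if "0 \<le> t" "t \<le> 1" for t
  proof -
    have "x + t *\<^sub>R (y - x) = (1 - t) *\<^sub>R x + t *\<^sub>R y" by (simp add: algebra_simps)
    then show ?thesis using that x y by (simp add: S_add S_scale)
  qed
  have "\<exists>t\<in>{0<..<1}. grad (x + 1 *\<^sub>R (y - x)) \<bullet> k - grad (x + 0 *\<^sub>R (y - x)) \<bullet> k
      = hess (x + t *\<^sub>R (y - x)) ((1 - 0) *\<^sub>R (y - x)) \<bullet> k"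
  proof (rule mvt_simple[where f' = "\<lambda>t u. hess (x + t *\<^sub>R (y - x)) (u *\<^sub>R (y - x)) \<bullet> k"])
    fix t :: real assume t: "0 \<le> t" "t \<le> 1"
    have "((\<lambda>u. grad (x + u *\<^sub>R (y - x))) has_derivative
        (\<lambda>u. hess (x + t *\<^sub>R (y - x)) (u *\<^sub>R (y - x)))) (at t within {0..1})"
      by (rule has_derivative_along_line[OF has_derivative_hess]) (use mem t in auto)
    then show "((\<lambda>u. grad (x + u *\<^sub>R (y - x)) \<bullet> k) has_derivative
        (\<lambda>u. hess (x + t *\<^sub>R (y - x)) (u *\<^sub>R (y - x)) \<bullet> k)) (at t within {0..1})"
      by (rule has_derivative_inner_left)
  qed simp
  then show thesis using that by (auto simp: inner_diff_left)
qed

end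

end

section \<open>From Hessian bounds to lower bounds on gradient differences\<close>

lemma restricted_form_inner_ge:
  fixes B :: "'a::real_inner \<Rightarrow> 'a"
  assumes lin: "linear B" and sym: "B x \<bullet> y = B y \<bullet> x"
    and bd: "\<And>\<alpha> \<beta>. \<mu> * (norm (\<alpha> *\<^sub>R x + \<beta> *\<^sub>R y))\<^sup>2 \<le> B (\<alpha> *\<^sub>R x + \<beta> *\<^sub>R y) \<bullet> (\<alpha> *\<^sub>R x + \<beta> *\<^sub>R y)"
      "\<And>\<alpha> \<beta>. B (\<alpha> *\<^sub>R x + \<beta> *\<^sub>R y) \<bullet> (\<alpha> *\<^sub>R x + \<beta> *\<^sub>R y) \<le> L * (norm (\<alpha> *\<^sub>R x + \<beta> *\<^sub>R y))\<^sup>2"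
  shows "(L + \<mu>) / 2 * (x \<bullet> y) - (L - \<mu>) / 2 * norm x * norm y \<le> B x \<bullet> y"
proof (cases "x = 0 \<or> y = 0")
  case True
  then show ?thesis using linear_0[OF lin] by auto
next
  case False
  define a b where "a = norm x" and "b = norm y"
  have ab: "a > 0" "b > 0" using False by (auto simp: a_def b_def)
  have nx: "x \<bullet> x = a\<^sup>2" and ny: "y \<bullet> y = b\<^sup>2" by (simp_all add: a_def b_def dot_square_norm)
  have expand: "B (\<alpha> *\<^sub>R x + \<beta> *\<^sub>R y) \<bullet> (\<alpha> *\<^sub>R x + \<beta> *\<^sub>R y)
      = \<alpha>\<^sup>2 * (B x \<bullet> x) + 2 * \<alpha> * \<beta> * (B x \<bullet> y) + \<beta>\<^sup>2 * (B y \<bullet> y)" for \<alpha> \<beta>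
    using sym by (simp add: linear_add[OF lin] linear_scale[OF lin] algebra_simps power2_eq_square)
  have expand': "(norm (\<alpha> *\<^sub>R x + \<beta> *\<^sub>R y))\<^sup>2 = \<alpha>\<^sup>2 * a\<^sup>2 + 2 * \<alpha> * \<beta> * (x \<bullet> y) + \<beta>\<^sup>2 * b\<^sup>2" for \<alpha> \<beta>
    unfolding power2_norm_eq_inner
    by (simp add: inner_add_left inner_add_right inner_commute nx ny algebra_simps power2_eq_square)
  \<comment> \<open>Polarisation with weights that give both terms norm \<open>a * b\<close>: the
    lower bound is tested on b x + a y, the upper one on b x - a y. Their difference isolates the
    mixed term \<open>B x \<bullet> y\<close>.\<close>
  have 1: "\<mu> * (b\<^sup>2 * a\<^sup>2 + 2 * b * a * (x \<bullet> y) + a\<^sup>2 * b\<^sup>2)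
      \<le> b\<^sup>2 * (B x \<bullet> x) + 2 * b * a * (B x \<bullet> y) + a\<^sup>2 * (B y \<bullet> y)"
    using bd(1)[of b a] unfolding expand expand' .
  have 2: "b\<^sup>2 * (B x \<bullet> x) - 2 * b * a * (B x \<bullet> y) + a\<^sup>2 * (B y \<bullet> y)
      \<le> L * (b\<^sup>2 * a\<^sup>2 - 2 * b * a * (x \<bullet> y) + a\<^sup>2 * b\<^sup>2)"
    using bd(2)[of b "- a"] unfolding expand expand' by simp
  have "2 * (L + \<mu>) * a * b * (x \<bullet> y) - 2 * (L - \<mu>) * a\<^sup>2 * b\<^sup>2 \<le> 4 * a * b * (B x \<bullet> y)"
    using 1 2 by (simp add: algebra_simps)
  also have "2 * (L + \<mu>) * a * b * (x \<bullet> y) - 2 * (L - \<mu>) * a\<^sup>2 * b\<^sup>2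
      = (4 * a * b) * ((L + \<mu>) / 2 * (x \<bullet> y) - (L - \<mu>) / 2 * a * b)"
    by (simp add: field_simps power2_eq_square)
  finally have "(4 * a * b) * ((L + \<mu>) / 2 * (x \<bullet> y) - (L - \<mu>) / 2 * a * b) \<le> (4 * a * b) * (B x \<bullet> y)" .
  then show ?thesis using ab by (simp add: a_def b_def)
qed

lemma cone_pair_UNIV: "cone_pair UNIV UNIV"
proof
  show "\<exists>p\<in>UNIV. \<exists>q\<in>UNIV. h = p - q" for h :: 'a
    by (metis UNIV_I diff_zero)
qed (simp_all add: subspace_UNIV)

lemma cone_pair_psd: "cone_pair sym_mats (psd_mats :: (real^'d^'d) set)"
proof
  show "subspace sym_mats"
    by (auto simp: sym_mats_def subspace_def transpose_add transpose_scalar transpose_zero)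
  show "psd_mats \<subseteq> (sym_mats :: (real^'d^'d) set)" by (auto simp: psd_mats_def sym_mats_def)
  show "x + y \<in> psd_mats" if "x \<in> psd_mats" "y \<in> psd_mats" for x y :: "real^'d^'d"
    using that by (auto simp: psd_mats_def transpose_add matrix_vector_mult_add_rdistrib inner_add_right)
  show "t *\<^sub>R x \<in> psd_mats" if "x \<in> psd_mats" "0 \<le> t" for x :: "real^'d^'d" and t
    using that by (auto simp: psd_mats_def transpose_scalar scaleR_matrix_vector)
  fix h :: "real^'d^'d" assume h: "h \<in> sym_mats"
  \<comment> \<open>|x . h x| is at most \<open>op_norm h\<close> times |x|^2, so adding this
    multiple of the identity makes \<open>h\<close> positive semidefinite.\<close>
  define c where "c = op_norm h"
  have I: "(c *\<^sub>R mat 1) *v x = c *\<^sub>R x" for x :: "real^'d" unfolding scaleR_matrix_vector by simp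
  have "c *\<^sub>R mat 1 \<in> (psd_mats :: (real^'d^'d) set)"
    using op_norm_nonneg[of h] by (auto simp: psd_mats_def transpose_scalar I simp flip: c_def)
  moreover have "h + c *\<^sub>R mat 1 \<in> psd_mats"
  proof -
    have "0 \<le> x \<bullet> ((h + c *\<^sub>R mat 1) *v x)" for x
    proof -
      have "\<bar>x \<bullet> (h *v x)\<bar> \<le> norm x * norm (h *v x)" by (rule Cauchy_Schwarz_ineq2)
      also have "\<dots> \<le> norm x * (c * norm x)"
        using op_norm_bound[of h x] by (intro mult_left_mono) (auto simp: c_def)
      also have "\<dots> = x \<bullet> (c *\<^sub>R x)" by (simp add: dot_square_norm power2_eq_square)
      finally show ?thesis by (simp add: matrix_vector_mult_add_rdistrib I inner_add_right)
    qed
    then show ?thesis using h by (simp add: psd_mats_def sym_mats_def transpose_add transpose_scalar)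
  qed
  moreover have "h = (h + c *\<^sub>R mat 1) - c *\<^sub>R mat 1" by simp
  ultimately show "\<exists>p\<in>psd_mats. \<exists>q\<in>psd_mats. h = p - q" by blast
qed

text \<open>All points of the segment from \<open>Ms\<close> to \<open>M\<close> have rank at most
  \<open>rank M + rank Ms\<close>, so the Hessian bounds hold at the mean value point
  \<open>Z\<close>. The rank condition covers the plane of directions on which
  \<open>restricted_form_inner_ge\<close> tests.\<close>

lemma restricted_monotone:
  fixes \<phi> :: "real^'n^'m \<Rightarrow> real"
  assumes cone: "cone_pair T S" and rsc: "restricted_sc_smooth T S K l \<mu> L \<phi>"
    and M: "M \<in> S" "Ms \<in> S" and rank_M: "rank M + rank Ms \<le> l" and Y: "Y \<in> T"
    and rank: "\<And>\<alpha> \<beta>. rank (\<alpha> *\<^sub>R (M - Ms) + \<beta> *\<^sub>R Y) \<le> K"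
  shows "(L + \<mu>) / 2 * ((M - Ms) \<bullet> Y) - (L - \<mu>) / 2 * norm (M - Ms) * norm Y
    \<le> (grad_on T S \<phi> M - grad_on T S \<phi> Ms) \<bullet> Y"
proof -
  interpret cone_pair T S by (rule cone)
  have tw: "twice_differentiable_on T S \<phi>" using rsc by (simp add: restricted_sc_smooth_def)
  obtain \<xi> where \<xi>: "0 < \<xi>" "\<xi> < 1" and eq: "(grad_on T S \<phi> M - grad_on T S \<phi> Ms) \<bullet> Y
      = frechet_derivative (grad_on T S \<phi>) (at (Ms + \<xi> *\<^sub>R (M - Ms)) within S) (M - Ms) \<bullet> Y"
    using grad_mean_value[OF tw M(2) M(1)] by blast
  define Z where "Z = Ms + \<xi> *\<^sub>R (M - Ms)"
  have Z_eq: "Z = (1 - \<xi>) *\<^sub>R Ms + \<xi> *\<^sub>R M" by (simp add: Z_def algebra_simps)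
  have ZS: "Z \<in> S" unfolding Z_eq using M \<xi> by (intro S_add S_scale) auto
  have "rank Z \<le> rank ((1 - \<xi>) *\<^sub>R Ms) + rank (\<xi> *\<^sub>R M)" unfolding Z_eq by (rule rank_add_le)
  also have "\<dots> \<le> l" using rank_scaleR_le[of "1 - \<xi>" Ms] rank_scaleR_le[of \<xi> M] rank_M by linarith
  finally have rZ: "rank Z \<le> l" .
  have XT: "M - Ms \<in> T" using M S_subset subspace_diff[OF subspace_T] by blast
  have ET: "\<alpha> *\<^sub>R (M - Ms) + \<beta> *\<^sub>R Y \<in> T" for \<alpha> \<beta>
    using XT Y subspace_T by (simp add: subspace_add subspace_scale)
  note bd = rsc[unfolded restricted_sc_smooth_def hess_on_def]
  show ?thesis
    unfolding eq Z_def[symmetric]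
  proof (rule restricted_form_inner_ge[OF linear_hess[OF tw ZS] hess_symmetric[OF tw ZS XT Y]])
    fix \<alpha> \<beta>
    let ?E = "\<alpha> *\<^sub>R (M - Ms) + \<beta> *\<^sub>R Y"
    show "\<mu> * (norm ?E)\<^sup>2 \<le> frechet_derivative (grad_on T S \<phi>) (at Z within S) ?E \<bullet> ?E"
      "frechet_derivative (grad_on T S \<phi>) (at Z within S) ?E \<bullet> ?E \<le> L * (norm ?E)\<^sup>2"
      using bd ZS rZ ET rank by blast+
  qed
qed

section \<open>Frames and the lower bound off the corner\<close>

text \<open>The constraints in \<open>C\<close> need not lie in \<open>S\<close>. On
  \<open>S\<close> each acts like its projection \<open>p c\<close>, and fewer than
  \<open>dim S\<close> projections leave room for a common orthogonal vector.\<close>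

lemma unit_orthogonal_exists:
  fixes S :: "'a::euclidean_space set"
  assumes S: "subspace S" and C: "finite C" "card C < dim S"
  obtains x where "x \<in> S" "norm x = 1" "\<And>c. c \<in> C \<Longrightarrow> c \<bullet> x = 0"
proof -
  have spanS: "span S = S" using S by (metis span_eq_iff)
  define p where "p c = (SOME y. y \<in> S \<and> (\<forall>w\<in>S. (c - y) \<bullet> w = 0))" for c
  have p: "p c \<in> S" "\<And>w. w \<in> S \<Longrightarrow> c \<bullet> w = p c \<bullet> w" for c
  proof -
    obtain y z where "y \<in> span S" "\<And>w. w \<in> span S \<Longrightarrow> orthogonal z w" "c = y + z"
      using orthogonal_subspace_decomp_exists[of S c] by metis
    then have "\<exists>y. y \<in> S \<and> (\<forall>w\<in>S. (c - y) \<bullet> w = 0)" by (auto simp: spanS orthogonal_def)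
    then have "p c \<in> S \<and> (\<forall>w\<in>S. (c - p c) \<bullet> w = 0)" unfolding p_def by (rule someI_ex)
    then show "p c \<in> S" "\<And>w. w \<in> S \<Longrightarrow> c \<bullet> w = p c \<bullet> w" by (auto simp: inner_diff_left)
  qed
  have "dim (p ` C) \<le> card (p ` C)" using C by (intro dim_le_card span_superset) auto
  also have "\<dots> < dim S" using C card_image_le[of C p] by linarith
  finally have "dim (span (p ` C)) < dim (span S)" by simp
  moreover have "span (p ` C) \<subseteq> span S" using p by (intro span_mono) auto
  ultimately have "span (p ` C) \<subset> span S" by (metis less_irrefl psubsetI)
  then obtain x where x: "x \<noteq> 0" "x \<in> span S" "\<And>y. y \<in> span (p ` C) \<Longrightarrow> orthogonal x y"
    using orthogonal_to_subspace_exists_gen[of "p ` C" S] by metis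
  have orth: "c \<bullet> x = 0" if "c \<in> C" for c
  proof -
    have "orthogonal x (p c)" using x(3) that by (blast intro: span_base)
    then show ?thesis using p(2)[of x c] x(2) by (simp add: spanS orthogonal_def inner_commute)
  qed
  show thesis
  proof (rule that)
    show "x /\<^sub>R norm x \<in> S" using x(2) S by (simp add: spanS subspace_scale)
    show "norm (x /\<^sub>R norm x) = 1" using x(1) by simp
    show "\<And>c. c \<in> C \<Longrightarrow> c \<bullet> (x /\<^sub>R norm x) = 0" using orth by simp
  qed
qed

lemma orthonormal_bessel:
  assumes o: "orthonormal k o'" and I: "I \<subseteq> {..<k}"
  shows "(\<Sum>j\<in>I. (h \<bullet> o' j)\<^sup>2) \<le> (norm h)\<^sup>2"
proof -
  have fin: "finite I" using I finite_subset by blast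
  define y where "y = (\<Sum>j\<in>I. (h \<bullet> o' j) *\<^sub>R o' j)"
  have yo: "y \<bullet> o' j = h \<bullet> o' j" if "j \<in> I" for j
  proof -
    have "y \<bullet> o' j = (\<Sum>i\<in>I. if i = j then h \<bullet> o' i else 0)"
      unfolding y_def inner_sum_left
      by (rule sum.cong) (use o I that in \<open>auto simp: orthonormal_def subset_eq\<close>)
    then show ?thesis using that fin by simp
  qed
  have hy: "h \<bullet> y = (\<Sum>j\<in>I. (h \<bullet> o' j)\<^sup>2)"
    by (simp add: y_def inner_sum_right power2_eq_square)
  have "y \<bullet> y = (\<Sum>j\<in>I. (h \<bullet> o' j) * (y \<bullet> o' j))"
    by (subst (2) y_def) (simp add: inner_sum_right)
  also have "\<dots> = h \<bullet> y" unfolding hy by (simp add: yo power2_eq_square)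
  finally have yy: "y \<bullet> y = h \<bullet> y" .
  have "0 \<le> (h - y) \<bullet> (h - y)" by simp
  then have "h \<bullet> y \<le> h \<bullet> h" by (simp add: inner_diff_left inner_diff_right inner_commute yy)
  then show ?thesis by (simp add: hy power2_norm_eq_inner)
qed

text \<open>The frame is chosen greedily: at step \<open>j\<close> there are fewer than \<open>dim S\<close> constraints.\<close>

lemma adapted_frame_exists:
  fixes S :: "'a::euclidean_space set" and h :: "nat \<Rightarrow> 'a"
  assumes S: "subspace S" and C: "finite C" and dim: "m + k + card C \<le> dim S"
  obtains f where "orthonormal (m + k) f" "\<And>j. j < m + k \<Longrightarrow> f j \<in> S"
    "\<And>c j. j < m + k \<Longrightarrow> c \<in> C \<Longrightarrow> c \<bullet> f j = 0"
    "\<And>i j. j < m \<Longrightarrow> i < k \<Longrightarrow> h i \<bullet> f j = 0"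
    "\<And>i j. j < i \<Longrightarrow> i < k \<Longrightarrow> h i \<bullet> f (m + j) = 0"
proof -
  \<comment> \<open>The constraints are triangular: the first \<open>m\<close> vectors are
    orthogonal to every \<open>h i\<close>, and vector \<open>m + j\<close> only to those
    \<open>h i\<close> with \<open>i > j\<close>.\<close>
  define good where "good J f \<longleftrightarrow> orthonormal J f \<and> (\<forall>j<J. f j \<in> S \<and>
      (\<forall>c\<in>C. c \<bullet> f j = 0) \<and> (\<forall>i<k. j < m + i \<longrightarrow> h i \<bullet> f j = 0))" for J and f :: "nat \<Rightarrow> 'a"
  have "\<exists>f. good J f" if "J \<le> m + k" for J
    using that
  proof (induction J)
    case 0
    then show ?case by (auto simp: good_def orthonormal_def)
  next
    case (Suc J)
    then obtain f where f: "good J f" by auto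
    let ?C = "C \<union> (f ` {..<J} \<union> h ` {i. i < k \<and> J < m + i})"
    \<comment> \<open>For \<open>J < m\<close> all \<open>k\<close> vectors \<open>h i\<close>
      constrain. From then on each new frame vector adds one constraint while one \<open>h i\<close>
      drops out, so the total never exceeds \<open>m + k + card C - 1\<close>.\<close>
    have "card {i. i < k \<and> J < m + i} + J + card C < dim S"
    proof (cases "J < m")
      case True
      then have "{i. i < k \<and> J < m + i} = {..<k}" by auto
      then show ?thesis using True dim by simp
    next
      case False
      then have "{i. i < k \<and> J < m + i} = {J - m<..<k}" by auto
      then show ?thesis using False dim Suc.prems by simp
    qed
    moreover have "card ?C \<le> card C + (J + card {i. i < k \<and> J < m + i})"
      using card_Un_le[of C "f ` {..<J} \<union> h ` {i. i < k \<and> J < m + i}"]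
        card_Un_le[of "f ` {..<J}" "h ` {i. i < k \<and> J < m + i}"]
        card_image_le[of "{..<J}" f] card_image_le[of "{i. i < k \<and> J < m + i}" h] by simp
    ultimately have "card ?C < dim S" by linarith
    then obtain x where x: "x \<in> S" "norm x = 1" "\<And>c. c \<in> ?C \<Longrightarrow> c \<bullet> x = 0"
      using unit_orthogonal_exists[OF S, of ?C] C by auto
    have xf: "f j \<bullet> x = 0" "x \<bullet> f j = 0" if "j < J" for j
      using x(3)[of "f j"] that by (auto simp: inner_commute)
    have "h i \<bullet> x = 0" if "i < k" "J < m + i" for i
      using x(3)[of "h i"] that by auto
    then have "good (Suc J) (f(J := x))"
      using f x xf unfolding good_def orthonormal_def
      by (auto simp: less_Suc_eq norm_eq_1)
    then show ?case by blast
  qed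
  then obtain f where f: "good (m + k) f" by blast
  show thesis
    by (rule that[of f]) (use f in \<open>auto simp: good_def\<close>)
qed

lemma norm_sum_scaleR_outer:
  assumes "orthonormal k a" "orthonormal k b"
  shows "(norm (\<Sum>j<k. w j *\<^sub>R outer (a j) (b j)))\<^sup>2 = (\<Sum>j<k. (w j)\<^sup>2)"
proof -
  have "(\<Sum>j<k. w j *\<^sub>R outer (a j) (b j)) \<bullet> (\<Sum>j<k. w j *\<^sub>R outer (a j) (b j))
      = (\<Sum>i<k. \<Sum>j<k. w i * w j * ((a i \<bullet> a j) * (b i \<bullet> b j)))"
    by (simp add: inner_sum_left inner_sum_right inner_outer_outer mult_ac inner_commute)
  also have "\<dots> = (\<Sum>i<k. \<Sum>j<k. if j = i then w i * w j else 0)"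
    using assms by (intro sum.cong refl) (auto simp: orthonormal_def)
  also have "\<dots> = (\<Sum>j<k. (w j)\<^sup>2)" by (simp add: power2_eq_square)
  finally show ?thesis by (simp add: power2_norm_eq_inner)
qed

lemma orthonormal_independent:
  assumes "orthonormal k u"
  shows "inj_on u {..<k}" "independent (u ` {..<k})"
proof -
  show "inj_on u {..<k}"
    using assms unfolding orthonormal_def inj_on_def by (metis lessThan_iff zero_neq_one)
  have "pairwise orthogonal (u ` {..<k})"
    using assms by (auto simp: pairwise_def orthogonal_def orthonormal_def)
  moreover have "0 \<notin> u ` {..<k}"
    using assms by (fastforce simp: orthonormal_def)
  ultimately show "independent (u ` {..<k})" by (rule pairwise_orthogonal_independent)
qed

lemma orthonormal_le_dim:
  assumes u: "orthonormal k u" and S: "\<And>i. i < k \<Longrightarrow> u i \<in> S"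
  shows "k \<le> dim (S :: 'a::euclidean_space set)"
proof -
  have "card (u ` {..<k}) \<le> dim S"
    by (rule independent_card_le_dim) (use S orthonormal_independent(2)[OF u] in auto)
  then show ?thesis using orthonormal_independent(1)[OF u] by (simp add: card_image)
qed

text \<open>Wedderburn's rank reduction: \<open>B\<close> is a generalised Schur complement of the
  diagonal block u_i . A v_j. Every u_j annihilates the range of \<open>B\<close>, while a vector in
  the span of the A v_i annihilated by all u_j is 0. So these two subspaces of the range of
  \<open>A\<close> meet only in 0 and their dimensions add up.\<close>

lemma wedderburn_rank:
  fixes A :: "real^'n^'m"
  assumes n: "\<And>i. i < k \<Longrightarrow> n i \<noteq> 0"
    and uAv: "\<And>i j. i < k \<Longrightarrow> j < k \<Longrightarrow> u i \<bullet> (A *v v j) = (if i = j then n i else 0)"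
  defines "B \<equiv> A - (\<Sum>i<k. (1 / n i) *\<^sub>R outer (A *v v i) (transpose A *v u i))"
  shows "rank B + k \<le> rank A"
proof -
  let ?z = "\<lambda>i. A *v v i"
  have Bx: "B *v x = A *v (x - (\<Sum>i<k. (u i \<bullet> (A *v x) / n i) *\<^sub>R v i))" for x
    unfolding B_def
    by (simp add: matrix_vector_mult_diff_rdistrib matrix_vector_sum_left scaleR_matrix_vector
        outer_mult_vec inner_transpose_mult matrix_vector_mult_diff_distrib linear_sum[OF matrix_vector_mul_linear]
        matrix_vector_mult_scaleR del: transpose_matrix_vector)
  have uB: "u j \<bullet> (B *v x) = 0" if "j < k" for j x
  proof -
    have "u j \<bullet> (B *v x) = u j \<bullet> (A *v x) - (\<Sum>i<k. (u i \<bullet> (A *v x) / n i) * (u j \<bullet> (A *v v i)))"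
      unfolding Bx
      by (simp add: matrix_vector_mult_diff_distrib linear_sum[OF matrix_vector_mul_linear]
        matrix_vector_mult_scaleR inner_diff_right inner_sum_right)
    also have "(\<Sum>i<k. (u i \<bullet> (A *v x) / n i) * (u j \<bullet> (A *v v i))) = (\<Sum>i<k. if i = j then u i \<bullet> (A *v x) else 0)"
      by (rule sum.cong) (use that uAv n in auto)
    finally show ?thesis using that by simp
  qed
  have inj: "inj_on ?z {..<k}"
  proof (rule inj_onI)
    fix i j assume ij: "i \<in> {..<k}" "j \<in> {..<k}" "?z i = ?z j"
    then have "u i \<bullet> ?z i = u i \<bullet> ?z j" by simp
    then show "i = j" using ij uAv[of i i] uAv[of i j] n[of i] by (auto split: if_splits)
  qed
  let ?R = "range ((*v) B)" and ?T = "span (?z ` {..<k})"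
  have coef: "(\<Sum>i<k. c i *\<^sub>R ?z i) \<bullet> u j = c j * n j" if "j < k" for c j
  proof -
    have "(\<Sum>i<k. c i *\<^sub>R ?z i) \<bullet> u j = (\<Sum>i<k. if i = j then c i * n i else 0)"
      unfolding inner_sum_left
      by (rule sum.cong) (use that uAv in \<open>auto simp: inner_commute\<close>)
    then show ?thesis using that by simp
  qed
  have span_form: "\<exists>c. x = (\<Sum>i<k. c i *\<^sub>R ?z i)" if x: "x \<in> ?T" for x
  proof -
    obtain c where "x = (\<Sum>v\<in>?z ` {..<k}. c v *\<^sub>R v)"
      using x span_finite[of "?z ` {..<k}"] by auto
    also have "\<dots> = (\<Sum>i<k. c (?z i) *\<^sub>R ?z i)" by (simp add: sum.reindex[OF inj])
    finally show ?thesis by (intro exI[of _ "\<lambda>i. c (?z i)"])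
  qed
  have "independent (?z ` {..<k})"
  proof (rule independent_if_scalars_zero)
    fix f x assume 0: "(\<Sum>x\<in>?z ` {..<k}. f x *\<^sub>R x) = 0" and x: "x \<in> ?z ` {..<k}"
    then obtain j where j: "j < k" "x = ?z j" by auto
    have "(\<Sum>i<k. f (?z i) *\<^sub>R ?z i) = 0" using 0 by (simp add: sum.reindex[OF inj])
    then show "f x = 0" using coef[OF j(1), of "\<lambda>i. f (?z i)"] n[OF j(1)] j(2) by simp
  qed simp
  then have dimT: "dim ?T = k" by (simp add: dim_eq_card_independent card_image[OF inj])
  have Int: "?R \<inter> ?T = {0}"
  proof -
    have "x = 0" if x: "x \<in> ?R" "x \<in> ?T" for x
    proof -
      obtain c where c: "x = (\<Sum>i<k. c i *\<^sub>R ?z i)" using span_form[OF x(2)] by blast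
      have "c j = 0" if "j < k" for j
      proof -
        have "x \<bullet> u j = 0" using x(1) uB[OF that] by (auto simp: inner_commute)
        then show ?thesis using coef[OF that, of c] n[OF that] c by simp
      qed
      then show ?thesis by (simp add: c)
    qed
    moreover have "0 \<in> ?R" by (metis matrix_vector_mult_0_right rangeI)
    ultimately show ?thesis by (auto simp: span_zero)
  qed
  have sub: "subspace ?R" "subspace (range ((*v) A))"
    by (auto intro!: linear_subspace_image matrix_vector_mul_linear subspace_UNIV)
  have "?T \<subseteq> range ((*v) A)" by (rule span_minimal[OF _ sub(2)]) auto
  moreover have "?R \<subseteq> range ((*v) A)" using Bx by auto
  ultimately have "{x + y |x y. x \<in> ?R \<and> y \<in> ?T} \<subseteq> range ((*v) A)"
    using subspace_add[OF sub(2)] by blast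
  then have "dim {x + y |x y. x \<in> ?R \<and> y \<in> ?T} \<le> dim (range ((*v) A))" by (rule dim_subset)
  then show ?thesis
    using dim_sums_Int[OF sub(1) subspace_span, of "?z ` {..<k}"]
    unfolding Int dimT rank_dim_range by simp
qed


text \<open>A partial isometry for orthonormal families: the projection onto the span when
  \<open>a = b\<close>, the polar factor of \<open>M\<close> when they are its singular vectors.
  \<open>frame k b a\<close> then carries vectors from the column space back to the row
  space.\<close>

definition frame :: "nat \<Rightarrow> (nat \<Rightarrow> real^'m) \<Rightarrow> (nat \<Rightarrow> real^'n) \<Rightarrow> real^'n^'m" where
  "frame k a b = (\<Sum>i<k. outer (a i) (b i))"

lemma transpose_frame [simp]: "transpose (frame k a b) = frame k b a"
  by (simp add: frame_def transpose_sum)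

lemma frame_mult_vec: "frame k a b *v x = (\<Sum>i<k. (b i \<bullet> x) *\<^sub>R a i)"
  by (simp add: frame_def matrix_vector_sum_left outer_mult_vec)

lemma frame_mult_basis: "orthonormal k b \<Longrightarrow> i < k \<Longrightarrow> frame k a b *v b i = a i"
  unfolding frame_mult_vec by (rule sum_lessThan_delta) (auto simp: orthonormal_def)

lemma frame_mult_frame: "orthonormal k b \<Longrightarrow> frame k a b ** frame k b c = frame k a c"
  by (subst (2) frame_def) (simp add: matrix_mult_sum_right mult_outer frame_mult_basis, simp add: frame_def)

lemma frame_mult_frame_vec: "orthonormal k b \<Longrightarrow> frame k a b *v (frame k b c *v x) = frame k a c *v x"
  by (simp add: matrix_vector_mul_assoc frame_mult_frame)

lemma inner_frame: "(frame k a b *v x) \<bullet> y = x \<bullet> (frame k b a *v y)"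
  by (metis inner_transpose_mult transpose_frame)

lemma inner_frame_frame:
  "orthonormal k a \<Longrightarrow> (frame k a b *v x) \<bullet> (frame k a c *v y) = x \<bullet> (frame k b c *v y)"
  by (simp add: inner_frame frame_mult_frame_vec)

lemma norm_frame: "orthonormal k a \<Longrightarrow> orthonormal k c \<Longrightarrow> norm (frame k a b *v x) = norm (frame k c b *v x)"
  by (simp add: norm_eq_sqrt_inner inner_frame_frame)

lemma dim_frame_range:
  assumes b: "orthonormal k b"
  shows "subspace {x. frame k b b *v x = x}" "k \<le> dim {x. frame k b b *v x = x}"
proof -
  show "subspace {x. frame k b b *v x = x}"
    by (auto simp: subspace_def matrix_vector_right_distrib matrix_vector_mult_scaleR)
  show "k \<le> dim {x. frame k b b *v x = x}"
    by (rule orthonormal_le_dim[OF b]) (simp add: frame_mult_basis[OF b])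
qed

lemma svd_frame_left: "svd M k \<sigma> a b \<Longrightarrow> frame k a a ** M = M"
proof -
  assume svd: "svd M k \<sigma> a b"
  show ?thesis
    unfolding svd_eq[OF svd] matrix_mult_sum_right
    by (simp add: matrix_mult_simps mult_outer frame_mult_basis[OF svd_orthonormal_left[OF svd]])
qed

lemma svd_frame_right: "svd M k \<sigma> a b \<Longrightarrow> M ** frame k b b = M"
  using svd_frame_left[OF svd_transpose] by (metis matrix_transpose_mul transpose_frame transpose_transpose)

lemma norm_power2_diff_bound: "2 * (x \<bullet> y) - (norm y)\<^sup>2 \<le> (norm x)\<^sup>2"
proof -
  have "0 \<le> (x - y) \<bullet> (x - y)" by simp
  then show ?thesis by (simp add: power2_norm_eq_inner inner_diff_left inner_diff_right inner_commute)
qed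

text \<open>The corner has range orthogonal to the \<open>a j\<close> and row space orthogonal to
  the \<open>b j\<close>. This orthogonality removes the cross terms when the second-order condition
  is tested.\<close>

lemma corner_singular_vectors:
  fixes Ms :: "real^'n^'m"
  assumes oa: "orthonormal k a" and ob: "orthonormal k b"
    and svd: "svd ((mat 1 - frame k a a) ** Ms ** (mat 1 - frame k b b)) k' n u v"
    and i: "i < k'" and j: "j < k"
  shows "a j \<bullet> u i = 0" "b j \<bullet> v i = 0"
proof -
  let ?N = "(mat 1 - frame k a a) ** Ms ** (mat 1 - frame k b b)"
  have left: "c j \<bullet> ((mat 1 - frame k c c) *v x) = 0" if "orthonormal k c" for x and c :: "nat \<Rightarrow> real^'p"
    using inner_frame[of k c c "c j" x]
    by (simp add: matrix_vector_mult_diff_rdistrib inner_diff_right frame_mult_basis[OF that j])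
  have "n i * (a j \<bullet> u i) = a j \<bullet> (?N *v v i)" by (simp add: svd_mult_right[OF svd i])
  also have "\<dots> = 0" using left[OF oa] by (simp flip: matrix_vector_mul_assoc)
  finally show "a j \<bullet> u i = 0" using svd_pos[OF svd i] by simp
  have t: "transpose ?N = (mat 1 - frame k b b) ** transpose Ms ** (mat 1 - frame k a a)"
    by (simp add: matrix_transpose_mul transpose_diff matrix_mul_assoc)
  have "n i * (b j \<bullet> v i) = b j \<bullet> (transpose ?N *v u i)"
    by (simp add: svd_mult_left[OF svd i] del: transpose_matrix_vector)
  also have "\<dots> = 0" unfolding t using left[OF ob]
    by (simp del: transpose_matrix_vector flip: matrix_vector_mul_assoc)
  finally show "b j \<bullet> v i = 0" using svd_pos[OF svd i] by simp
qed

text \<open>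
  Lower bound on the part of \<open>M - Ms\<close> outside the corner \<open>N\<close>, by testing against one matrix
  \<open>W - B - C\<close>: \<open>B\<close> and \<open>C\<close> recover the off-diagonal blocks, and \<open>W\<close> is aligned with the polar
  factor of \<open>M\<close> and annihilates the Schur complement of \<open>N\<close> in \<open>Ms\<close>.
\<close>

lemma off_corner_norm_ge:
  fixes M Ms :: "real^'n^'m"
  assumes svdM: "svd M k \<sigma> a b" and s: "\<And>i. i < k \<Longrightarrow> s \<le> \<sigma> i" "0 \<le> s"
    and rs: "rank Ms \<le> rs" "rs \<le> k"
    and svdN: "svd ((mat 1 - frame k a a) ** Ms ** (mat 1 - frame k b b)) k' n u v"
    and t: "0 \<le> t" "t \<le> 1"
  shows "real (k - rs) * s\<^sup>2 + 2 * s * t * (\<Sum>i<k'. n i) - t\<^sup>2 * (\<Sum>i<k'. (n i)\<^sup>2)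
    \<le> (norm (M - Ms + (mat 1 - frame k a a) ** Ms ** (mat 1 - frame k b b)))\<^sup>2"
proof -
  define P Q R N where "P = frame k a a" and "Q = frame k b b" and "R = frame k a b"
    and "N = (mat 1 - P) ** Ms ** (mat 1 - Q)"
  note oa = svd_orthonormal_left[OF svdM] and ob = svd_orthonormal_right[OF svdM]
  have svdN: "svd N k' n u v" using svdN by (simp add: N_def P_def Q_def)
  note ou = svd_orthonormal_left[OF svdN] and ov = svd_orthonormal_right[OF svdN]
  have n_pos: "0 < n i" if "i < k'" for i using svd_pos[OF svdN that] .
  have Psym: "(P *v x) \<bullet> y = x \<bullet> (P *v y)" for x y by (simp add: P_def inner_frame)
  have Qsym: "(Q *v x) \<bullet> y = x \<bullet> (Q *v y)" for x y by (simp add: Q_def inner_frame)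
  have PP: "P *v (P *v x) = P *v x" for x by (simp add: P_def frame_mult_frame_vec oa)
  have QQ: "Q *v (Q *v x) = Q *v x" for x by (simp add: Q_def frame_mult_frame_vec ob)
  have MQ: "M *v (Q *v x) = M *v x" for x
    by (simp add: matrix_vector_mul_assoc Q_def svd_frame_right[OF svdM])
  have PM: "P *v (M *v x) = M *v x" for x
    by (simp add: matrix_vector_mul_assoc P_def svd_frame_left[OF svdM])
  have Nx: "N *v x = (Ms *v (x - Q *v x)) - P *v (Ms *v (x - Q *v x))" for x
    by (simp add: N_def matrix_vector_mult_diff_rdistrib flip: matrix_vector_mul_assoc)
  have PN: "P *v (N *v x) = 0" for x by (simp add: Nx matrix_vector_mult_diff_distrib PP)
  have NQ: "N *v (Q *v x) = 0" for x by (simp add: Nx QQ)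
  note corner = corner_singular_vectors[OF oa ob svdN[unfolded N_def P_def Q_def]]
  have Pu: "P *v u i = 0" if "i < k'" for i
    unfolding P_def frame_mult_vec using corner(1)[OF that] by simp
  have Qv: "Q *v v i = 0" if "i < k'" for i
    unfolding Q_def frame_mult_vec using corner(2)[OF that] by simp
  have Pu0: "u i \<bullet> (P *v x) = 0" if "i < k'" for i x
    using Psym[of "u i" x] Pu[OF that] by simp
  \<comment> \<open>\<open>u i\<close> and \<open>v j\<close> are orthogonal to the column and row
    space of \<open>M\<close>, so \<open>Ms\<close> and its corner agree between them: the singular
    pairs of \<open>N\<close> diagonalise a block of \<open>Ms\<close>.\<close>
  have uMv: "u i \<bullet> (Ms *v v j) = (if i = j then n i else 0)" if "i < k'" "j < k'" for i j
  proof -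
    have "u i \<bullet> (N *v v j) = u i \<bullet> (Ms *v v j)"
      using that by (simp add: Nx Qv inner_diff_right Pu0)
    then show ?thesis
      using that ou by (auto simp: svd_mult_right[OF svdN] orthonormal_def)
  qed
  \<comment> \<open>Schur complement of that block. Its rank is at most \<open>rs - k'\<close>,
    which leaves enough room in the row space of \<open>M\<close> for a frame on which it is
    invisible.\<close>
  define M' where "M' = Ms - (\<Sum>i<k'. (1 / n i) *\<^sub>R outer (Ms *v v i) (transpose Ms *v u i))"
  have rank_M': "rank M' + k' \<le> rank Ms"
    unfolding M'_def by (rule wedderburn_rank) (use n_pos uMv in \<open>force+\<close>)
  obtain q \<sigma>' u' v' where svdM': "svd M' q \<sigma>' u' v'" and q: "q \<le> rank M'"
    using svd_exists by blast
  define y where "y i = Q *v (transpose Ms *v u i)" for i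
  define x where "x i = Ms *v v i" for i
  define z where "z i = frame k b a *v x i" for i
  \<comment> \<open>Each rank-one term of \<open>Ms - M'\<close> contributes (z_i . f) (y_i . f) /
    n_i. Since c d is at most ((c + d) / 2)^2, this is at most (h_i . f)^2, which explains the
    factor 2 sqrt n_i.\<close>
  define h where "h i = (1 / (2 * sqrt (n i))) *\<^sub>R (z i + y i)" for i
  define m where "m = k - rs"
  define S where "S = {x. Q *v x = x}"
  \<comment> \<open>Transported left singular vectors of \<open>M'\<close>: a frame orthogonal to
    them makes \<open>M'\<close> pair to 0 with \<open>W\<close>.\<close>
  define C where "C = (\<lambda>l. frame k b a *v u' l) ` {..<q}"
  have "card C \<le> q" unfolding C_def using card_image_le[of "{..<q}"] by simp
  then have "m + k' + card C \<le> k" using rs rank_M' q by (simp add: m_def)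
  then have "m + k' + card C \<le> dim S" using dim_frame_range(2)[OF ob] by (simp add: S_def Q_def)
  then obtain f where of: "orthonormal (m + k') f" and fS: "\<And>j. j < m + k' \<Longrightarrow> f j \<in> S"
    and fC: "\<And>c j. j < m + k' \<Longrightarrow> c \<in> C \<Longrightarrow> c \<bullet> f j = 0"
    and f1: "\<And>i j. j < m \<Longrightarrow> i < k' \<Longrightarrow> h i \<bullet> f j = 0"
    and f2: "\<And>i j. j < i \<Longrightarrow> i < k' \<Longrightarrow> h i \<bullet> f (m + j) = 0"
    using adapted_frame_exists[of S C m k' h] dim_frame_range(1)[OF ob]
    by (auto simp: S_def Q_def C_def)
  have Qf: "Q *v f j = f j" if "j < m + k'" for j using fS[OF that] by (simp add: S_def)
  \<comment> \<open>Weight \<open>s\<close> on \<open>m = k - rs\<close> directions unmatched by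
    \<open>Ms\<close>, and \<open>t * n\<close> on \<open>k'\<close> further ones, which pick up the
    nuclear norm of the corner.\<close>
  define w where "w j = (if j < m then s else t * n (j - m))" for j
  have w0: "0 \<le> w j" if "j < m + k'" for j
  proof (cases "j < m")
    case False
    then have "0 < n (j - m)" using that by (intro n_pos) auto
    then show ?thesis using False t by (simp add: w_def)
  qed (simp add: w_def s)
  have sum_w: "(\<Sum>j<m + k'. g (w j)) = real m * g s + (\<Sum>i<k'. g (t * n i))" for g :: "real \<Rightarrow> real"
  proof -
    have "(\<Sum>j<m + K. g (w j)) = (\<Sum>j<m. g (w j)) + (\<Sum>i<K. g (w (m + i)))" for K
      by (induction K) simp_all
    then show ?thesis by (simp add: w_def)
  qed
  define W where "W = (\<Sum>j<m + k'. w j *\<^sub>R outer (R *v f j) (f j))"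
  have oRf: "orthonormal (m + k') (\<lambda>j. R *v f j)"
    using of Qf unfolding orthonormal_def R_def
    by (simp add: inner_frame_frame[OF oa] flip: Q_def)
  have normW: "(norm W)\<^sup>2 = real m * s\<^sup>2 + t\<^sup>2 * (\<Sum>i<k'. (n i)\<^sup>2)"
    unfolding W_def norm_sum_scaleR_outer[OF oRf of] sum_w[of "\<lambda>x. x\<^sup>2"]
    by (simp add: power_mult_distrib sum_distrib_left)
  have inner_W: "A \<bullet> W = (\<Sum>j<m + k'. w j * ((R *v f j) \<bullet> (A *v f j)))" for A
    by (simp add: W_def inner_sum_right inner_outer_right)
  have MW: "s * (real m * s + t * (\<Sum>i<k'. n i)) \<le> M \<bullet> W"
  proof -
    \<comment> \<open>Moved to the row space by the transpose of \<open>R\<close>, \<open>M\<close>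
      acts as the sum of the \<sigma>_i b_i b_i^T, which is at least \<open>s\<close> on unit
      vectors of \<open>S\<close>.\<close>
    have "s \<le> (R *v f j) \<bullet> (M *v f j)" if j: "j < m + k'" for j
    proof -
      have "(R *v f j) \<bullet> (M *v f j) = (\<Sum>i<k. \<sigma> i * ((b i \<bullet> f j) * (a i \<bullet> (R *v f j))))"
        by (simp add: svd_eq[OF svdM] matrix_vector_sum_left scaleR_matrix_vector outer_mult_vec
            inner_sum_right inner_commute mult.assoc)
      also have "\<dots> = (\<Sum>i<k. \<sigma> i * (b i \<bullet> f j)\<^sup>2)"
      proof (rule sum.cong)
        fix i assume "i \<in> {..<k}"
        then have "a i \<bullet> (R *v f j) = b i \<bullet> f j"
          using inner_frame[of k b a "a i" "f j"] by (simp add: R_def frame_mult_basis[OF oa])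
        then show "\<sigma> i * ((b i \<bullet> f j) * (a i \<bullet> (R *v f j))) = \<sigma> i * (b i \<bullet> f j)\<^sup>2"
          by (simp add: power2_eq_square)
      qed simp
      also have "\<dots> \<ge> (\<Sum>i<k. s * (b i \<bullet> f j)\<^sup>2)"
        by (intro sum_mono mult_right_mono) (use s in auto)
      also have "(\<Sum>i<k. s * (b i \<bullet> f j)\<^sup>2) = s * (f j \<bullet> (Q *v f j))"
        by (simp add: Q_def frame_mult_vec inner_sum_right sum_distrib_left power2_eq_square inner_commute)
      also have "\<dots> = s" using of j by (simp add: Qf orthonormal_def)
      finally show ?thesis .
    qed
    then have "(\<Sum>j<m + k'. w j * s) \<le> M \<bullet> W"
      unfolding inner_W using w0 by (intro sum_mono mult_left_mono) auto
    moreover have "(\<Sum>j<m + k'. w j * s) = s * (real m * s + t * (\<Sum>i<k'. n i))"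
      using sum_w[of "\<lambda>x. x * s"] by (simp add: sum_distrib_left algebra_simps)
    ultimately show ?thesis by simp
  qed
  have NW: "N \<bullet> W = 0"
  proof -
    have "N *v f j = 0" if "j < m + k'" for j using NQ[of "f j"] Qf[OF that] by simp
    then show ?thesis unfolding inner_W by (intro sum.neutral) simp
  qed
  define \<beta> \<gamma> where "\<beta> = (\<Sum>i<k'. (norm (P *v x i))\<^sup>2)" and "\<gamma> = (\<Sum>i<k'. (norm (y i))\<^sup>2)"
  have norm_z: "norm (z i) = norm (P *v x i)" for i
    unfolding z_def P_def by (rule norm_frame[OF ob oa])
  have MsW: "Ms \<bullet> W \<le> (\<beta> + \<gamma>) / 2"
  proof -
    have term_le: "(R *v f j) \<bullet> (Ms *v f j) \<le> (\<Sum>i<k'. (h i \<bullet> f j)\<^sup>2)" if j: "j < m + k'" for j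
    proof -
      have Rz: "(R *v f j) \<bullet> c = (frame k b a *v c) \<bullet> f j" for c
        unfolding R_def inner_frame[of k a b] by (rule inner_commute)
      have yf: "(transpose Ms *v u i) \<bullet> f j = y i \<bullet> f j" for i
        by (simp add: y_def Qsym Qf[OF j] del: transpose_matrix_vector)
      have "(R *v f j) \<bullet> (M' *v f j) = (\<Sum>l<q. \<sigma>' l * (v' l \<bullet> f j) * ((R *v f j) \<bullet> u' l))"
        by (simp add: svd_eq[OF svdM'] matrix_vector_sum_left scaleR_matrix_vector outer_mult_vec
            inner_sum_right mult_ac)
      also have "\<dots> = 0"
        by (intro sum.neutral ballI) (use fC[OF j] in \<open>auto simp: Rz C_def\<close>)
      finally have M'0: "(R *v f j) \<bullet> (M' *v f j) = 0" .
      define A where "A = (\<Sum>i<k'. (1 / n i) *\<^sub>R outer (x i) (transpose Ms *v u i))"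
      have "Ms *v f j = (M' + A) *v f j" by (simp add: M'_def A_def x_def)
      also have "\<dots> = M' *v f j + A *v f j" by (rule matrix_vector_mult_add_rdistrib)
      finally have "(R *v f j) \<bullet> (Ms *v f j) = (R *v f j) \<bullet> (A *v f j)"
        by (simp only: inner_add_right M'0 add_0)
      also have "\<dots> = (\<Sum>i<k'. (1 / n i) * ((z i \<bullet> f j) * (y i \<bullet> f j)))"
        by (simp add: A_def matrix_vector_sum_left scaleR_matrix_vector outer_mult_vec
            inner_sum_right yf Rz mult_ac z_def del: transpose_matrix_vector)
      also have "\<dots> \<le> (\<Sum>i<k'. (h i \<bullet> f j)\<^sup>2)"
      proof (rule sum_mono)
        fix i assume "i \<in> {..<k'}"
        then have n: "0 < n i" using n_pos by simp
        have sq: "c * d \<le> ((c + d) / 2)\<^sup>2" for c d :: real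
          using sum_squares_bound[of c d] by (simp add: power2_eq_square field_simps)
        have "(h i \<bullet> f j)\<^sup>2 = (1 / n i) * ((z i \<bullet> f j + y i \<bullet> f j) / 2)\<^sup>2"
          using n by (simp add: h_def inner_add_left power_divide power_mult_distrib field_simps)
        then show "(1 / n i) * ((z i \<bullet> f j) * (y i \<bullet> f j)) \<le> (h i \<bullet> f j)\<^sup>2"
          using sq n by (metis divide_pos_pos mult_left_mono less_imp_le zero_less_one)
      qed
      finally show ?thesis .
    qed
    have "Ms \<bullet> W \<le> (\<Sum>j<m + k'. w j * (\<Sum>i<k'. (h i \<bullet> f j)\<^sup>2))"
      unfolding inner_W using w0 term_le by (intro sum_mono mult_left_mono) auto
    also have "\<dots> = (\<Sum>j<m + k'. \<Sum>i<k'. w j * (h i \<bullet> f j)\<^sup>2)" by (simp add: sum_distrib_left)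
    \<comment> \<open>Purpose of the triangular frame: \<open>h i\<close> meets f_j only for
      \<open>j - m \<ge> i\<close>, where the descending order gives
      \<open>t * n (j - m) \<le> n i\<close>. So \<open>w j\<close> can be replaced by
      \<open>n i\<close>, and Bessel applies for each \<open>i\<close>.\<close>
    also have "\<dots> \<le> (\<Sum>j<m + k'. \<Sum>i<k'. n i * (h i \<bullet> f j)\<^sup>2)"
    proof (intro sum_mono)
      fix j i assume ji: "j \<in> {..<m + k'}" "i \<in> {..<k'}"
      show "w j * (h i \<bullet> f j)\<^sup>2 \<le> n i * (h i \<bullet> f j)\<^sup>2"
      proof (cases "j < m \<or> j - m < i")
        case True
        then have "h i \<bullet> f j = 0"
          using f1[of j i] f2[of "j - m" i] ji by (cases "j < m") auto
        then show ?thesis by simp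
      next
        case False
        then have "n (j - m) \<le> n i" using ji svd_mono[OF svdN, of i "j - m"] by auto
        moreover have "0 < n (j - m)" using ji False by (intro n_pos) auto
        ultimately have "t * n (j - m) \<le> 1 * n i" using t by (intro mult_mono) auto
        then have "w j \<le> n i" using False by (simp add: w_def)
        then show ?thesis by (rule mult_right_mono) simp
      qed
    qed
    also have "\<dots> = (\<Sum>i<k'. n i * (\<Sum>j<m + k'. (h i \<bullet> f j)\<^sup>2))"
      unfolding sum_distrib_left by (rule sum.swap)
    also have "\<dots> \<le> (\<Sum>i<k'. n i * (norm (h i))\<^sup>2)"
      using orthonormal_bessel[OF of subset_refl] n_pos
      by (intro sum_mono mult_left_mono) (auto intro: less_imp_le)
    also have "\<dots> \<le> (\<Sum>i<k'. ((norm (P *v x i))\<^sup>2 + (norm (y i))\<^sup>2) / 2)"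
    proof (rule sum_mono)
      fix i assume "i \<in> {..<k'}"
      then have n: "0 < n i" using n_pos by simp
      have "n i * (norm (h i))\<^sup>2 = (norm (z i + y i))\<^sup>2 / 4"
      proof -
        have "norm (h i) = norm (z i + y i) / (2 * sqrt (n i))" using n by (simp add: h_def)
        then show ?thesis using n by (simp add: power_mult_distrib power_divide)
      qed
      also have "(norm (z i + y i))\<^sup>2 \<le> 2 * (norm (z i))\<^sup>2 + 2 * (norm (y i))\<^sup>2"
        using zero_le_power2[of "norm (z i - y i)"] unfolding power2_norm_eq_inner
        by (simp add: inner_diff_left inner_diff_right inner_add_left inner_add_right inner_commute)
      finally show "n i * (norm (h i))\<^sup>2 \<le> ((norm (P *v x i))\<^sup>2 + (norm (y i))\<^sup>2) / 2"
        by (simp add: norm_z)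
    qed
    also have "\<dots> = (\<beta> + \<gamma>) / 2"
      by (simp add: \<beta>_def \<gamma>_def sum.distrib flip: sum_divide_distrib)
    finally show ?thesis .
  qed
  \<comment> \<open>Pairing \<open>X\<close> with \<open>- B - C'\<close> contributes
    \<open>2 * (\<beta> + \<gamma>)\<close> to the test inequality: one half pays for the squared
    norm of \<open>B + C'\<close>, the other for the bound on
    \<open>2 * (Ms \<bullet> W)\<close>.\<close>
  define B C' where "B = (\<Sum>i<k'. outer (P *v x i) (v i))" and "C' = (\<Sum>i<k'. outer (u i) (y i))"
  define X where "X = M - Ms + N"
  have Mv: "M *v v i = 0" if "i < k'" for i using MQ[of "v i"] Qv[OF that] by simp
  have uM: "u i \<bullet> (M *v c) = 0" if "i < k'" for i c using PM[of c] Pu0[OF that] by metis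
  have XB: "X \<bullet> B = - \<beta>"
  proof -
    have "(P *v x i) \<bullet> (X *v v i) = - (norm (P *v x i))\<^sup>2" if "i < k'" for i
    proof -
      have "X *v v i = N *v v i - x i"
        by (simp add: X_def matrix_vector_mult_diff_rdistrib matrix_vector_mult_add_rdistrib Mv[OF that] x_def)
      then have "(P *v x i) \<bullet> (X *v v i) = x i \<bullet> (P *v (N *v v i)) - x i \<bullet> (P *v x i)"
        by (simp add: Psym matrix_vector_mult_diff_distrib inner_diff_right)
      also have "\<dots> = - (norm (P *v x i))\<^sup>2"
        by (simp add: PN power2_norm_eq_inner Psym PP)
      finally show ?thesis .
    qed
    then show ?thesis by (simp add: B_def \<beta>_def inner_sum_right inner_outer_right flip: sum_negf)
  qed
  have XC: "X \<bullet> C' = - \<gamma>"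
  proof -
    have "u i \<bullet> (X *v y i) = - (norm (y i))\<^sup>2" if "i < k'" for i
    proof -
      have Qy: "Q *v y i = y i" by (simp add: y_def QQ del: transpose_matrix_vector)
      have Ny: "N *v y i = 0" using NQ[of "y i"] unfolding Qy .
      have "u i \<bullet> (X *v y i) = - (u i \<bullet> (Ms *v y i))"
        by (simp add: Ny X_def matrix_vector_mult_diff_rdistrib matrix_vector_mult_add_rdistrib
            inner_diff_right inner_add_right uM[OF that])
      also have "\<dots> = - ((transpose Ms *v u i) \<bullet> (Q *v y i))"
        by (simp add: Qy inner_transpose_mult del: transpose_matrix_vector)
      also have "\<dots> = - (norm (y i))\<^sup>2"
        by (simp add: power2_norm_eq_inner y_def QQ flip: Qsym del: transpose_matrix_vector)
      finally show ?thesis .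
    qed
    then show ?thesis by (simp add: C'_def \<gamma>_def inner_sum_right inner_outer_right flip: sum_negf)
  qed
  have BB: "B \<bullet> B = \<beta>"
  proof -
    have "B *v v i = P *v x i" if "i < k'" for i
      unfolding B_def matrix_vector_sum_left outer_mult_vec
      by (rule sum_lessThan_delta) (use that ov in \<open>auto simp: orthonormal_def\<close>)
    then have "(\<Sum>i<k'. (P *v x i) \<bullet> (B *v v i)) = \<beta>" by (simp add: \<beta>_def power2_norm_eq_inner)
    then show ?thesis by (subst (2) B_def) (simp add: inner_sum_right inner_outer_right)
  qed
  have CC: "C' \<bullet> C' = \<gamma>"
  proof -
    have "u i \<bullet> (C' *v c) = y i \<bullet> c" if "i < k'" for i c
    proof -
      have "u i \<bullet> (C' *v c) = (\<Sum>j<k'. (u i \<bullet> u j) *\<^sub>R (y j \<bullet> c))"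
        by (simp add: C'_def matrix_vector_sum_left outer_mult_vec inner_sum_right mult.commute)
      also have "\<dots> = y i \<bullet> c"
        by (rule sum_lessThan_delta) (use that ou in \<open>auto simp: orthonormal_def\<close>)
      finally show ?thesis .
    qed
    then have "(\<Sum>i<k'. u i \<bullet> (C' *v y i)) = \<gamma>" by (simp add: \<gamma>_def power2_norm_eq_inner)
    then show ?thesis by (subst (2) C'_def) (simp add: inner_sum_right inner_outer_right)
  qed
  have BC: "B \<bullet> C' = 0"
  proof -
    have "u i \<bullet> (B *v c) = 0" if "i < k'" for i c
      using Pu0[OF that] by (simp add: B_def matrix_vector_sum_left outer_mult_vec inner_sum_right)
    then show ?thesis by (simp add: C'_def inner_sum_right inner_outer_right)
  qed
  have WB: "W \<bullet> B = 0"
  proof -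
    have "W *v v i = 0" if "i < k'" for i
    proof -
      have "f j \<bullet> v i = 0" if "j < m + k'" for j
        using Qsym[of "f j" "v i"] Qf[OF that] Qv[OF \<open>i < k'\<close>] by simp
      then show ?thesis by (simp add: W_def matrix_vector_sum_left scaleR_matrix_vector outer_mult_vec)
    qed
    then show ?thesis by (simp add: B_def inner_sum_right inner_outer_right)
  qed
  have WC: "W \<bullet> C' = 0"
  proof -
    have "u i \<bullet> (W *v c) = 0" if "i < k'" for i c
    proof -
      have "u i \<bullet> (R *v f j) = 0" for j
        using Pu0[OF that, of "R *v f j"] by (simp add: P_def R_def frame_mult_frame_vec oa)
      then show ?thesis
        by (simp add: W_def matrix_vector_sum_left scaleR_matrix_vector outer_mult_vec inner_sum_right)
    qed
    then show ?thesis by (simp add: C'_def inner_sum_right inner_outer_right)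
  qed
  have "2 * (X \<bullet> (W - B - C')) - (norm (W - B - C'))\<^sup>2 \<le> (norm X)\<^sup>2"
    by (rule norm_power2_diff_bound)
  moreover have "(norm (W - B - C'))\<^sup>2 = (norm W)\<^sup>2 + \<beta> + \<gamma>"
    unfolding power2_norm_eq_inner
    by (simp add: inner_diff_left inner_diff_right WB WC BC BB CC inner_commute[of B W]
        inner_commute[of C' W] inner_commute[of C' B])
  moreover have "X \<bullet> (W - B - C') = M \<bullet> W - Ms \<bullet> W + \<beta> + \<gamma>"
    by (simp add: inner_diff_right XB XC) (simp add: X_def inner_diff_left inner_add_left NW)
  ultimately have "2 * (s * (real m * s + t * (\<Sum>i<k'. n i))) - (norm W)\<^sup>2 \<le> (norm X)\<^sup>2"
    using MW MsW by argo
  then show ?thesis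
    unfolding normW X_def N_def P_def Q_def m_def by (simp add: algebra_simps power2_eq_square)
qed

section \<open>The scalar optimisation\<close>

text \<open>
  \<open>\<tau>\<close> is the smaller singular value of the matrix with rows \<open>(m, 0)\<close> and \<open>(- \<kappa>, m)\<close>, whence the
  relation \<open>\<tau> (\<tau> + \<kappa>) = m\<^sup>2\<close>.
\<close>

lemma multiplier_exists_scalar:
  fixes a b x :: real
  assumes nonneg: "0 \<le> a" "0 < b" "0 \<le> x" "0 \<le> \<kappa>" "0 < \<tau>" "0 < m"
    and root: "\<tau>\<^sup>2 + \<kappa> * \<tau> = m\<^sup>2"
    and geo: "\<And>y. 0 \<le> y \<Longrightarrow> y \<le> b \<Longrightarrow> 2 * x * y - y\<^sup>2 \<le> a\<^sup>2"
  obtains c where "0 \<le> c" "0 < a\<^sup>2 + c\<^sup>2 * b\<^sup>2"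
    "\<tau> * sqrt (a\<^sup>2 + b\<^sup>2) * sqrt (a\<^sup>2 + c\<^sup>2 * b\<^sup>2) \<le> m * (a\<^sup>2 + c * b\<^sup>2) - c * (\<kappa> * x * b)"
proof (cases "m * b \<le> \<kappa> * x")
  case True
  \<comment> \<open>The unconstrained optimum has c at most 0, so c = 0 is used. Squaring with
    \<open>root\<close> reduces the claim to
    \<open>\<tau> * b\<^sup>2 \<le> \<kappa> * a\<^sup>2\<close>.\<close>
  have *: "0 < a \<and> \<tau> * b\<^sup>2 \<le> \<kappa> * a\<^sup>2"
  proof (cases "x \<le> b")
    case xb: True
    have "x\<^sup>2 \<le> a\<^sup>2" using geo[of x] nonneg xb by (simp add: power2_eq_square)
    then have "x \<le> a" using nonneg by (simp add: power2_le_iff_abs_le)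
    then have ka: "m * b \<le> \<kappa> * a" using True nonneg by (meson mult_left_mono order_trans)
    have "0 < m * b" using nonneg by simp
    then have "0 < \<kappa> * a" using ka by linarith
    then have pos: "0 < \<kappa>" "0 < a" using nonneg by (auto simp: zero_less_mult_iff)
    have "(m * b)\<^sup>2 \<le> (\<kappa> * a)\<^sup>2" using ka \<open>0 < m * b\<close> by (intro power_mono) auto
    moreover have "(\<kappa> * \<tau>) * b\<^sup>2 \<le> m\<^sup>2 * b\<^sup>2" unfolding root[symmetric] by (intro mult_right_mono) auto
    ultimately have "\<kappa> * (\<tau> * b\<^sup>2) \<le> \<kappa> * (\<kappa> * a\<^sup>2)" by (simp add: power_mult_distrib power2_eq_square mult_ac)
    then show ?thesis using pos by simp
  next
    case xb: False
    have g: "2 * x * b - b\<^sup>2 \<le> a\<^sup>2" using geo[of b] nonneg by simp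
    have "b * b \<le> x * b" using xb nonneg by (intro mult_right_mono) auto
    then have ab: "b\<^sup>2 \<le> a\<^sup>2" using g by (simp add: power2_eq_square)
    have "0 < b\<^sup>2" using nonneg by simp
    then have "0 < a" using ab nonneg by (metis less_le_trans power2_eq_square order_le_less mult_zero_left less_irrefl)
    moreover have "\<tau> * b\<^sup>2 \<le> \<kappa> * a\<^sup>2"
    proof (cases "\<tau> \<le> \<kappa>")
      case True
      then show ?thesis using ab nonneg by (intro mult_mono) auto
    next
      case False
      have "0 \<le> (3 * \<tau> - \<kappa>) * (\<tau> + \<kappa>)" using False nonneg by (intro mult_nonneg_nonneg) auto
      then have "(\<tau> + \<kappa>)\<^sup>2 \<le> 4 * (\<tau>\<^sup>2 + \<kappa> * \<tau>)" by (simp add: power2_eq_square algebra_simps)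
      then have "(\<tau> + \<kappa>)\<^sup>2 \<le> (2 * m)\<^sup>2" unfolding root by (simp add: power_mult_distrib)
      then have "\<tau> + \<kappa> \<le> 2 * m" by (rule power2_le_imp_le) (use nonneg in simp)
      then have tk: "\<tau> \<le> 2 * m - \<kappa>" by simp
      have "\<tau> * b\<^sup>2 \<le> (2 * m - \<kappa>) * b\<^sup>2" using tk by (rule mult_right_mono) simp
      also have "\<dots> = 2 * b * (m * b) - \<kappa> * b\<^sup>2" by (simp add: algebra_simps power2_eq_square)
      also have "\<dots> \<le> 2 * b * (\<kappa> * x) - \<kappa> * b\<^sup>2" using True nonneg by simp
      also have "\<dots> = \<kappa> * (2 * x * b - b\<^sup>2)" by (simp add: algebra_simps)
      also have "\<dots> \<le> \<kappa> * a\<^sup>2" using g nonneg by (intro mult_left_mono) auto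
      finally show ?thesis .
    qed
    ultimately show ?thesis by simp
  qed
  have "(\<tau> * sqrt (a\<^sup>2 + b\<^sup>2))\<^sup>2 = \<tau>\<^sup>2 * a\<^sup>2 + \<tau> * (\<tau> * b\<^sup>2)"
    by (simp add: power_mult_distrib algebra_simps power2_eq_square)
  also have "\<dots> \<le> \<tau>\<^sup>2 * a\<^sup>2 + \<tau> * (\<kappa> * a\<^sup>2)" using * nonneg by simp
  also have "\<dots> = (m * a)\<^sup>2" unfolding power_mult_distrib root[symmetric] by (simp add: algebra_simps power2_eq_square)
  finally have "\<tau> * sqrt (a\<^sup>2 + b\<^sup>2) \<le> m * a" using nonneg by (simp add: power2_le_iff_abs_le)
  then have "\<tau> * sqrt (a\<^sup>2 + b\<^sup>2) * a \<le> m * a * a" using nonneg by (intro mult_right_mono)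
  then show thesis using * nonneg by (intro that[of 0]) (auto simp: power2_eq_square mult_ac)
next
  case False
  \<comment> \<open>\<open>c\<close> makes \<open>(a, c b)\<close> parallel to \<open>(m a, m b - \<kappa> x)\<close>, which is optimal by Cauchy--Schwarz.\<close>
  define d where "d = m * b - \<kappa> * x"
  have d: "0 < d" using False by (simp add: d_def)
  define c where "c = d / (m * b)"
  define K where "K = sqrt (m\<^sup>2 * a\<^sup>2 + d\<^sup>2)"
  have K: "K > 0" using d by (simp add: K_def add_nonneg_pos)
  have K2: "K\<^sup>2 = m\<^sup>2 * a\<^sup>2 + d\<^sup>2" by (simp add: K_def)
  have cb: "c * b = d / m" using nonneg by (simp add: c_def)
  have sum: "a\<^sup>2 + c\<^sup>2 * b\<^sup>2 = (K / m)\<^sup>2"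
    using nonneg unfolding power_mult_distrib[symmetric] cb power_divide K2 by (simp add: field_simps)
  \<comment> \<open>\<kappa> times this quadratic is the difference of the squares in
    \<open>\<tau> * sqrt (a\<^sup>2 + b\<^sup>2) \<le> K\<close>. Replacing a by its lower bound x
    turns it into (m x - \<tau> b)^2 / \<tau>; for x > b the constraint at y = b takes over.\<close>
  have key: "0 \<le> \<tau> * (a\<^sup>2 + b\<^sup>2) - 2 * m * b * x + \<kappa> * x\<^sup>2"
  proof (cases "x \<le> b")
    case xb: True
    have g: "x\<^sup>2 \<le> a\<^sup>2" using geo[of x] nonneg xb by (simp add: power2_eq_square)
    have "0 \<le> (m * x - \<tau> * b)\<^sup>2" by simp
    also have "\<dots> = m\<^sup>2 * x\<^sup>2 - 2 * m * x * \<tau> * b + \<tau>\<^sup>2 * b\<^sup>2" by (simp add: power2_eq_square algebra_simps)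
    also have "\<dots> = \<tau> * (\<tau> * (x\<^sup>2 + b\<^sup>2) - 2 * m * b * x + \<kappa> * x\<^sup>2)"
      unfolding root[symmetric] by (simp add: power2_eq_square algebra_simps)
    finally have "0 \<le> \<tau> * (x\<^sup>2 + b\<^sup>2) - 2 * m * b * x + \<kappa> * x\<^sup>2"
      using nonneg by (simp add: zero_le_mult_iff)
    moreover have "\<tau> * (x\<^sup>2 + b\<^sup>2) \<le> \<tau> * (a\<^sup>2 + b\<^sup>2)" using g nonneg by simp
    ultimately show ?thesis by linarith
  next
    case xb: False
    have g: "2 * x * b \<le> a\<^sup>2 + b\<^sup>2" using geo[of b] nonneg by simp
    have "(2 * m)\<^sup>2 = 4 * (\<tau>\<^sup>2 + \<kappa> * \<tau>)" unfolding root by (simp add: power_mult_distrib)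
    also have "\<dots> \<le> (2 * \<tau> + \<kappa>)\<^sup>2" by (simp add: power2_eq_square algebra_simps)
    finally have "(2 * m)\<^sup>2 \<le> (2 * \<tau> + \<kappa>)\<^sup>2" .
    then have "2 * m \<le> 2 * \<tau> + \<kappa>" by (rule power2_le_imp_le) (use nonneg in simp)
    then have "0 \<le> (2 * \<tau> + \<kappa> - 2 * m) * (x * b)" using nonneg by (intro mult_nonneg_nonneg) auto
    moreover have "\<kappa> * (x * b) \<le> \<kappa> * x\<^sup>2"
      unfolding power2_eq_square using xb nonneg by (intro mult_left_mono) auto
    moreover have "\<tau> * (2 * x * b) \<le> \<tau> * (a\<^sup>2 + b\<^sup>2)" using g nonneg by (intro mult_left_mono) auto
    ultimately show ?thesis by (simp add: algebra_simps)
  qed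
  have "K\<^sup>2 - \<tau>\<^sup>2 * (a\<^sup>2 + b\<^sup>2) = \<kappa> * (\<tau> * (a\<^sup>2 + b\<^sup>2) - 2 * m * b * x + \<kappa> * x\<^sup>2)"
  proof -
    have "K\<^sup>2 = m\<^sup>2 * (a\<^sup>2 + b\<^sup>2) - 2 * m * b * \<kappa> * x + \<kappa>\<^sup>2 * x\<^sup>2"
      unfolding K2 d_def by (simp add: power2_eq_square algebra_simps)
    then show ?thesis unfolding root[symmetric] by (simp add: power2_eq_square algebra_simps)
  qed
  moreover have "0 \<le> \<kappa> * (\<tau> * (a\<^sup>2 + b\<^sup>2) - 2 * m * b * x + \<kappa> * x\<^sup>2)"
    using key nonneg by (intro mult_nonneg_nonneg)
  ultimately have "\<tau>\<^sup>2 * (a\<^sup>2 + b\<^sup>2) \<le> K\<^sup>2" by linarith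
  then have "(\<tau> * sqrt (a\<^sup>2 + b\<^sup>2))\<^sup>2 \<le> K\<^sup>2" by (simp add: power_mult_distrib)
  then have tK: "\<tau> * sqrt (a\<^sup>2 + b\<^sup>2) \<le> K" using K nonneg by (simp add: power2_le_iff_abs_le)
  show thesis
  proof (rule that)
    show "0 \<le> c" using d nonneg by (simp add: c_def)
    show "0 < a\<^sup>2 + c\<^sup>2 * b\<^sup>2" unfolding sum using K nonneg by simp
    have "sqrt (a\<^sup>2 + c\<^sup>2 * b\<^sup>2) = K / m" unfolding sum using K nonneg by simp
    then have "\<tau> * sqrt (a\<^sup>2 + b\<^sup>2) * sqrt (a\<^sup>2 + c\<^sup>2 * b\<^sup>2) \<le> K * (K / m)"
      using tK K nonneg by (metis divide_nonneg_pos less_imp_le mult_right_mono)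
    also have "\<dots> = m * a\<^sup>2 + (c * b) * d"
      using K2 nonneg unfolding cb by (simp add: power2_eq_square field_simps)
    also have "\<dots> = m * (a\<^sup>2 + c * b\<^sup>2) - c * (\<kappa> * x * b)"
      by (simp add: d_def power2_eq_square algebra_simps)
    finally show "\<tau> * sqrt (a\<^sup>2 + b\<^sup>2) * sqrt (a\<^sup>2 + c\<^sup>2 * b\<^sup>2) \<le> m * (a\<^sup>2 + c * b\<^sup>2) - c * (\<kappa> * x * b)" .
  qed
qed

text \<open>Reduction to the scalar lemma with x = R s \<nu> / b and R = sqrt (r / rs),
  \<open>l\<close> standing for L2. The factor R cancels the root in \<kappa>, so that \<kappa> x b
  is the loss l s \<nu>. The work lies in sharpening \<open>geo\<close> by the factor R; this
  succeeds because the bound on \<nu> makes \<open>(r - rs) * s\<^sup>2\<close> dominate (R^2 - 1)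
  (s \<nu> / b)^2.\<close>

lemma multiplier_exists:
  fixes a b s \<nu> :: real
  assumes nonneg: "0 \<le> a" "0 \<le> b" "0 \<le> s" "0 \<le> \<nu>" "0 \<le> l" "0 < \<tau>" "0 < m" "0 < a \<or> 0 < b"
    and rs: "0 < rs" "rs \<le> (r :: real)"
    and \<kappa>: "\<kappa> = sqrt (rs / r) * l"
    and root: "\<tau>\<^sup>2 + \<kappa> * \<tau> = m\<^sup>2"
    and \<nu>: "\<nu>\<^sup>2 \<le> rs * b\<^sup>2"
    and geo: "s = 0 \<or> (\<forall>t. 0 \<le> t \<and> t \<le> 1 \<longrightarrow> (r - rs) * s\<^sup>2 + 2 * s * t * \<nu> - t\<^sup>2 * b\<^sup>2 \<le> a\<^sup>2)"
  obtains c where "0 \<le> c" "0 < a\<^sup>2 + c\<^sup>2 * b\<^sup>2"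
    "\<tau> * sqrt (a\<^sup>2 + b\<^sup>2) * sqrt (a\<^sup>2 + c\<^sup>2 * b\<^sup>2) \<le> m * (a\<^sup>2 + c * b\<^sup>2) - c * (l * s * \<nu>)"
proof (cases "s * \<nu> = 0")
  case True
  have \<kappa>0: "0 \<le> \<kappa>" using \<kappa> nonneg rs by simp
  have "\<tau>\<^sup>2 \<le> m\<^sup>2" unfolding root[symmetric] using nonneg \<kappa>0 by simp
  then have "\<tau> \<le> m" using nonneg by (simp add: power2_le_iff_abs_le)
  then have "\<tau> * (a\<^sup>2 + b\<^sup>2) \<le> m * (a\<^sup>2 + b\<^sup>2)" by (rule mult_right_mono) simp
  then show thesis
    using nonneg True by (intro that[of 1]) (auto simp: add_pos_nonneg add_nonneg_pos mult.assoc)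
next
  case False
  then have s: "0 < s" and \<nu>0: "0 < \<nu>" using nonneg by auto
  have b: "0 < b"
  proof (rule ccontr)
    assume "\<not> 0 < b"
    then have "\<nu>\<^sup>2 \<le> 0" using \<nu> nonneg by simp
    then show False using \<nu>0 by simp
  qed
  define R where "R = sqrt (r / rs)"
  define p where "p = s * \<nu>"
  define w where "w = b\<^sup>2"
  have R: "1 \<le> R" "R\<^sup>2 = r / rs" using rs by (simp_all add: R_def)
  have p: "0 < p" using s \<nu>0 by (simp add: p_def)
  have w: "0 < w" using b by (simp add: w_def)
  have Rinv: "sqrt (rs / r) * R = 1" using rs unfolding R_def by (simp flip: real_sqrt_mult)
  have geo': "(r - rs) * s\<^sup>2 + 2 * p * t - t\<^sup>2 * w \<le> a\<^sup>2" if "0 \<le> t" "t \<le> 1" for t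
  proof -
    have "(r - rs) * s\<^sup>2 + 2 * s * t * \<nu> - t\<^sup>2 * b\<^sup>2 \<le> a\<^sup>2" using geo s that by auto
    then show ?thesis by (simp add: p_def w_def mult_ac)
  qed
  have big: "(R\<^sup>2 - 1) * (p\<^sup>2 / w) \<le> (r - rs) * s\<^sup>2"
  proof -
    have "p\<^sup>2 \<le> s\<^sup>2 * (rs * w)" using \<nu> by (simp add: p_def w_def power_mult_distrib mult_left_mono)
    then have "p\<^sup>2 / w \<le> rs * s\<^sup>2" using w by (simp add: divide_le_eq mult_ac)
    moreover have "0 \<le> R\<^sup>2 - 1" using R(1) by simp
    ultimately have "(R\<^sup>2 - 1) * (p\<^sup>2 / w) \<le> (R\<^sup>2 - 1) * (rs * s\<^sup>2)" by (rule mult_left_mono)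
    also have "\<dots> = (r - rs) * s\<^sup>2" using R(2) rs by (simp add: field_simps)
    finally show ?thesis .
  qed
  \<comment> \<open>For small t the surplus \<open>big\<close> covers the missing 2 (R - 1) p t. For
    large t the point p / w is admissible in \<open>geo'\<close> and yields R^2 p^2 / w <= a^2,
    where R^2 p^2 / w is the maximum of the left side over all real t.\<close>
  have main: "2 * R * p * t - t\<^sup>2 * w \<le> a\<^sup>2" if t: "0 \<le> t" "t \<le> 1" for t
  proof (cases "2 * t \<le> (R + 1) * (p / w)")
    case True
    have "0 \<le> (R - 1) * p" using R p by simp
    then have "(R - 1) * p * (2 * t) \<le> (R - 1) * p * ((R + 1) * (p / w))" using True by (rule mult_left_mono[rotated])
    also have "\<dots> = (R\<^sup>2 - 1) * (p\<^sup>2 / w)" by (simp add: power2_eq_square algebra_simps)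
    also note big
    finally show ?thesis using geo'[OF t] by (simp add: algebra_simps)
  next
    case False
    have "2 * (p / w) \<le> (R + 1) * (p / w)" using R p w by (intro mult_right_mono) auto
    then have "2 * (p / w) < 2 * t" using False by linarith
    then have t': "p / w \<le> 1" "0 \<le> p / w" using t p w by (linarith, simp)
    have "2 * p * (p / w) - (p / w)\<^sup>2 * w = p\<^sup>2 / w" using w by (simp add: power2_eq_square field_simps)
    moreover have "(R\<^sup>2 - 1) * (p\<^sup>2 / w) = R\<^sup>2 * (p\<^sup>2 / w) - p\<^sup>2 / w" by (simp only: left_diff_distrib mult_1)
    ultimately have a2: "R\<^sup>2 * (p\<^sup>2 / w) \<le> a\<^sup>2" using geo'[OF t'(2,1)] big by linarith
    have "0 \<le> (R * p - t * w)\<^sup>2 / w" using w by simp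
    also have "\<dots> = R\<^sup>2 * (p\<^sup>2 / w) - 2 * R * p * t + t\<^sup>2 * w" using w by (simp add: power2_eq_square field_simps)
    finally show ?thesis using a2 by linarith
  qed
  define x where "x = R * p / b"
  have lsn: "\<kappa> * x * b = l * s * \<nu>"
  proof -
    have "\<kappa> * x * b = (sqrt (rs / r) * R) * (l * p)" using b by (simp add: \<kappa> x_def)
    then show ?thesis by (simp add: Rinv p_def mult.assoc)
  qed
  have "2 * x * y - y\<^sup>2 \<le> a\<^sup>2" if y: "0 \<le> y" "y \<le> b" for y
  proof -
    have "2 * R * p * (y / b) - (y / b)\<^sup>2 * w \<le> a\<^sup>2" using y b by (intro main) auto
    then show ?thesis using b by (simp add: x_def w_def power_divide field_simps)
  qed
  then obtain c where "0 \<le> c" "0 < a\<^sup>2 + c\<^sup>2 * b\<^sup>2"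
    "\<tau> * sqrt (a\<^sup>2 + b\<^sup>2) * sqrt (a\<^sup>2 + c\<^sup>2 * b\<^sup>2) \<le> m * (a\<^sup>2 + c * b\<^sup>2) - c * (\<kappa> * x * b)"
    using multiplier_exists_scalar[of a b x \<kappa> \<tau> m] nonneg b root R(1) p \<kappa> rs
    by (auto simp: x_def)
  then show thesis using that lsn by auto
qed

text \<open>Cleared of denominators and multiplied by \<open>\<rho>\<close>, the threshold reads L
  \<kappa> < 2 \<mu> L + \<mu> \<kappa>, which is \<kappa> + (L - \<mu>) < sqrt ((L + \<mu>)^2 +
  \<kappa>^2) after squaring. Positivity of \<mu> comes first: only then is \<open>L\<close> known
  to be nonzero, and the other side of the threshold is nonnegative even if a division by zero
  occurs in it.\<close>

lemma mu_eff_pos: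
  assumes rs: "1 \<le> rs" "rs \<le> r" and \<mu>: "0 \<le> \<mu>" "\<mu> \<le> L" "0 \<le> L2"
    and thr: "\<mu> > L2 / (2 * sqrt (real r / real rs) + L2 / L)"
  shows "0 < \<mu>" "0 < mu_eff r rs \<mu> L L2"
proof -
  define \<rho> where "\<rho> = sqrt (real rs / real r)"
  define R where "R = sqrt (real r / real rs)"
  define \<kappa> where "\<kappa> = \<rho> * L2"
  have \<rho>R: "\<rho> * R = 1" using rs unfolding \<rho>_def R_def by (simp flip: real_sqrt_mult)
  have pos: "0 < \<rho>" "0 < R" using rs by (simp_all add: \<rho>_def R_def)
  have "0 \<le> L" using \<mu> by simp
  then have "0 \<le> L2 / (2 * R + L2 / L)" using pos \<mu> by (intro divide_nonneg_nonneg add_nonneg_nonneg) auto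
  then show "0 < \<mu>" using thr by (simp add: R_def)
  then have L: "0 < L" using \<mu> by simp
  have den: "0 < 2 * R + L2 / L" using pos \<mu> L by (intro add_pos_nonneg) auto
  have "L2 < \<mu> * (2 * R + L2 / L)" using thr den by (simp add: divide_less_eq R_def)
  then have "\<rho> * L * L2 < \<rho> * L * (\<mu> * (2 * R + L2 / L))" using pos L by simp
  also have "\<dots> = 2 * \<mu> * L * (\<rho> * R) + \<mu> * \<kappa>" using L by (simp add: \<kappa>_def field_simps)
  finally have thr': "L * \<kappa> < 2 * \<mu> * L + \<mu> * \<kappa>" unfolding \<rho>R by (simp add: \<kappa>_def mult_ac)
  have \<kappa>0: "0 \<le> \<kappa>" using pos \<mu> by (simp add: \<kappa>_def)
  have "(\<kappa> + (L - \<mu>))\<^sup>2 < (L + \<mu>)\<^sup>2 + \<kappa>\<^sup>2"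
    using thr' by (simp add: power2_eq_square algebra_simps)
  then have "\<kappa> + (L - \<mu>) < sqrt ((L + \<mu>)\<^sup>2 + \<kappa>\<^sup>2)" by (rule real_less_rsqrt)
  moreover have "\<kappa>\<^sup>2 = real rs / real r * L2\<^sup>2" by (simp add: \<kappa>_def \<rho>_def power_mult_distrib)
  ultimately show "0 < mu_eff r rs \<mu> L L2" by (simp add: mu_eff_def \<kappa>_def \<rho>_def)
qed

section \<open>The recovery bound\<close>

text \<open>
  Compressing \<open>Y\<close> to the part of the range of \<open>M\<close> orthogonal to the rows of \<open>Ms\<close> leaves a piece \<open>Z1\<close>
  of the form polar factor times positive semidefinite, on which the two terms cancel. The
  remainder has rank at most \<open>3 * rs\<close>.
\<close>

lemma nuclear_cone_bound:
  fixes M Ms Y :: "real^'n^'m"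
  assumes svd: "svd M k \<sigma> a b" and rs: "rank Ms \<le> rs"
    and G: "\<And>x. norm (G *v x) \<le> l * norm x" and l: "0 \<le> l"
    and Y: "Y = M - Ms + d *\<^sub>R ((mat 1 - frame k a a) ** Ms ** (mat 1 - frame k b b))"
  shows "- (G \<bullet> Y) - l * (frame k a b \<bullet> Y) \<le> 2 * sqrt (3 * real rs) * l * norm Y"
proof -
  define P Q R where "P = frame k a a" and "Q = frame k b b" and "R = frame k a b"
  note oa = svd_orthonormal_left[OF svd] and ob = svd_orthonormal_right[OF svd]
  have Qt: "transpose Q = Q" and QQ: "Q ** Q = Q" and RtR: "transpose R ** R = Q" and RRt: "R ** transpose R = P"
    and RQ: "R ** Q = R"
    using oa ob by (simp_all add: P_def Q_def R_def frame_mult_frame)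
  have PM: "P ** M = M" and MQ: "M ** Q = M"
    by (simp_all add: P_def Q_def svd_frame_left[OF svd] svd_frame_right[OF svd])
  \<comment> \<open>The columns of \<open>D\<close> are the rows of \<open>Ms\<close> projected onto
    the row space of \<open>M\<close>. Cutting their span, the range of \<open>F\<close>, out of
    \<open>Q\<close> leaves a projection \<open>E\<close> with \<open>Ms ** E = 0\<close>.\<close>
  define D where "D = Q ** transpose Ms"
  obtain F C where Ft: "transpose F = F" and FF: "F ** F = F" and FD: "F ** D = D" and FC: "F = D ** C"
    and rF: "rank F \<le> rank D"
    using range_projection_exists[of D] by metis
  have "rank D \<le> rank Ms" unfolding D_def using rank_mul_le_right[of Q "transpose Ms"] by (simp add: rank_transpose)
  then have rF: "rank F \<le> rs" using rF rs by simp
  have QF: "Q ** F = F" unfolding FC D_def by (simp add: matrix_mul_assoc QQ)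
  have FQ: "F ** Q = F" using arg_cong[OF QF, of transpose] by (simp add: matrix_transpose_mul Ft Qt)
  define E where "E = Q - F"
  have Et: "transpose E = E" by (simp add: E_def transpose_diff Ft Qt)
  have EE: "E ** E = E" by (simp add: E_def matrix_mult_simps QQ QF FQ FF)
  have QE: "Q ** E = E" by (simp add: E_def matrix_mult_simps QQ QF)
  have "E ** transpose Ms = D - (F ** Q) ** transpose Ms" by (simp add: E_def matrix_mult_simps D_def FQ)
  also have "\<dots> = 0" using FD by (simp add: D_def flip: matrix_mul_assoc)
  finally have "transpose (E ** transpose Ms) = 0" by (simp add: transpose_zero)
  then have MsE: "Ms ** E = 0" by (simp add: matrix_transpose_mul Et)
  have NE: "(mat 1 - P) ** Ms ** (mat 1 - Q) ** E = 0"
  proof -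
    have "(mat 1 - Q) ** E = 0" by (simp add: matrix_mult_simps QE)
    then show ?thesis by (simp only: matrix_mult_zero_right flip: matrix_mul_assoc)
  qed
  define N where "N = (mat 1 - P) ** Ms ** (mat 1 - Q)"
  have YN: "Y = M - Ms + d *\<^sub>R N" by (simp add: Y N_def P_def Q_def)
  have "N ** E = 0" unfolding N_def by (rule NE)
  then have YE: "Y ** E = M ** E"
    by (simp add: YN matrix_mult_add_left matrix_mult_diff_left matrix_mult_scaleR_left MsE)
  \<comment> \<open>\<open>E\<close> transported to the column side by the polar factor, so that
    \<open>EL ** M ** E\<close> is \<open>R\<close> times the compression by \<open>E\<close> of the
    positive factor of \<open>M\<close>.\<close>
  define EL where "EL = R ** E ** transpose R"
  have ELt: "transpose EL = EL" by (simp add: EL_def matrix_transpose_mul Et matrix_mul_assoc)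
  have "EL ** EL = R ** E ** (transpose R ** R) ** E ** transpose R" by (simp add: EL_def matrix_mul_assoc)
  also have "\<dots> = R ** (E ** (Q ** E)) ** transpose R" by (simp add: RtR matrix_mul_assoc)
  finally have ELEL: "EL ** EL = EL" by (simp add: QE EE EL_def)
  define Z1 where "Z1 = EL ** Y ** E"
  define Z2 where "Z2 = Y - Z1"
  have Z1_eq: "Z1 = EL ** M ** E" by (simp add: Z1_def YE flip: matrix_mul_assoc)
  have Z1_self: "EL ** Z1 ** E = Z1" by (simp add: Z1_def matrix_mul_assoc ELEL) (simp add: EE flip: matrix_mul_assoc)
  have "Z1 \<bullet> Z1 = Y \<bullet> (EL ** Z1 ** E)"
  proof -
    have "Z1 \<bullet> Z1 = (EL ** Y ** E) \<bullet> Z1" by (simp only: Z1_def)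
    also have "\<dots> = (EL ** Y) \<bullet> (Z1 ** E)" unfolding inner_matrix_mult_right Et ..
    also have "\<dots> = Y \<bullet> (EL ** (Z1 ** E))" unfolding inner_matrix_mult_left ELt ..
    finally show ?thesis by (simp only: matrix_mul_assoc)
  qed
  then have Z1Y: "Z1 \<bullet> Z1 = Y \<bullet> Z1" by (simp add: Z1_self)
  have norm_Z2: "norm Z2 \<le> norm Y"
  proof -
    have "Z2 \<bullet> Z2 = Y \<bullet> Y - Z1 \<bullet> Z1"
      unfolding Z2_def inner_diff_left inner_diff_right inner_commute[of Z1 Y] Z1Y by simp
    then show ?thesis by (simp add: norm_le)
  qed
  have rank_Z2: "rank Z2 \<le> 3 * rs"
  proof -
    have "PM - EL = R ** F ** transpose R" if "PM = P" for PM
      unfolding that RRt[symmetric] EL_def E_def by (simp add: matrix_mult_simps RQ)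
    then have PEL: "P - EL = R ** F ** transpose R" by simp
    have "M ** E - EL ** M ** E = (P - EL) ** (M ** E)"
      by (simp add: matrix_mult_simps PM matrix_mul_assoc)
    also have "\<dots> = (R ** F) ** (transpose R ** M ** E)" by (simp add: PEL matrix_mul_assoc)
    finally have "rank (M ** E - EL ** M ** E) \<le> rank F"
      by (metis rank_mul_le_left rank_mul_le_right order_trans)
    moreover have "rank (Y ** F) \<le> rank F" by (rule rank_mul_le_right)
    moreover have "Y ** (mat 1 - Q) = (d *\<^sub>R (mat 1 - P) - mat 1) ** (Ms ** (mat 1 - Q))"
    proof -
      have QQ': "(mat 1 - Q) ** (mat 1 - Q) = mat 1 - Q" by (simp add: matrix_mult_simps QQ)
      have MQ': "M ** (mat 1 - Q) = 0" by (simp add: matrix_mult_simps MQ)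
      have N': "(mat 1 - P) ** Ms ** (mat 1 - Q) ** (mat 1 - Q) = (mat 1 - P) ** Ms ** (mat 1 - Q)"
        by (simp only: QQ' flip: matrix_mul_assoc)
      have "Y ** (mat 1 - Q) = M ** (mat 1 - Q) - Ms ** (mat 1 - Q)
          + d *\<^sub>R ((mat 1 - P) ** Ms ** (mat 1 - Q) ** (mat 1 - Q))"
        unfolding Y P_def[symmetric] Q_def[symmetric]
        by (simp only: matrix_mult_add_left matrix_mult_diff_left matrix_mult_scaleR_left)
      also have "\<dots> = d *\<^sub>R ((mat 1 - P) ** (Ms ** (mat 1 - Q))) - mat 1 ** (Ms ** (mat 1 - Q))"
        unfolding N' MQ' by (simp add: matrix_mul_assoc)
      also have "\<dots> = (d *\<^sub>R (mat 1 - P) - mat 1) ** (Ms ** (mat 1 - Q))"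
        by (simp only: matrix_mult_diff_left matrix_mult_scaleR_left)
      finally show ?thesis .
    qed
    then have "rank (Y ** (mat 1 - Q)) \<le> rs"
      by (metis rank_mul_le_left rank_mul_le_right order_trans rs)
    \<comment> \<open>Three pieces of rank at most \<open>rs\<close>: the part outside the row space
      of \<open>M\<close>, which factors through \<open>Ms\<close>; the part on \<open>F\<close>;
      and the part of \<open>M ** E\<close> missed by \<open>EL\<close>.\<close>
    moreover have "Z2 = (Y ** (mat 1 - Q) + Y ** F) + (M ** E - EL ** M ** E)"
    proof -
      have "Y ** (mat 1 - Q) + Y ** F = Y - Y ** E" by (simp add: E_def matrix_mult_simps)
      then show ?thesis by (simp add: Z2_def Z1_eq YE)
    qed
    ultimately show ?thesis
      using rank_add_le[of "Y ** (mat 1 - Q) + Y ** F" "M ** E - EL ** M ** E"]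
        rank_add_le[of "Y ** (mat 1 - Q)" "Y ** F"] rF by simp
  qed
  have norm_R: "norm (R *v x) = norm (Q *v x)" for x
    unfolding R_def Q_def by (rule norm_frame[OF oa ob])
  have norm_Q: "norm (Q *v x) \<le> 1 * norm x" for x
  proof -
    have "(norm (Q *v x))\<^sup>2 = x \<bullet> (Q *v x)"
      by (simp add: power2_norm_eq_inner Q_def inner_frame frame_mult_frame_vec ob)
    also have "\<dots> \<le> norm x * norm (Q *v x)" by (rule norm_cauchy_schwarz)
    finally show ?thesis
      by (cases "norm (Q *v x) = 0") (auto simp: power2_eq_square)
  qed
  have Z1_le: "- (G \<bullet> Z1) - l * (R \<bullet> Z1) \<le> 0"
  proof -
    have "EL *v a i = R *v (E *v b i)" if "i < k" for i
    proof -
      have "transpose R *v a i = b i" by (simp add: R_def frame_mult_basis[OF oa that] del: transpose_matrix_vector)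
      then show ?thesis by (simp add: EL_def del: transpose_matrix_vector flip: matrix_vector_mul_assoc)
    qed
    then have Z1_sum: "Z1 = (\<Sum>i<k. \<sigma> i *\<^sub>R outer (R *v (E *v b i)) (E *v b i))"
      unfolding Z1_eq by (subst svd_eq[OF svd])
        (simp add: matrix_mult_sum_left matrix_mult_sum_right matrix_mult_simps mult_outer outer_mult Et
          del: transpose_matrix_vector)
    have inner_Z1: "A \<bullet> Z1 = (\<Sum>i<k. \<sigma> i * ((R *v (E *v b i)) \<bullet> (A *v (E *v b i))))" for A
      by (simp add: Z1_sum inner_sum_right inner_outer_right)
    have "- (G \<bullet> Z1) - l * (R \<bullet> Z1)
        = (\<Sum>i<k. \<sigma> i * (- ((R *v (E *v b i)) \<bullet> (G *v (E *v b i))) - l * (norm (R *v (E *v b i)))\<^sup>2))"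
      unfolding inner_Z1 power2_norm_eq_inner
      by (simp add: sum_distrib_left right_diff_distrib sum_subtractf sum_negf mult_ac)
    also have "\<dots> \<le> 0"
    proof (rule sum_nonpos)
      fix i assume "i \<in> {..<k}"
      then have i: "i < k" by simp
      let ?e = "E *v b i"
      have "Q *v ?e = ?e" by (simp add: matrix_vector_mul_assoc QE)
      then have nR: "norm (R *v ?e) = norm ?e" by (simp add: norm_R)
      have "- ((R *v ?e) \<bullet> (G *v ?e)) \<le> norm (R *v ?e) * norm (G *v ?e)"
        using Cauchy_Schwarz_ineq2[of "R *v ?e" "G *v ?e"] by linarith
      also have "\<dots> \<le> norm (R *v ?e) * (l * norm ?e)" using G by (intro mult_left_mono) auto
      also have "\<dots> = l * (norm (R *v ?e))\<^sup>2" by (simp add: nR power2_eq_square)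
      finally show "\<sigma> i * (- ((R *v ?e) \<bullet> (G *v ?e)) - l * (norm (R *v ?e))\<^sup>2) \<le> 0"
        using svd_pos[OF svd i] by (intro mult_nonneg_nonpos) auto
    qed
    finally show ?thesis .
  qed
  have GZ2: "\<bar>G \<bullet> Z2\<bar> \<le> l * sqrt (real (3 * rs)) * norm Z2"
    by (rule inner_le_rank[OF G l rank_Z2])
  have RZ2: "\<bar>R \<bullet> Z2\<bar> \<le> 1 * sqrt (real (3 * rs)) * norm Z2"
    by (rule inner_le_rank[OF _ _ rank_Z2]) (use norm_R norm_Q in auto)
  have "- (G \<bullet> Z2) - l * (R \<bullet> Z2) \<le> l * sqrt (real (3 * rs)) * norm Z2 + l * (1 * sqrt (real (3 * rs)) * norm Z2)"
  proof -
    have "l * - (R \<bullet> Z2) \<le> l * (1 * sqrt (real (3 * rs)) * norm Z2)" using RZ2 l by (intro mult_left_mono) auto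
    then show ?thesis using GZ2 by linarith
  qed
  also have "\<dots> = 2 * sqrt (3 * real rs) * l * norm Z2" by simp
  also have "\<dots> \<le> 2 * sqrt (3 * real rs) * l * norm Y" using norm_Z2 l by (intro mult_left_mono) auto
  finally have Z2_le: "- (G \<bullet> Z2) - l * (R \<bullet> Z2) \<le> 2 * sqrt (3 * real rs) * l * norm Y" .
  have "Y = Z1 + Z2" by (simp add: Z2_def)
  then have "- (G \<bullet> Y) - l * (R \<bullet> Y) = (- (G \<bullet> Z1) - l * (R \<bullet> Z1)) + (- (G \<bullet> Z2) - l * (R \<bullet> Z2))"
    by (simp add: inner_add_right algebra_simps)
  then show ?thesis using Z1_le Z2_le by (simp add: R_def)
qed

text \<open>Subadditivity alone would count \<open>Ms\<close> twice. What \<open>P\<close> keeps has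
  rank at most \<open>k\<close>, and the rest factors through \<open>Ms\<close> because the corner
  does.\<close>

lemma rank_corner_combination:
  fixes M Ms :: "real^'n^'m"
  assumes svd: "svd M k \<sigma> a b"
  shows "rank (x *\<^sub>R M + y *\<^sub>R Ms + z *\<^sub>R ((mat 1 - frame k a a) ** Ms ** (mat 1 - frame k b b))) \<le> k + rank Ms"
proof -
  define P Q where "P = frame k a a" and "Q = frame k b b"
  have PM: "P ** M = M" by (simp add: P_def svd_frame_left[OF svd])
  have rP: "rank P \<le> k"
    using rank_sum_outer_le[of "{..<k}" "\<lambda>_. 1" a a] by (simp add: P_def frame_def)
  have eq: "x *\<^sub>R M + y *\<^sub>R Ms + z *\<^sub>R ((mat 1 - P) ** Ms ** (mat 1 - Q))
    = P ** (x *\<^sub>R M + y *\<^sub>R Ms) + ((mat 1 - P) ** Ms) ** (y *\<^sub>R mat 1 + z *\<^sub>R (mat 1 - Q))"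
    by (simp add: matrix_mult_simps PM algebra_simps)
  have "rank (P ** (x *\<^sub>R M + y *\<^sub>R Ms)) \<le> k" using rank_mul_le_left[of P] rP order_trans by blast
  moreover have "rank (((mat 1 - P) ** Ms) ** (y *\<^sub>R mat 1 + z *\<^sub>R (mat 1 - Q))) \<le> rank Ms"
    by (metis rank_mul_le_left rank_mul_le_right order_trans)
  ultimately show ?thesis
    unfolding P_def[symmetric] Q_def[symmetric] eq by (meson add_mono order_trans rank_add_le)
qed

text \<open>On blocks touching the row or column space of \<open>M\<close> the gradient acts as -l
  times the polar factor \<open>R\<close>. The matrix \<open>T\<close>, having no corner, equals P T
  + T Q - P T Q; each of these terms pairs with \<open>G\<close> to -l (R . T), and \<open>R\<close>
  is orthogonal to the corner.\<close>

lemma inner_test_matrix: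
  fixes M Ms G :: "real^'n^'m"
  assumes svd: "svd M k \<sigma> a b"
    and Gb: "\<And>i. i < k \<Longrightarrow> G *v b i = - l *\<^sub>R a i"
    and Ga: "\<And>i. i < k \<Longrightarrow> transpose G *v a i = - l *\<^sub>R b i"
  defines "N \<equiv> (mat 1 - frame k a a) ** Ms ** (mat 1 - frame k b b)"
  shows "G \<bullet> (M - Ms + N - c *\<^sub>R N) = - l * (frame k a b \<bullet> (M - Ms + N - c *\<^sub>R N)) - c * (G \<bullet> N)"
    and "(M - Ms + N) \<bullet> N = 0"
proof -
  define P Q R where "P = frame k a a" and "Q = frame k b b" and "R = frame k a b"
  note oa = svd_orthonormal_left[OF svd] and ob = svd_orthonormal_right[OF svd]
  have Pt: "transpose P = P" and Qt: "transpose Q = Q" and QQ: "Q ** Q = Q" and PP: "P ** P = P"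
    and RQ: "R ** Q = R" and PR: "P ** R = R"
    using oa ob by (simp_all add: P_def Q_def R_def frame_mult_frame)
  have PM: "P ** M = M" and MQ: "M ** Q = M"
    by (simp_all add: P_def Q_def svd_frame_left[OF svd] svd_frame_right[OF svd])
  have N: "N = (mat 1 - P) ** Ms ** (mat 1 - Q)" by (simp add: N_def P_def Q_def)
  have PN: "P ** N = 0"
  proof -
    have "P ** N = (P ** (mat 1 - P)) ** (Ms ** (mat 1 - Q))" by (simp add: N matrix_mul_assoc)
    also have "P ** (mat 1 - P) = 0" by (simp add: matrix_mult_simps PP)
    finally show ?thesis by (simp add: matrix_mult_simps)
  qed
  have NQ: "N ** Q = 0"
  proof -
    have "N ** Q = (mat 1 - P) ** Ms ** ((mat 1 - Q) ** Q)" by (simp add: N matrix_mul_assoc)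
    also have "(mat 1 - Q) ** Q = 0" by (simp add: matrix_mult_simps QQ)
    finally show ?thesis by (simp add: matrix_mult_simps)
  qed
  have GQ: "G ** Q = - l *\<^sub>R R"
    by (simp add: Q_def R_def frame_def matrix_mult_sum_right mult_outer Gb outer_scaleR_left
        outer_minus_left scaleR_sum_right sum_negf)
  have PG: "P ** G = - l *\<^sub>R R"
    by (simp add: P_def R_def frame_def matrix_mult_sum_left outer_mult Ga outer_scaleR_right
        outer_minus_right scaleR_sum_right sum_negf del: transpose_matrix_vector)
  have RN: "R \<bullet> N = 0"
    using inner_matrix_mult_left[of P R N] by (simp add: PR Pt PN)
  have MN: "M \<bullet> N = 0"
    using inner_matrix_mult_left[of P M N] by (simp add: PM Pt PN)
  have NN: "(mat 1 - P) ** N ** (mat 1 - Q) = N"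
    by (simp add: matrix_mult_simps PN NQ)
  have "N \<bullet> N = Ms \<bullet> ((mat 1 - P) ** N ** (mat 1 - Q))"
  proof -
    have At: "transpose (mat 1 - P) = mat 1 - P" "transpose (mat 1 - Q) = mat 1 - Q"
      by (simp_all add: transpose_diff Pt Qt)
    have "N \<bullet> N = ((mat 1 - P) ** Ms ** (mat 1 - Q)) \<bullet> N" by (simp only: N)
    also have "\<dots> = ((mat 1 - P) ** Ms) \<bullet> (N ** (mat 1 - Q))"
      unfolding inner_matrix_mult_right At ..
    also have "\<dots> = Ms \<bullet> ((mat 1 - P) ** (N ** (mat 1 - Q)))"
      unfolding inner_matrix_mult_left At ..
    finally show ?thesis by (simp only: matrix_mul_assoc)
  qed
  then have MsN: "Ms \<bullet> N = N \<bullet> N" by (simp add: NN)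
  show "(M - Ms + N) \<bullet> N = 0" by (simp add: inner_add_left inner_diff_left MN MsN)
  define T where "T = M - Ms + N"
  have T: "(mat 1 - P) ** T ** (mat 1 - Q) = 0"
  proof -
    have "(mat 1 - P) ** M = 0" by (simp add: matrix_mult_simps PM)
    then have "(mat 1 - P) ** T = (mat 1 - P) ** N - (mat 1 - P) ** Ms"
      by (simp add: T_def matrix_mult_add_right matrix_mult_diff_right)
    then have "(mat 1 - P) ** T ** (mat 1 - Q) = (mat 1 - P) ** N ** (mat 1 - Q) - N"
      unfolding N by (metis matrix_mult_diff_left)
    then show ?thesis by (simp add: NN)
  qed
  then have T_eq: "T = P ** T + T ** Q - P ** T ** Q" by (simp add: matrix_mult_simps algebra_simps)
  have 1: "G \<bullet> (P ** A) = - l * (R \<bullet> A)" for A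
    using inner_matrix_mult_left[of P G A] by (simp add: Pt PG)
  have 2: "G \<bullet> (A ** Q) = - l * (R \<bullet> A)" for A
    using inner_matrix_mult_right[of G Q A] by (simp add: Qt GQ)
  have 3: "G \<bullet> (P ** T ** Q) = - l * (R \<bullet> T)"
    using 2[of "P ** T"] inner_matrix_mult_left[of P R T] by (simp add: Pt PR)
  have "G \<bullet> T = G \<bullet> (P ** T) + G \<bullet> (T ** Q) - G \<bullet> (P ** T ** Q)"
    by (subst T_eq) (simp add: inner_add_right inner_diff_right)
  then have "G \<bullet> T = - l * (R \<bullet> T)" using 1[of T] 2[of T] 3 by linarith
  then show "G \<bullet> (M - Ms + N - c *\<^sub>R N) = - l * (frame k a b \<bullet> (M - Ms + N - c *\<^sub>R N)) - c * (G \<bullet> N)"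
    unfolding T_def[symmetric] R_def[symmetric] by (simp add: inner_diff_right RN)
qed

text \<open>Common core of both cases: \<open>Gb\<close> and \<open>Ga\<close> carry the first-order
  condition, \<open>corner\<close> the second-order one, \<open>mono\<close> the Hessian bounds;
  \<open>s\<close> bounds the singular values from below if there are \<open>r\<close> of them and
  is 0 otherwise. All estimates are combined for one \<open>Y\<close>, whose norm is finally
  cancelled.\<close>

lemma recovery_bound:
  fixes M Ms G Gs :: "real^'n^'m"
  assumes svd: "svd M k \<sigma> a b" and k: "k \<le> r"
    and rs: "1 \<le> rs" "rs \<le> r" and rank_Ms: "rank Ms \<le> rs"
    and \<mu>: "0 < \<mu>" "\<mu> \<le> L" and L2: "0 \<le> L2" and eff: "0 < mu_eff r rs \<mu> L L2"
    and l: "0 \<le> l"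
    and Gb: "\<And>i. i < k \<Longrightarrow> G *v b i = - l *\<^sub>R a i"
    and Ga: "\<And>i. i < k \<Longrightarrow> transpose G *v a i = - l *\<^sub>R b i"
    and s: "0 \<le> s" "k = r \<Longrightarrow> (\<And>i. i < k \<Longrightarrow> s \<le> \<sigma> i)" "k < r \<Longrightarrow> s = 0"
  defines "N \<equiv> (mat 1 - frame k a a) ** Ms ** (mat 1 - frame k b b)"
  assumes svdN: "svd N k' n u v"
    and corner: "- (G \<bullet> N) \<le> (l + L2 * s) * (\<Sum>i<k'. n i)"
    and mono: "\<And>d. (L + \<mu>) / 2 * ((M - Ms) \<bullet> (M - Ms + d *\<^sub>R N))
        - (L - \<mu>) / 2 * norm (M - Ms) * norm (M - Ms + d *\<^sub>R N) \<le> (G - Gs) \<bullet> (M - Ms + d *\<^sub>R N)"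
  shows "norm (M - Ms) \<le> (6 * sqrt (real rs) * l + sqrt (real (r + rs)) * max (op_norm Gs - l) 0)
    / mu_eff r rs \<mu> L L2"
proof (cases "M = Ms")
  case True
  then show ?thesis using eff l by (simp add: divide_nonneg_nonneg)
next
  case False
  define \<nu> where "\<nu> = (\<Sum>i<k'. n i)"
  define \<kappa> where "\<kappa> = sqrt (real rs / real r) * L2"
  define m where "m = (L + \<mu>) / 2"
  define \<tau> where "\<tau> = (sqrt ((L + \<mu>)\<^sup>2 + \<kappa>\<^sup>2) - \<kappa>) / 2"
  define \<alpha> \<beta> where "\<alpha> = norm (M - Ms + N)" and "\<beta> = norm N"
  have n_pos: "0 < n i" if "i < k'" for i using svd_pos[OF svdN that] .
  have \<nu>0: "0 \<le> \<nu>" unfolding \<nu>_def using n_pos by (intro sum_nonneg) (auto intro: less_imp_le)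
  have rank_N: "rank N \<le> rs"
    unfolding N_def using rank_Ms by (meson rank_mul_le_left rank_mul_le_right order_trans)
  have k': "k' \<le> rs"
  proof -
    have "n i *\<^sub>R u i \<in> range ((*v) N)" if "i < k'" for i
      using svd_mult_right[OF svdN that] by (metis rangeI)
    moreover have "subspace (range ((*v) N))"
      by (auto intro!: linear_subspace_image matrix_vector_mul_linear subspace_UNIV)
    ultimately have "(1 / n i) *\<^sub>R (n i *\<^sub>R u i) \<in> range ((*v) N)" if "i < k'" for i
      using that subspace_scale by blast
    then have "u i \<in> range ((*v) N)" if "i < k'" for i using n_pos[OF that] that by force
    then have "k' \<le> rank N" unfolding rank_dim_range by (rule orthonormal_le_dim[OF svd_orthonormal_left[OF svdN]])
    then show ?thesis using rank_N by simp
  qed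
  have norm_N: "\<beta>\<^sup>2 = (\<Sum>i<k'. (n i)\<^sup>2)" by (simp add: \<beta>_def svd_norm[OF svdN])
  have \<nu>_le: "\<nu> \<le> sqrt (real rs) * \<beta>"
  proof -
    have "\<nu> \<le> sqrt (real k') * sqrt (\<Sum>i<k'. (n i)\<^sup>2)"
      unfolding \<nu>_def using n_pos by (intro sum_le_sqrt_mult_norm) (auto intro: less_imp_le)
    also have "\<dots> = sqrt (real k') * \<beta>" by (simp add: \<beta>_def flip: norm_N)
    also have "\<dots> \<le> sqrt (real rs) * \<beta>" using k' by (intro mult_right_mono) (auto simp: \<beta>_def)
    finally show ?thesis .
  qed
  then have \<nu>2: "\<nu>\<^sup>2 \<le> real rs * \<beta>\<^sup>2"
    using power_mono[OF \<nu>_le \<nu>0, of 2] by (simp add: power_mult_distrib)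
  have orth: "(M - Ms + N) \<bullet> N = 0" unfolding N_def by (rule inner_test_matrix(2)[OF svd Gb Ga])
  have normX: "(norm (M - Ms))\<^sup>2 = \<alpha>\<^sup>2 + \<beta>\<^sup>2"
  proof -
    have "M - Ms = (M - Ms + N) - N" by simp
    then have "(norm (M - Ms))\<^sup>2 = ((M - Ms + N) - N) \<bullet> ((M - Ms + N) - N)" by (simp add: power2_norm_eq_inner)
    also have "\<dots> = \<alpha>\<^sup>2 + \<beta>\<^sup>2"
      unfolding inner_diff_left[of "M - Ms + N" N] inner_diff_right[of _ "M - Ms + N" N] \<alpha>_def \<beta>_def
        power2_norm_eq_inner inner_commute[of N "M - Ms + N"] orth by simp
    finally show ?thesis .
  qed
  have \<kappa>0: "0 \<le> \<kappa>" using L2 by (simp add: \<kappa>_def)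
  have m0: "0 < m" using \<mu> by (simp add: m_def)
  have \<tau>0: "0 < \<tau>"
  proof -
    have "\<kappa>\<^sup>2 < (L + \<mu>)\<^sup>2 + \<kappa>\<^sup>2" using \<mu> by simp
    then have "\<kappa> < sqrt ((L + \<mu>)\<^sup>2 + \<kappa>\<^sup>2)" by (rule real_less_rsqrt)
    then show ?thesis by (simp add: \<tau>_def)
  qed
  have root: "\<tau>\<^sup>2 + \<kappa> * \<tau> = m\<^sup>2"
  proof -
    define q where "q = sqrt ((L + \<mu>)\<^sup>2 + \<kappa>\<^sup>2)"
    have "q\<^sup>2 = (L + \<mu>)\<^sup>2 + \<kappa>\<^sup>2" by (simp add: q_def)
    moreover have "\<tau>\<^sup>2 + \<kappa> * \<tau> = (q\<^sup>2 - \<kappa>\<^sup>2) / 4"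
      unfolding \<tau>_def q_def[symmetric] by (simp add: power2_eq_square field_simps)
    ultimately show ?thesis by (simp add: m_def power_divide)
  qed
  have eff_eq: "mu_eff r rs \<mu> L L2 = \<tau> - (L - \<mu>) / 2"
    by (simp add: mu_eff_def \<tau>_def \<kappa>_def power_mult_distrib field_simps)
  have geo: "s = 0 \<or> (\<forall>t. 0 \<le> t \<and> t \<le> 1 \<longrightarrow>
      (real r - real rs) * s\<^sup>2 + 2 * s * t * \<nu> - t\<^sup>2 * \<beta>\<^sup>2 \<le> \<alpha>\<^sup>2)"
  proof (cases "k < r")
    case True
    then show ?thesis using s(3) by simp
  next
    case False
    then have kr: "k = r" using k by simp
    have "(real r - real rs) * s\<^sup>2 + 2 * s * t * \<nu> - t\<^sup>2 * \<beta>\<^sup>2 \<le> \<alpha>\<^sup>2" if "0 \<le> t" "t \<le> 1" for t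
      using off_corner_norm_ge[OF svd s(2)[OF kr] s(1) rank_Ms _ svdN[unfolded N_def] that] rs kr
      unfolding norm_N \<alpha>_def \<nu>_def N_def by (simp add: of_nat_diff)
    then show ?thesis by blast
  qed
  have ab: "0 < \<alpha> \<or> 0 < \<beta>"
  proof (rule ccontr)
    assume "\<not> (0 < \<alpha> \<or> 0 < \<beta>)"
    then have "\<alpha> = 0" "\<beta> = 0" by (auto simp: \<alpha>_def \<beta>_def not_less)
    then have "(norm (M - Ms))\<^sup>2 = 0" unfolding normX by simp
    then show False using False by simp
  qed
  \<comment> \<open>\<open>\<alpha>\<close> and \<open>\<beta>\<close> are the norms of the two
    orthogonal parts of \<open>M - Ms\<close>. In \<open>Y\<close> the corner part is scaled by
    \<open>c\<close>, so the two square roots are the norms of \<open>M - Ms\<close> and of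
    \<open>Y\<close>.\<close>
  obtain c where c: "0 \<le> c" "0 < \<alpha>\<^sup>2 + c\<^sup>2 * \<beta>\<^sup>2"
    "\<tau> * sqrt (\<alpha>\<^sup>2 + \<beta>\<^sup>2) * sqrt (\<alpha>\<^sup>2 + c\<^sup>2 * \<beta>\<^sup>2) \<le> m * (\<alpha>\<^sup>2 + c * \<beta>\<^sup>2) - c * (L2 * s * \<nu>)"
    by (rule multiplier_exists[of \<alpha> \<beta> s \<nu> L2 \<tau> m "real rs" "real r" \<kappa>])
      (use s(1) \<nu>0 L2 \<tau>0 m0 ab rs root \<nu>2 geo in \<open>auto simp: \<alpha>_def \<beta>_def \<kappa>_def\<close>)
  define Y where "Y = M - Ms + N - c *\<^sub>R N"
  have Y_alt: "Y = M - Ms + (1 - c) *\<^sub>R N" by (simp add: Y_def algebra_simps)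
  have normY: "(norm Y)\<^sup>2 = \<alpha>\<^sup>2 + c\<^sup>2 * \<beta>\<^sup>2"
    unfolding Y_def \<alpha>_def \<beta>_def power2_norm_eq_inner inner_diff_left[of "M - Ms + N" "c *\<^sub>R N"]
      inner_diff_right[of _ "M - Ms + N" "c *\<^sub>R N"] inner_scaleR_left inner_scaleR_right
      inner_commute[of N "M - Ms + N"] orth by (simp add: power2_eq_square mult_ac)
  have XY: "(M - Ms) \<bullet> Y = \<alpha>\<^sup>2 + c * \<beta>\<^sup>2"
  proof -
    have "(M - Ms) \<bullet> Y = ((M - Ms + N) - N) \<bullet> ((M - Ms + N) - c *\<^sub>R N)" by (simp add: Y_def)
    also have "\<dots> = \<alpha>\<^sup>2 + c * \<beta>\<^sup>2"
      unfolding \<alpha>_def \<beta>_def power2_norm_eq_inner inner_diff_left[of "M - Ms + N" N]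
        inner_diff_right[of _ "M - Ms + N" "c *\<^sub>R N"] inner_scaleR_left inner_scaleR_right
        inner_commute[of N "M - Ms + N"] orth by simp
    finally show ?thesis .
  qed
  have nX: "norm (M - Ms) = sqrt (\<alpha>\<^sup>2 + \<beta>\<^sup>2)" by (simp flip: normX)
  have nY: "norm Y = sqrt (\<alpha>\<^sup>2 + c\<^sup>2 * \<beta>\<^sup>2)" by (simp flip: normY)
  have Y0: "0 < norm Y" unfolding nY using c(2) by simp
  have lower: "m * (\<alpha>\<^sup>2 + c * \<beta>\<^sup>2) - (L - \<mu>) / 2 * norm (M - Ms) * norm Y \<le> (G - Gs) \<bullet> Y"
    using mono[of "1 - c"] unfolding Y_alt[symmetric] XY m_def .
  have GY: "G \<bullet> Y \<le> - l * (frame k a b \<bullet> Y) + c * l * \<nu> + c * (L2 * s * \<nu>)"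
  proof -
    have "G \<bullet> Y = - l * (frame k a b \<bullet> Y) - c * (G \<bullet> N)"
      unfolding Y_def N_def by (rule inner_test_matrix(1)[OF svd Gb Ga])
    moreover have "c * - (G \<bullet> N) \<le> c * ((l + L2 * s) * \<nu>)"
      using corner c(1) unfolding \<nu>_def by (intro mult_left_mono)
    ultimately show ?thesis by (simp add: algebra_simps)
  qed
  have rank_Y: "rank Y \<le> r + rs"
  proof -
    have "Y = 1 *\<^sub>R M + (-1) *\<^sub>R Ms + (1 - c) *\<^sub>R N" by (simp add: Y_alt)
    then have "rank Y \<le> k + rank Ms" unfolding N_def by (metis rank_corner_combination[OF svd])
    then show ?thesis using k rank_Ms by simp
  qed
  define e where "e = max (op_norm Gs - l) 0"
  have e0: "0 \<le> e" by (simp add: e_def)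
  have GsY: "- (Gs \<bullet> Y) - l * (frame k a b \<bullet> Y)
      \<le> e * sqrt (real (r + rs)) * norm Y + 2 * sqrt (3 * real rs) * l * norm Y"
  proof (cases "op_norm Gs \<le> l")
    case True
    then have "norm (Gs *v x) \<le> l * norm x" for x
      using op_norm_bound[of Gs x] mult_right_mono[OF True norm_ge_zero] order_trans by blast
    then have "- (Gs \<bullet> Y) - l * (frame k a b \<bullet> Y) \<le> 2 * sqrt (3 * real rs) * l * norm Y"
      by (rule nuclear_cone_bound[OF svd rank_Ms _ l Y_alt[unfolded N_def]])
    moreover have "0 \<le> e * sqrt (real (r + rs)) * norm Y" using e0 by simp
    ultimately show ?thesis by linarith
  next
    case False
    define g where "g = op_norm Gs"
    have g: "l < g" "0 < g" using False l by (auto simp: g_def)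
    \<comment> \<open>\<open>Gs\<close> is scaled down to operator norm at most \<open>l\<close>,
      where the nuclear cone bound applies; the rest has operator norm at most \<open>e\<close> and
      is paid for by the rank of \<open>Y\<close>.\<close>
    define G1 where "G1 = (l / g) *\<^sub>R Gs"
    define G2 where "G2 = (1 - l / g) *\<^sub>R Gs"
    have bG: "norm (Gs *v x) \<le> g * norm x" for x using op_norm_bound[of Gs x] by (simp add: g_def)
    have b1: "norm (G1 *v x) \<le> l * norm x" for x
    proof -
      have "norm (G1 *v x) = (l / g) * norm (Gs *v x)" using l g by (simp add: G1_def scaleR_matrix_vector)
      also have "\<dots> \<le> (l / g) * (g * norm x)" using bG l g by (intro mult_left_mono) auto
      finally show ?thesis using g by simp
    qed
    have b2: "norm (G2 *v x) \<le> e * norm x" for x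
    proof -
      have "norm (G2 *v x) = (1 - l / g) * norm (Gs *v x)" using g by (simp add: G2_def scaleR_matrix_vector)
      also have "\<dots> \<le> (1 - l / g) * (g * norm x)" using bG g by (intro mult_left_mono) auto
      also have "\<dots> = e * norm x" using g by (simp add: e_def flip: g_def) (simp add: field_simps)
      finally show ?thesis .
    qed
    have "Gs = G1 + G2" by (simp add: G1_def G2_def flip: scaleR_add_left)
    then have "- (Gs \<bullet> Y) = - (G1 \<bullet> Y) - (G2 \<bullet> Y)" by (simp add: inner_add_left)
    moreover have "- (G1 \<bullet> Y) - l * (frame k a b \<bullet> Y) \<le> 2 * sqrt (3 * real rs) * l * norm Y"
      by (rule nuclear_cone_bound[OF svd rank_Ms b1 l Y_alt[unfolded N_def]])
    moreover have "\<bar>G2 \<bullet> Y\<bar> \<le> e * sqrt (real (r + rs)) * norm Y"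
      by (rule inner_le_rank[OF b2 e0 rank_Y])
    ultimately show ?thesis by linarith
  qed
  have c\<nu>: "c * l * \<nu> \<le> sqrt (real rs) * l * norm Y"
  proof -
    have "(c * \<beta>)\<^sup>2 \<le> (norm Y)\<^sup>2" unfolding normY by (simp add: power_mult_distrib)
    then have "c * \<beta> \<le> norm Y" by (rule power2_le_imp_le) simp
    then have "(sqrt (real rs) * l) * (c * \<beta>) \<le> (sqrt (real rs) * l) * norm Y"
      using l by (intro mult_left_mono) auto
    moreover have "(c * l) * \<nu> \<le> (c * l) * (sqrt (real rs) * \<beta>)" using \<nu>_le c(1) l by (intro mult_left_mono) auto
    ultimately show ?thesis by (simp add: mult_ac)
  qed
  \<comment> \<open>2 sqrt 3 comes from the nuclear cone bound and 1 from the nuclear norm of the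
    corner; the constant 6 leaves slack.\<close>
  have six: "2 * sqrt (3 * real rs) + sqrt (real rs) \<le> 6 * sqrt (real rs)"
  proof -
    have "sqrt 3 \<le> 5 / 2" by (rule real_le_lsqrt) (simp_all add: power2_eq_square)
    then have "2 * (sqrt 3 * sqrt (real rs)) \<le> 5 * sqrt (real rs)"
      using mult_right_mono[of "sqrt 3" "5 / 2" "sqrt (real rs)"] by simp
    then show ?thesis by (simp add: real_sqrt_mult)
  qed
  have "mu_eff r rs \<mu> L L2 * norm (M - Ms) * norm Y
      = \<tau> * norm (M - Ms) * norm Y - (L - \<mu>) / 2 * norm (M - Ms) * norm Y"
    unfolding eff_eq by (simp add: left_diff_distrib)
  also have "\<dots> \<le> m * (\<alpha>\<^sup>2 + c * \<beta>\<^sup>2) - c * (L2 * s * \<nu>) - (L - \<mu>) / 2 * norm (M - Ms) * norm Y"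
    using c(3) unfolding nX[symmetric] nY[symmetric] by simp
  also have "\<dots> \<le> G \<bullet> Y - Gs \<bullet> Y - c * (L2 * s * \<nu>)" using lower by (simp add: inner_diff_left)
  also have "\<dots> \<le> e * sqrt (real (r + rs)) * norm Y + 2 * sqrt (3 * real rs) * l * norm Y + c * l * \<nu>"
    using GY GsY by linarith
  also have "\<dots> \<le> e * sqrt (real (r + rs)) * norm Y + (2 * sqrt (3 * real rs) + sqrt (real rs)) * (l * norm Y)"
  proof -
    have "(2 * sqrt (3 * real rs) + sqrt (real rs)) * (l * norm Y)
        = 2 * sqrt (3 * real rs) * l * norm Y + sqrt (real rs) * l * norm Y"
      by (simp add: algebra_simps)
    then show ?thesis using c\<nu> by linarith
  qed
  also have "\<dots> \<le> e * sqrt (real (r + rs)) * norm Y + 6 * sqrt (real rs) * (l * norm Y)"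
    using six l by (intro add_left_mono mult_right_mono) auto
  also have "\<dots> = (6 * sqrt (real rs) * l + sqrt (real (r + rs)) * e) * norm Y" by (simp add: algebra_simps)
  finally have "mu_eff r rs \<mu> L L2 * norm (M - Ms) \<le> 6 * sqrt (real rs) * l + sqrt (real (r + rs)) * e"
    using Y0 by (rule mult_right_le_imp_le)
  then show ?thesis using eff by (simp add: e_def le_divide_eq mult.commute)
qed

section \<open>Critical points of the factored objectives\<close>

lemma bounded_bilinear_matrix_mult:
  "bounded_bilinear ((**) :: real^'k^'m \<Rightarrow> real^'n^'k \<Rightarrow> real^'n^'m)"
  unfolding bilinear_conv_bounded_bilinear[symmetric] bilinear_def
  by (auto intro!: linearI simp: matrix_mult_simps)

lemma bounded_linear_transpose: "bounded_linear (transpose :: real^'n^'m \<Rightarrow> real^'m^'n)"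
  using linear_transpose by (simp add: linear_conv_bounded_linear)

lemmas has_derivative_matrix_mult = bounded_bilinear.FDERIV[OF bounded_bilinear_matrix_mult]
lemmas has_derivative_transpose = bounded_linear.has_derivative[OF bounded_linear_transpose]

lemma grad_on_UNIV_eqI:
  assumes "\<And>x. (f has_derivative (\<lambda>h. F x \<bullet> h)) (at x)"
  shows "grad_on UNIV UNIV f = F"
proof
  fix x
  show "grad_on UNIV UNIV f x = F x"
    unfolding grad_on_def
  proof (rule the_equality)
    show "F x \<in> UNIV \<and> (f has_derivative (\<lambda>h. F x \<bullet> h)) (at x within UNIV)" using assms by simp
    fix g assume "g \<in> UNIV \<and> (f has_derivative (\<lambda>h. g \<bullet> h)) (at x within UNIV)"
    then have "(\<lambda>h. g \<bullet> h) = (\<lambda>h. F x \<bullet> h)" using assms[of x] has_derivative_unique by auto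
    then have "g \<bullet> (g - F x) = F x \<bullet> (g - F x)" by metis
    then have "(g - F x) \<bullet> (g - F x) = 0" by (simp only: inner_diff_left)
    then show "g = F x" by simp
  qed
qed

lemma second_order_critical_iff:
  assumes "\<And>x. (f has_derivative (\<lambda>h. F x \<bullet> h)) (at x)" "(F has_derivative F') (at x)"
  shows "second_order_critical f x \<longleftrightarrow> F x = 0 \<and> (\<forall>h. 0 \<le> F' h \<bullet> h)"
  unfolding second_order_critical_def hess_on_def grad_on_UNIV_eqI[OF assms(1)]
  using frechet_derivative_at[OF assms(2)] by simp

lemma gram_psd: "U ** transpose U \<in> psd_mats" for U :: "real^'r^'d"
proof -
  have "x \<bullet> ((U ** transpose U) *v x) = (transpose U *v x) \<bullet> (transpose U *v x)" for x
    unfolding inner_transpose_mult by (simp add: matrix_vector_mul_assoc del: transpose_matrix_vector)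
  then show ?thesis by (simp add: psd_mats_def matrix_transpose_mul)
qed

text \<open>The chain rule works with derivatives within the cone because
  \<open>U ** transpose U\<close> never leaves it. Symmetry of the gradient and, by
  \<open>hess_mem\<close>, of its derivative merges the two halves of the product rule, which
  accounts for the factors 2.\<close>

lemma second_order_critical_symmetric:
  fixes \<phi> :: "real^'d^'d \<Rightarrow> real" and U :: "real^'r^'d"
  assumes tw: "twice_differentiable_on sym_mats psd_mats \<phi>"
    and crit: "second_order_critical (\<lambda>U :: real^'r^'d. \<phi> (U ** transpose U) + lam * (norm U)\<^sup>2) U"
  defines "M \<equiv> U ** transpose U" and "G \<equiv> grad_on sym_mats psd_mats \<phi> (U ** transpose U)"
  shows "G ** U = - lam *\<^sub>R U"
    and "0 \<le> hess_on sym_mats psd_mats \<phi> M (U ** transpose h + h ** transpose U) (U ** transpose h + h ** transpose U)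
      + 2 * (G \<bullet> (h ** transpose h)) + 2 * lam * (h \<bullet> h)"
proof -
  interpret cone_pair sym_mats "psd_mats :: (real^'d^'d) set" by (rule cone_pair_psd)
  let ?g = "grad_on sym_mats psd_mats \<phi>"
  let ?D = "\<lambda>x. frechet_derivative ?g (at x within psd_mats)"
  have gram: "((\<lambda>U. U ** transpose U) has_derivative (\<lambda>h. x ** transpose h + h ** transpose x)) (at x)"
    for x :: "real^'r^'d"
    by (rule has_derivative_matrix_mult[OF has_derivative_ident has_derivative_transpose[OF has_derivative_ident]])
  have comp: "((\<lambda>U. f (U ** transpose U)) has_derivative (\<lambda>h. f' (x ** transpose h + h ** transpose x))) (at x)"
    if "(f has_derivative f') (at (x ** transpose x) within psd_mats)"
    for f :: "real^'d^'d \<Rightarrow> 'b::real_normed_vector" and f' and x :: "real^'r^'d"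
    by (rule has_derivative_in_compose[OF gram has_derivative_subset[OF that]]) (auto simp: gram_psd)
  have gsym: "transpose (?g x) = ?g x" if "x \<in> psd_mats" for x
    using grad_mem[OF tw that] by (simp add: sym_mats_def)
  have half: "A \<bullet> (x ** transpose h + h ** transpose x) = 2 * ((A ** x) \<bullet> h)"
    if "transpose A = A" for A :: "real^'d^'d" and x h :: "real^'r^'d"
  proof -
    have "A \<bullet> (x ** transpose h) = A \<bullet> (h ** transpose x)"
      using inner_transpose_transpose[of A "x ** transpose h"] that by (simp add: matrix_transpose_mul)
    moreover have "A \<bullet> (h ** transpose x) = (A ** x) \<bullet> h" by (simp add: inner_matrix_mult_right)
    ultimately show ?thesis by (simp add: inner_add_right)
  qed
  define F where "F x = 2 *\<^sub>R (?g (x ** transpose x) ** x) + (2 * lam) *\<^sub>R x" for x :: "real^'r^'d"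
  have der: "((\<lambda>U. \<phi> (U ** transpose U) + lam * (norm U)\<^sup>2) has_derivative (\<lambda>h. F x \<bullet> h)) (at x)"
    for x :: "real^'r^'d"
  proof -
    have "((\<lambda>U. \<phi> (U ** transpose U)) has_derivative
        (\<lambda>h. ?g (x ** transpose x) \<bullet> (x ** transpose h + h ** transpose x))) (at x)"
      by (rule comp[OF has_derivative_grad[OF tw gram_psd]])
    moreover have "((\<lambda>U. lam * (norm U)\<^sup>2) has_derivative (\<lambda>h. lam * (2 * (x \<bullet> h)))) (at x)"
      unfolding power2_norm_eq_inner by (auto intro!: derivative_eq_intros simp: inner_commute)
    ultimately show ?thesis
      by (rule has_derivative_add[THEN has_derivative_eq_rhs])
        (simp add: F_def half[OF gsym[OF gram_psd]] inner_add_left mult.assoc mult.left_commute)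
  qed
  have derF: "(F has_derivative (\<lambda>h. 2 *\<^sub>R (?g M ** h + ?D M (U ** transpose h + h ** transpose U) ** U)
      + (2 * lam) *\<^sub>R h)) (at U)"
    unfolding F_def M_def
    by (intro has_derivative_add has_derivative_scaleR_right has_derivative_matrix_mult has_derivative_ident
        comp[OF has_derivative_hess[OF tw gram_psd]])
  have crit': "F U = 0" "\<And>h. 0 \<le> (2 *\<^sub>R (?g M ** h + ?D M (U ** transpose h + h ** transpose U) ** U)
      + (2 * lam) *\<^sub>R h) \<bullet> h"
    using crit unfolding second_order_critical_iff[OF der derF] by blast+
  have "2 *\<^sub>R (G ** U + lam *\<^sub>R U) = 0" using crit'(1) by (simp add: F_def G_def scaleR_add_right)
  then show "G ** U = - lam *\<^sub>R U" by (simp add: add_eq_0_iff)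
  let ?E = "U ** transpose h + h ** transpose U"
  have MP: "M \<in> psd_mats" unfolding M_def by (rule gram_psd)
  have "?E \<in> sym_mats" by (simp add: sym_mats_def transpose_add matrix_transpose_mul add.commute)
  then have "?D M ?E \<in> sym_mats" by (rule hess_mem[OF tw MP])
  then have "?D M ?E \<bullet> ?E = 2 * ((?D M ?E ** U) \<bullet> h)" by (intro half) (simp add: sym_mats_def)
  moreover have "(?g M ** h) \<bullet> h = G \<bullet> (h ** transpose h)"
    by (simp add: inner_matrix_mult_right G_def M_def)
  ultimately show "0 \<le> hess_on sym_mats psd_mats \<phi> M ?E ?E + 2 * (G \<bullet> (h ** transpose h)) + 2 * lam * (h \<bullet> h)"
    using crit'(2)[of h] by (simp add: hess_on_def inner_add_left algebra_simps)
qed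

text \<open>In the product space the gradient is (G V, G^T U) + lam (U, V). Differentiating its
  outer factors in direction (A, B) gives two terms that both pair to
  \<open>G \<bullet> (A ** transpose B)\<close>, hence the factor 2.\<close>

lemma second_order_critical_asymmetric:
  fixes \<phi> :: "real^'n^'m \<Rightarrow> real" and U :: "real^'r^'m" and V :: "real^'r^'n"
  assumes tw: "twice_differentiable_on UNIV UNIV \<phi>"
    and crit: "second_order_critical (\<lambda>(U :: real^'r^'m, V :: real^'r^'n).
        \<phi> (U ** transpose V) + lam * (((norm U)\<^sup>2 + (norm V)\<^sup>2) / 2)) (U, V)"
  defines "M \<equiv> U ** transpose V" and "G \<equiv> grad_on UNIV UNIV \<phi> (U ** transpose V)"
  shows "G ** V = - lam *\<^sub>R U" and "transpose G ** U = - lam *\<^sub>R V"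
    and "0 \<le> hess_on UNIV UNIV \<phi> M (U ** transpose B + A ** transpose V) (U ** transpose B + A ** transpose V)
      + 2 * (G \<bullet> (A ** transpose B)) + lam * (A \<bullet> A + B \<bullet> B)"
proof -
  interpret cone_pair UNIV "UNIV :: (real^'n^'m) set" by (rule cone_pair_UNIV)
  let ?g = "grad_on UNIV UNIV \<phi>"
  let ?D = "\<lambda>x. frechet_derivative ?g (at x)"
  let ?m = "\<lambda>p :: (real^'r^'m) \<times> (real^'r^'n). fst p ** transpose (snd p)"
  let ?m' = "\<lambda>p h :: (real^'r^'m) \<times> (real^'r^'n). fst p ** transpose (snd h) + fst h ** transpose (snd p)"
  have prod: "(?m has_derivative ?m' x) (at x)" for x
    by (intro has_derivative_matrix_mult has_derivative_transpose has_derivative_fst has_derivative_snd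
        has_derivative_ident)
  have comp: "((\<lambda>p. f (?m p)) has_derivative (\<lambda>h. f' (?m' x h))) (at x)"
    if "(f has_derivative f') (at (?m x))" for f :: "real^'n^'m \<Rightarrow> 'b::real_normed_vector" and f' x
    by (rule has_derivative_compose[OF prod that])
  have split: "A \<bullet> ?m' x h = (A ** snd x, transpose A ** fst x) \<bullet> h" for A :: "real^'n^'m" and x h
  proof -
    have "A \<bullet> (fst x ** transpose (snd h)) = (transpose A ** fst x) \<bullet> snd h"
      using inner_transpose_transpose[of A "fst x ** transpose (snd h)"]
      by (simp add: matrix_transpose_mul inner_matrix_mult_right)
    moreover have "A \<bullet> (fst h ** transpose (snd x)) = (A ** snd x) \<bullet> fst h"
      by (simp add: inner_matrix_mult_right)
    ultimately show ?thesis by (simp add: inner_add_right inner_prod_def)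
  qed
  define F where "F x = (?g (?m x) ** snd x, transpose (?g (?m x)) ** fst x) + lam *\<^sub>R x" for x
  have der: "((\<lambda>(U :: real^'r^'m, V :: real^'r^'n). \<phi> (U ** transpose V) + lam * (((norm U)\<^sup>2 + (norm V)\<^sup>2) / 2))
      has_derivative (\<lambda>h. F x \<bullet> h)) (at x)" for x
  proof -
    have "((\<lambda>p. \<phi> (?m p)) has_derivative (\<lambda>h. ?g (?m x) \<bullet> ?m' x h)) (at x)"
      using comp[OF has_derivative_grad[OF tw UNIV_I]] by simp
    moreover have "((\<lambda>p. lam * ((p \<bullet> p) / 2)) has_derivative (\<lambda>h. lam * (x \<bullet> h))) (at x)"
      by (auto intro!: derivative_eq_intros simp: inner_commute)
    ultimately have "((\<lambda>p. \<phi> (?m p) + lam * ((p \<bullet> p) / 2)) has_derivative (\<lambda>h. F x \<bullet> h)) (at x)"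
      by (rule has_derivative_add[THEN has_derivative_eq_rhs]) (simp add: F_def split inner_add_left)
    moreover have "(\<lambda>p. \<phi> (?m p) + lam * ((p \<bullet> p) / 2))
      = (\<lambda>(U :: real^'r^'m, V :: real^'r^'n). \<phi> (U ** transpose V) + lam * (((norm U)\<^sup>2 + (norm V)\<^sup>2) / 2))"
      by (auto simp: inner_prod_def power2_norm_eq_inner)
    ultimately show ?thesis by simp
  qed
  have hess: "(?g has_derivative ?D (?m x)) (at (?m x))" for x
    using has_derivative_hess[OF tw UNIV_I] by simp
  have derF: "(F has_derivative (\<lambda>h.
      (?g M ** snd h + ?D M (?m' (U, V) h) ** V, transpose (?g M) ** fst h + transpose (?D M (?m' (U, V) h)) ** U)
      + lam *\<^sub>R h)) (at (U, V))"
    unfolding F_def M_def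
    by (rule has_derivative_eq_rhs, (rule has_derivative_add has_derivative_scaleR_right has_derivative_Pair
      has_derivative_matrix_mult has_derivative_ident has_derivative_fst has_derivative_snd
      has_derivative_transpose comp[OF hess])+) (simp add: fun_eq_iff)
  have crit': "F (U, V) = 0" "\<And>h. 0 \<le> ((?g M ** snd h + ?D M (?m' (U, V) h) ** V,
      transpose (?g M) ** fst h + transpose (?D M (?m' (U, V) h)) ** U) + lam *\<^sub>R h) \<bullet> h"
    using crit unfolding second_order_critical_iff[OF der derF] by blast+
  have "G ** V + lam *\<^sub>R U = 0" "transpose G ** U + lam *\<^sub>R V = 0"
    using crit'(1) by (auto simp: F_def G_def zero_prod_def)
  then show "G ** V = - lam *\<^sub>R U" "transpose G ** U = - lam *\<^sub>R V" by (simp_all add: add_eq_0_iff)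
  let ?E = "U ** transpose B + A ** transpose V"
  have "?D M ?E \<bullet> ?E = (?D M ?E ** V) \<bullet> A + (transpose (?D M ?E) ** U) \<bullet> B"
    using split[of "?D M ?E" "(U, V)" "(A, B)"] by (simp add: inner_prod_def)
  moreover have "G \<bullet> (A ** transpose B) = (?g M ** B) \<bullet> A"
    by (simp add: inner_matrix_mult_right G_def M_def)
  moreover have "G \<bullet> (A ** transpose B) = (transpose (?g M) ** A) \<bullet> B"
    using inner_transpose_transpose[of G "A ** transpose B"]
    by (simp add: matrix_transpose_mul inner_matrix_mult_right G_def M_def)
  ultimately show "0 \<le> hess_on UNIV UNIV \<phi> M ?E ?E + 2 * (G \<bullet> (A ** transpose B)) + lam * (A \<bullet> A + B \<bullet> B)"
    using crit'(2)[of "(A, B)"] by (simp add: hess_on_def inner_prod_def inner_add_left algebra_simps)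
qed

section \<open>Optimality conditions expressed in singular vectors\<close>

lemma svd_psd:
  assumes A: "A \<in> psd_mats" and svd: "svd A k \<sigma> u v" and i: "i < k"
  shows "u i = v i"
proof -
  have "transpose A = A" using A by (simp add: psd_mats_def)
  then have 1: "A *v u i = \<sigma> i *\<^sub>R v i" using svd_mult_left[OF svd i] by metis
  \<comment> \<open>A nonzero \<open>u i - v i\<close> would be an eigenvector for the negative
    eigenvalue \<open>- \<sigma> i\<close>.\<close>
  have "A *v (u i - v i) = - \<sigma> i *\<^sub>R (u i - v i)"
    by (simp add: matrix_vector_mult_diff_distrib 1 svd_mult_right[OF svd i] algebra_simps)
  moreover have "0 \<le> (u i - v i) \<bullet> (A *v (u i - v i))" using A by (simp add: psd_mats_def)
  ultimately have "0 \<le> (u i - v i) \<bullet> (- \<sigma> i *\<^sub>R (u i - v i))" by (simp only:)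
  then have "\<sigma> i * ((u i - v i) \<bullet> (u i - v i)) \<le> 0" by simp
  then have "(u i - v i) \<bullet> (u i - v i) \<le> 0" using svd_pos[OF svd i] by (simp add: mult_le_0_iff)
  then show ?thesis by (metis antisym eq_iff_diff_eq_0 inner_eq_zero_iff inner_ge_zero)
qed

text \<open>If \<open>U\<close> and \<open>V\<close> were both injective, \<open>transpose V\<close>
  would be onto and the product would have the full rank of \<open>U\<close>. Only a disjunction
  follows; which factor is singular matters when there is no regularisation.\<close>

lemma kernel_of_deficient_product:
  fixes U :: "real^'r^'m" and V :: "real^'r^'n"
  assumes "rank (U ** transpose V) < CARD('r)"
  obtains w where "norm w = 1" "U *v w = 0 \<or> V *v w = 0"
proof -
  have "\<not> (inj ((*v) U) \<and> inj ((*v) V))"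
  proof
    assume inj: "inj ((*v) U) \<and> inj ((*v) V)"
    then have "rank (transpose V) = CARD('r)" by (simp add: full_rank_injective rank_transpose)
    then have surj: "range ((*v) (transpose V)) = UNIV" by (simp only: full_rank_surjective)
    have "(*v) (U ** transpose V) = (*v) U \<circ> (*v) (transpose V)"
      by (simp only: fun_eq_iff o_apply matrix_vector_mul_assoc) simp
    then have "range ((*v) (U ** transpose V)) = range ((*v) U)"
      using surj by (metis image_comp)
    then have "rank (U ** transpose V) = rank U" by (simp add: rank_dim_range)
    then show False using assms inj by (metis full_rank_injective less_irrefl)
  qed
  then obtain w where w: "w \<noteq> 0" "U *v w = 0 \<or> V *v w = 0"
    using linear_injective_0[OF matrix_vector_mul_linear[of U]] linear_injective_0[OF matrix_vector_mul_linear[of V]]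
    by blast
  show thesis
    by (rule that[of "w /\<^sub>R norm w"]) (use w in \<open>auto simp: matrix_vector_mult_scaleR\<close>)
qed

lemma rank_outer_add_le: "rank (outer x y + outer x' y') \<le> 2"
  using rank_add_le[of "outer x y" "outer x' y'"] rank_outer_le[of x y] rank_outer_le[of x' y'] by linarith

text \<open>The test direction is h = x w^T with a unit vector \<open>w\<close> minimising |U w|. As
  \<open>x\<close> is orthogonal to U w, the direction seen by the Hessian has squared norm 2 s
  |x|^2 with s = |U w|^2, while the gradient is tested on h h^T = x x^T. Such products are positive
  semidefinite, so only one sign of the corner is controlled.\<close>

lemma symmetric_corner_bound:
  fixes U :: "real^'r^'d" and G :: "real^'d^'d"
  assumes svd: "svd (U ** transpose U) k \<sigma> a b" and k: "k \<le> CARD('r)"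
    and L2: "0 \<le> L2" and l: "0 \<le> l"
    and second: "\<And>h. rank (U ** transpose h + h ** transpose U) \<le> 2 \<Longrightarrow>
      0 \<le> L2 * (norm (U ** transpose h + h ** transpose U))\<^sup>2 + 2 * (G \<bullet> (h ** transpose h)) + 2 * l * (h \<bullet> h)"
    and x: "\<And>i. i < k \<Longrightarrow> a i \<bullet> x = 0"
  shows "- (x \<bullet> (G *v x)) \<le> (l + L2 * (if k = CARD('r) then \<sigma> (k - 1) else 0)) * (norm x)\<^sup>2"
proof -
  let ?M = "U ** transpose U"
  define s where "s = (if k = CARD('r) then \<sigma> (k - 1) else 0)"
  obtain w where w: "norm w = 1" "(U *v w) \<bullet> x = 0" "(norm (U *v w))\<^sup>2 = s"
  proof (cases "k = CARD('r)")
    case True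
    define i where "i = k - 1"
    have i: "i < k" using True by (simp add: i_def)
    have s: "s = \<sigma> i" "0 < s" using True svd_pos[OF svd i] by (simp_all add: s_def i_def)
    have ab: "a i = b i" by (rule svd_psd[OF gram_psd svd i])
    define w where "w = (1 / sqrt s) *\<^sub>R (transpose U *v a i)"
    have aa: "a i \<bullet> a i = 1" using svd_orthonormal_left[OF svd] i by (simp add: orthonormal_def)
    have UUa: "U *v (transpose U *v a i) = s *\<^sub>R a i"
      using svd_mult_right[OF svd i] by (simp add: matrix_vector_mul_assoc s ab del: transpose_matrix_vector)
    have Uw: "U *v w = sqrt s *\<^sub>R a i"
      using s(2) by (simp add: w_def matrix_vector_mult_scaleR UUa real_div_sqrt del: transpose_matrix_vector)
    have "(norm w)\<^sup>2 = (1 / s) * (a i \<bullet> (U *v (transpose U *v a i)))"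
      using s(2) unfolding w_def power2_norm_eq_inner
      by (simp add: inner_transpose_mult field_simps del: transpose_matrix_vector)
    also have "\<dots> = 1" unfolding UUa using s(2) by (simp add: aa)
    finally have "norm w = 1" by (simp add: power2_eq_1_iff) (metis abs_norm_cancel abs_1 abs_minus_cancel)
    moreover have "(U *v w) \<bullet> x = 0" using x[OF i] by (simp add: Uw)
    moreover have "(norm (U *v w))\<^sup>2 = s"
      unfolding Uw power2_norm_eq_inner using s(2) by (simp add: aa)
    ultimately show thesis using that by blast
  next
    case False
    then have "rank ?M < CARD('r)" using svd_rank[OF svd] k by simp
    then obtain w where "norm w = 1" "U *v w = 0" using kernel_of_deficient_product[of U U] by auto
    then show thesis using False by (intro that[of w]) (auto simp: s_def)
  qed
  define h where "h = outer x w"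
  have E: "U ** transpose h + h ** transpose U = outer (U *v w) x + outer x (U *v w)"
    by (simp add: h_def mult_outer outer_mult)
  have "h ** transpose h = outer x x"
    using w(1) by (simp add: h_def outer_mult outer_mult_vec dot_square_norm)
  moreover have "h \<bullet> h = (norm x)\<^sup>2" using w(1) by (simp add: h_def norm_outer dot_square_norm)
  moreover have "(norm (U ** transpose h + h ** transpose U))\<^sup>2 = 2 * s * (norm x)\<^sup>2"
    unfolding E power2_norm_eq_inner w(3)[symmetric]
    using w(2) by (simp add: inner_add_left inner_add_right inner_outer_outer inner_commute algebra_simps)
  ultimately have "0 \<le> L2 * (2 * s * (norm x)\<^sup>2) + 2 * (x \<bullet> (G *v x)) + 2 * l * (norm x)\<^sup>2"
    using second[of h] rank_outer_add_le[of "U *v w" x x "U *v w"] by (simp add: E inner_outer_right)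
  then show ?thesis by (simp add: s_def[symmetric] algebra_simps)
qed

text \<open>The first-order conditions give l (U^T U - V^T V) = 0. For l > 0 this balance makes S =
  U U^T the positive square root of M M^T, where M = U V^T, so S multiplies a_i by \<sigma>_i. The
  factor \<open>l\<close> in the conclusion lets it include l = 0.\<close>

lemma balanced_singular_vector:
  fixes U :: "real^'r^'m" and V :: "real^'r^'n" and G :: "real^'n^'m"
  assumes svd: "svd (U ** transpose V) k \<sigma> a b" and i: "i < k" and l: "0 \<le> l"
    and GV: "G ** V = - l *\<^sub>R U" and GU: "transpose G ** U = - l *\<^sub>R V"
  shows "l *\<^sub>R (U *v (transpose U *v a i)) = (l * \<sigma> i) *\<^sub>R a i"
proof (cases "l = 0")
  case False
  then have l: "0 < l" using l by simp
  have "transpose U ** (G ** V) = (transpose U ** G) ** V" by (simp add: matrix_mul_assoc)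
  also have "transpose U ** G = transpose (transpose G ** U)" by (simp add: matrix_transpose_mul)
  finally have "l *\<^sub>R (transpose U ** U) = l *\<^sub>R (transpose V ** V)"
    unfolding GV GU transpose_scalar matrix_mult_scaleR_left matrix_mult_scaleR_right by simp
  then have bal: "transpose U ** U = transpose V ** V" using l by simp
  define S where "S = U ** transpose U"
  have SS: "S ** S = (U ** transpose V) ** transpose (U ** transpose V)"
  proof -
    have "S ** S = U ** (transpose U ** U) ** transpose U" by (simp add: S_def matrix_mul_assoc)
    then show ?thesis by (simp add: bal matrix_transpose_mul matrix_mul_assoc)
  qed
  have "S *v (S *v a i) = (U ** transpose V) *v (transpose (U ** transpose V) *v a i)"
    by (simp only: matrix_vector_mul_assoc SS)
  also have "\<dots> = (\<sigma> i)\<^sup>2 *\<^sub>R a i"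
    by (simp add: svd_mult_left[OF svd i] svd_mult_right[OF svd i] matrix_vector_mult_scaleR power2_eq_square
        del: transpose_matrix_vector)
  finally have SSa: "S *v (S *v a i) = (\<sigma> i)\<^sup>2 *\<^sub>R a i" .
  define d where "d = S *v a i - \<sigma> i *\<^sub>R a i"
  have "S *v d = - \<sigma> i *\<^sub>R d"
    by (simp add: d_def matrix_vector_mult_diff_distrib matrix_vector_mult_scaleR SSa power2_eq_square algebra_simps)
  moreover have "0 \<le> d \<bullet> (S *v d)" using gram_psd[of U] by (simp add: psd_mats_def S_def)
  ultimately have "\<sigma> i * (d \<bullet> d) \<le> 0" by simp
  then have "d \<bullet> d \<le> 0" using svd_pos[OF svd i] by (simp add: mult_le_0_iff)
  then have "d = 0" by (metis antisym inner_eq_zero_iff inner_ge_zero)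
  then have "S *v a i = \<sigma> i *\<^sub>R a i" by (simp add: d_def)
  then show ?thesis by (simp add: S_def matrix_vector_mul_assoc del: transpose_matrix_vector)
qed simp

text \<open>With M = U V^T, \<sigma>_i b_i = M^T a_i turns \<sigma>_i G b_i into G V U^T a_i = -l U
  U^T a_i, which balance evaluates.\<close>

lemma critical_singular_vectors:
  fixes U :: "real^'r^'m" and V :: "real^'r^'n" and G :: "real^'n^'m"
  assumes svd: "svd (U ** transpose V) k \<sigma> a b" and i: "i < k" and l: "0 \<le> l"
    and GV: "G ** V = - l *\<^sub>R U" and GU: "transpose G ** U = - l *\<^sub>R V"
  shows "G *v b i = - l *\<^sub>R a i"
proof -
  have "\<sigma> i *\<^sub>R (G *v b i) = G *v (transpose (U ** transpose V) *v a i)"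
    by (simp add: svd_mult_left[OF svd i] matrix_vector_mult_scaleR del: transpose_matrix_vector)
  also have "\<dots> = (G ** V) *v (transpose U *v a i)"
    by (simp only: matrix_transpose_mul transpose_transpose matrix_vector_mul_assoc matrix_mul_assoc)
  also have "\<dots> = - (l *\<^sub>R (U *v (transpose U *v a i)))"
    by (simp add: GV scaleR_matrix_vector uminus_matrix_vector del: transpose_matrix_vector)
  also have "\<dots> = - ((l * \<sigma> i) *\<^sub>R a i)" unfolding balanced_singular_vector[OF svd i l GV GU] ..
  also have "\<dots> = \<sigma> i *\<^sub>R (- l *\<^sub>R a i)" by simp
  finally have "\<sigma> i *\<^sub>R (G *v b i) = \<sigma> i *\<^sub>R (- l *\<^sub>R a i)" .
  then show ?thesis using svd_pos[OF svd i] by (simp only: scaleR_cancel_left) simp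
qed

lemma affine_nonneg_imp_zero:
  fixes c d :: real
  assumes "\<And>t. 0 \<le> c + t * d"
  shows "d = 0"
proof (rule ccontr)
  assume "d \<noteq> 0"
  then show False using assms[of "- (\<bar>c\<bar> + 1) / d"] by simp
qed

text \<open>
  The second-order condition is tested on \<open>A = outer x w\<close>, \<open>B = outer y z\<close> with \<open>U z\<close>, \<open>V w\<close> along the
  last pair of singular vectors of \<open>U V\<^sup>T\<close>. Taking \<open>w \<noteq> z\<close> avoids the balancing
  \<open>U\<^sup>T U = V\<^sup>T V\<close>, which fails for \<open>l = 0\<close>.
\<close>

lemma asymmetric_corner_bound:
  fixes U :: "real^'r^'m" and V :: "real^'r^'n" and G :: "real^'n^'m"
  assumes svd: "svd (U ** transpose V) k \<sigma> a b" and k: "k \<le> CARD('r)"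
    and L2: "0 \<le> L2" and l: "0 \<le> l"
    and GV: "G ** V = - l *\<^sub>R U" and GU: "transpose G ** U = - l *\<^sub>R V"
    and second: "\<And>A B. rank (U ** transpose B + A ** transpose V) \<le> 2 \<Longrightarrow>
      0 \<le> L2 * (norm (U ** transpose B + A ** transpose V))\<^sup>2 + 2 * (G \<bullet> (A ** transpose B)) + l * (A \<bullet> A + B \<bullet> B)"
    and x: "\<And>i. i < k \<Longrightarrow> a i \<bullet> x = 0"
  shows "- (x \<bullet> (G *v y)) \<le> (l + L2 * (if k = CARD('r) then \<sigma> (k - 1) else 0)) * (norm x * norm y)"
proof -
  let ?M = "U ** transpose V"
  have test: "0 \<le> L2 * (norm (outer (U *v z) y + outer x (V *v w)))\<^sup>2 + 2 * ((w \<bullet> z) * (x \<bullet> (G *v y)))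
      + l * ((norm x)\<^sup>2 * (norm w)\<^sup>2 + (norm y)\<^sup>2 * (norm z)\<^sup>2)" for x y w z
  proof -
    have "U ** transpose (outer y z) + outer x w ** transpose V = outer (U *v z) y + outer x (V *v w)"
      by (simp add: mult_outer outer_mult)
    moreover have "outer x w ** transpose (outer y z) = (w \<bullet> z) *\<^sub>R outer x y"
      by (simp add: outer_mult outer_mult_vec outer_scaleR_right inner_commute)
    moreover have "outer x w \<bullet> outer x w = (norm x)\<^sup>2 * (norm w)\<^sup>2" "outer y z \<bullet> outer y z = (norm y)\<^sup>2 * (norm z)\<^sup>2"
      by (simp_all add: dot_square_norm norm_outer power_mult_distrib)
    ultimately show ?thesis
      using second[of "outer y z" "outer x w"] rank_outer_add_le[of "U *v z" y x "V *v w"]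
      by (simp add: inner_outer_right)
  qed
  show ?thesis
  proof (cases "k = CARD('r)")
    case True
    define i where "i = k - 1"
    have i: "i < k" using True by (simp add: i_def)
    define s where "s = \<sigma> i"
    have s: "0 < s" using svd_pos[OF svd i] by (simp add: s_def)
    \<comment> \<open>\<open>w\<close> and \<open>z\<close> are dual rather than normalised: U z = s
      a_i, V w = b_i and w . z = 1 hold with or without balance. Balance enters only in l |w|^2 = l
      / s and l |z|^2 = l s, which are trivial for l = 0.\<close>
    define w where "w = (1 / s) *\<^sub>R (transpose U *v a i)"
    define z where "z = transpose V *v b i"
    have aa: "a i \<bullet> a i = 1" and bb: "b i \<bullet> b i = 1"
      using svd_orthonormal_left[OF svd] svd_orthonormal_right[OF svd] i by (simp_all add: orthonormal_def)
    have Uz: "U *v z = s *\<^sub>R a i"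
      using svd_mult_right[OF svd i] by (simp add: z_def matrix_vector_mul_assoc s_def del: transpose_matrix_vector)
    have VUa: "V *v (transpose U *v a i) = s *\<^sub>R b i"
      using svd_mult_left[OF svd i]
      by (simp add: matrix_transpose_mul matrix_vector_mul_assoc s_def del: transpose_matrix_vector)
    have Vw: "V *v w = b i"
      using s by (simp add: w_def matrix_vector_mult_scaleR VUa del: transpose_matrix_vector)
    have wz: "w \<bullet> z = 1"
      using s by (simp add: w_def inner_transpose_mult Uz aa del: transpose_matrix_vector)
    have svdT: "svd (V ** transpose U) k \<sigma> b a"
      using svd_transpose[OF svd] by (simp add: matrix_transpose_mul)
    have w2: "l * (norm w)\<^sup>2 = l / s"
    proof -
      have "l * (norm w)\<^sup>2 = (1 / s\<^sup>2) * (a i \<bullet> (l *\<^sub>R (U *v (transpose U *v a i))))"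
        unfolding w_def power2_norm_eq_inner
        by (simp add: inner_transpose_mult power2_eq_square field_simps del: transpose_matrix_vector)
      also have "\<dots> = l / s"
        unfolding balanced_singular_vector[OF svd i l GV GU]
        using s by (simp add: aa power2_eq_square flip: s_def)
      finally show ?thesis .
    qed
    have z2: "l * (norm z)\<^sup>2 = l * s"
    proof -
      have "l * (norm z)\<^sup>2 = b i \<bullet> (l *\<^sub>R (V *v (transpose V *v b i)))"
        unfolding z_def power2_norm_eq_inner by (simp add: inner_transpose_mult del: transpose_matrix_vector)
      also have "\<dots> = l * s"
        using balanced_singular_vector[OF svdT i l, of "transpose G"] GV GU by (simp add: bb s_def)
      finally show ?thesis .
    qed
    define p q where "p = norm x" and "q = norm y"
    have pq: "0 \<le> p" "0 \<le> q" by (simp_all add: p_def q_def)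
    \<comment> \<open>This scaling equalises the two rank-one terms of the Hessian direction and
      also the two penalty terms, so nothing is lost to the arithmetic-geometric inequality.\<close>
    let ?x = "(s * q) *\<^sub>R x" and ?y = "p *\<^sub>R y"
    have orth: "a i \<bullet> x = 0" by (rule x[OF i])
    have xx: "x \<bullet> x = p\<^sup>2" "y \<bullet> y = q\<^sup>2" by (simp_all add: p_def q_def dot_square_norm)
    have "(norm (outer (U *v z) ?y + outer ?x (V *v w)))\<^sup>2 = 2 * (s\<^sup>2 * p\<^sup>2 * q\<^sup>2)"
      unfolding power2_norm_eq_inner Uz Vw
      by (simp add: inner_add_left inner_add_right inner_outer_outer inner_commute[of x "a i"] orth aa bb xx)
        (simp add: power2_eq_square)
    moreover have "l * ((norm ?x)\<^sup>2 * (norm w)\<^sup>2 + (norm ?y)\<^sup>2 * (norm z)\<^sup>2) = 2 * (l * s * p\<^sup>2 * q\<^sup>2)"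
    proof -
      have "l * ((norm ?x)\<^sup>2 * (norm w)\<^sup>2 + (norm ?y)\<^sup>2 * (norm z)\<^sup>2)
          = (s * q * p)\<^sup>2 * (l * (norm w)\<^sup>2) + (p * q)\<^sup>2 * (l * (norm z)\<^sup>2)"
        using s pq by (simp add: p_def[symmetric] q_def[symmetric] power_mult_distrib algebra_simps)
      then show ?thesis unfolding w2 z2 using s by (simp add: power2_eq_square field_simps)
    qed
    moreover have "?x \<bullet> (G *v ?y) = s * p * q * (x \<bullet> (G *v y))"
      by (simp add: matrix_vector_mult_scaleR)
    ultimately have "0 \<le> L2 * (2 * (s\<^sup>2 * p\<^sup>2 * q\<^sup>2)) + 2 * (s * p * q * (x \<bullet> (G *v y))) + 2 * (l * s * p\<^sup>2 * q\<^sup>2)"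
      using test[of z ?y ?x w] unfolding wz by (simp only: mult_1)
    also have "\<dots> = 2 * (s * p * q) * (L2 * s * (p * q) + x \<bullet> (G *v y) + l * (p * q))"
      by (simp add: power2_eq_square algebra_simps)
    finally have main: "0 \<le> 2 * (s * p * q) * (L2 * s * (p * q) + x \<bullet> (G *v y) + l * (p * q))" .
    show ?thesis
    proof (cases "p = 0 \<or> q = 0")
      case True
      then show ?thesis by (auto simp: p_def q_def)
    next
      case False
      then have "0 < 2 * (s * p * q)" using s pq by simp
      then have "0 \<le> L2 * s * (p * q) + x \<bullet> (G *v y) + l * (p * q)"
        using main by (simp add: zero_le_mult_iff)
      then show ?thesis
        using \<open>k = CARD('r)\<close> by (simp add: p_def q_def s_def i_def algebra_simps)
    qed
  next
    case False
    then have "rank ?M < CARD('r)" using svd_rank[OF svd] k by simp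
    then obtain w where w: "norm w = 1" "U *v w = 0 \<or> V *v w = 0"
      by (rule kernel_of_deficient_product)
    have ww: "w \<bullet> w = 1" using w(1) by (simp add: dot_square_norm)
    show ?thesis
    proof (cases "l = 0")
      case True
      \<comment> \<open>Without regularisation possibly only one factor kills \<open>w\<close>.
        Scaling the vector paired with the vanishing product by t leaves the Hessian direction
        unchanged, so the term linear in t must vanish.\<close>
      have "x \<bullet> (G *v y) = 0"
        using w(2)
      proof
        assume U0: "U *v w = 0"
        have "0 \<le> L2 * (norm (outer x (V *v w)))\<^sup>2 + t * (2 * (x \<bullet> (G *v y)))" for t
          using test[of w "t *\<^sub>R y" x w] True by (simp add: U0 ww matrix_vector_mult_scaleR mult_ac)
        then have "2 * (x \<bullet> (G *v y)) = 0" by (rule affine_nonneg_imp_zero)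
        then show ?thesis by simp
      next
        assume V0: "V *v w = 0"
        have "0 \<le> L2 * (norm (outer (U *v w) y))\<^sup>2 + t * (2 * (x \<bullet> (G *v y)))" for t
          using test[of w y "t *\<^sub>R x" w] True by (simp add: V0 ww mult_ac)
        then have "2 * (x \<bullet> (G *v y)) = 0" by (rule affine_nonneg_imp_zero)
        then show ?thesis by simp
      qed
      then show ?thesis using False True by simp
    next
      case l0: False
      \<comment> \<open>For nonzero \<open>l\<close> the first-order conditions carry a kernel
        vector of one factor over to the other, so the Hessian direction vanishes.\<close>
      have GVw: "G *v (V *v w) = - l *\<^sub>R (U *v w)" and GUw: "transpose G *v (U *v w) = - l *\<^sub>R (V *v w)"
        unfolding matrix_vector_mul_assoc GV GU scaleR_matrix_vector by simp_all
      have "U *v w = 0 \<and> V *v w = 0"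
        using w(2) GVw GUw l0 by auto
      then have test': "0 \<le> 2 * (x' \<bullet> (G *v y')) + l * ((norm x')\<^sup>2 + (norm y')\<^sup>2)" for x' y'
        using test[of w y' x' w] w(1) by (simp add: ww)
      define p q where "p = norm x" and "q = norm y"
      have pq: "0 \<le> p" "0 \<le> q" by (simp_all add: p_def q_def)
      have "0 \<le> 2 * (p * q * (x \<bullet> (G *v y))) + l * ((q * p)\<^sup>2 + (p * q)\<^sup>2)"
        using test'[of "q *\<^sub>R x" "p *\<^sub>R y"] pq
        by (simp add: matrix_vector_mult_scaleR p_def[symmetric] q_def[symmetric] mult_ac)
      also have "\<dots> = 2 * (p * q) * (x \<bullet> (G *v y) + l * (p * q))" by (simp add: power2_eq_square algebra_simps)
      finally have main: "0 \<le> 2 * (p * q) * (x \<bullet> (G *v y) + l * (p * q))" .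
      show ?thesis
      proof (cases "p = 0 \<or> q = 0")
        case True
        then show ?thesis by (auto simp: p_def q_def)
      next
        case pq0: False
        then have "0 < 2 * (p * q)" using pq by simp
        then have "0 \<le> x \<bullet> (G *v y) + l * (p * q)" using main by (simp add: zero_le_mult_iff)
        then show ?thesis using False by (simp add: p_def q_def)
      qed
    qed
  qed
qed

text \<open>The optimal constants are the infimum and supremum of the Rayleigh quotients over
  admissible \<open>M\<close> and nonzero \<open>E\<close>. The witnesses \<open>M0\<close> and
  \<open>E0\<close> keep this set nonempty, without which \<open>Inf\<close> and \<open>Sup\<close>
  would carry no information.\<close>

lemma restricted_optima:
  fixes \<phi> :: "real^'n^'m \<Rightarrow> real"
  assumes rsc: "restricted_sc_smooth T S k l a b \<phi>" and S: "M0 \<in> S" "rank M0 \<le> l"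
    and T: "E0 \<in> T" "rank E0 \<le> k" "E0 \<noteq> 0"
  shows "restricted_sc_smooth T S k l (rsc_mu T S k l \<phi>) (rsc_L T S k l \<phi>) \<phi>"
proof -
  let ?h = "\<lambda>M E. hess_on T S \<phi> M E E / (norm E)\<^sup>2"
  define X where "X = {?h M E |M E. M \<in> S \<and> E \<in> T \<and> rank M \<le> l \<and> rank E \<le> k \<and> E \<noteq> 0}"
  have X0: "?h M0 E0 \<in> X" using S T by (auto simp: X_def)
  have iff: "restricted_sc_smooth T S k l \<mu> L \<phi> \<longleftrightarrow>
      0 \<le> \<mu> \<and> \<mu> \<le> L \<and> (\<forall>x\<in>X. \<mu> \<le> x \<and> x \<le> L)" for \<mu> L
  proof -
    have zero: "hess_on T S \<phi> M 0 0 = 0" for M by (simp add: hess_on_def)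
    have "(\<mu> * (norm E)\<^sup>2 \<le> hess_on T S \<phi> M E E \<and> hess_on T S \<phi> M E E \<le> L * (norm E)\<^sup>2) \<longleftrightarrow>
        (E \<noteq> 0 \<longrightarrow> \<mu> \<le> ?h M E \<and> ?h M E \<le> L)" for M E
      by (cases "E = 0") (auto simp: zero le_divide_eq divide_le_eq)
    then show ?thesis
      using rsc unfolding restricted_sc_smooth_def X_def by blast
  qed
  have bd: "0 \<le> a" "a \<le> x" "x \<le> b" if "x \<in> X" for x using rsc that unfolding iff by auto
  have bdd: "bdd_below X" "bdd_above X" by (rule bdd_belowI[of _ a], rule bd(2), assumption) (rule bdd_aboveI[of _ b], rule bd(3), assumption)
  have Xne: "X \<noteq> {}" using X0 by blast
  have InfSup: "Inf X \<le> Sup X" using X0 bdd cInf_lower cSup_upper order_trans by metis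
  have opt: "restricted_sc_smooth T S k l (Inf X) (Sup X) \<phi>"
    unfolding iff
  proof (intro conjI ballI)
    show "0 \<le> Inf X" using Xne bd by (intro cInf_greatest) (auto intro: order_trans)
  qed (use InfSup bdd in \<open>auto intro: cInf_lower cSup_upper\<close>)
  have "rsc_mu T S k l \<phi> = Inf X"
    unfolding rsc_mu_def
    by (rule Greatest_equality) (use opt Xne in \<open>auto simp: iff intro: cInf_greatest\<close>)
  moreover have "rsc_L T S k l \<phi> = Sup X"
    unfolding rsc_L_def
    by (rule Least_equality) (use opt Xne in \<open>auto simp: iff intro: cSup_least\<close>)
  ultimately show ?thesis using opt by simp
qed


section \<open>Assembling the two cases\<close>

lemma symmetric_recovery:
  fixes \<phi> :: "real^'d^'d \<Rightarrow> real" and U :: "real^'r^'d" and Ms :: "real^'d^'d"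
  assumes rs: "1 \<le> rs" "rs \<le> CARD('r)"
    and rsc: "restricted_sc_smooth sym_mats psd_mats (CARD('r) + rs) (CARD('r) + rs) \<mu> L \<phi>"
    and rsc2: "restricted_sc_smooth sym_mats psd_mats 2 (CARD('r) + rs) \<mu>2 L2 \<phi>"
    and \<mu>: "0 < \<mu>" and eff: "0 < mu_eff (CARD('r)) rs \<mu> L L2"
    and l: "0 \<le> l" and Ms: "Ms \<in> psd_mats" "rank Ms \<le> rs"
    and crit: "second_order_critical (\<lambda>U :: real^'r^'d. \<phi> (U ** transpose U) + l * (norm U)\<^sup>2) U"
  shows "norm (U ** transpose U - Ms)
    \<le> (6 * sqrt (real rs) * l
       + sqrt (real (CARD('r) + rs)) * max (op_norm (grad_on sym_mats psd_mats \<phi> Ms) - l) 0)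
      / mu_eff (CARD('r)) rs \<mu> L L2"
proof -
  interpret cone_pair sym_mats "psd_mats :: (real^'d^'d) set" by (rule cone_pair_psd)
  define M G where "M = U ** transpose U" and "G = grad_on sym_mats psd_mats \<phi> (U ** transpose U)"
  have tw: "twice_differentiable_on sym_mats psd_mats \<phi>" using rsc by (simp add: restricted_sc_smooth_def)
  have MP: "M \<in> psd_mats" unfolding M_def by (rule gram_psd)
  have rank_M: "rank M \<le> CARD('r)"
    unfolding M_def using rank_mul_le_left[of U "transpose U"] rank_bound[of U] by simp
  have Gt: "transpose G = G" using grad_mem[OF tw MP] by (simp add: sym_mats_def G_def M_def)
  have GU: "G ** U = - l *\<^sub>R U" unfolding G_def by (rule second_order_critical_symmetric(1)[OF tw crit])
  have GU': "transpose G ** U = - l *\<^sub>R U" using GU Gt by simp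
  obtain k \<sigma> a b where svd: "svd M k \<sigma> a b" and k: "k \<le> rank M" using svd_exists by blast
  note svd' = svd[unfolded M_def]
  have kr: "k \<le> CARD('r)" using k rank_M by simp
  have ab: "a i = b i" if "i < k" for i by (rule svd_psd[OF MP svd that])
  then have frames: "frame k b b = frame k a a" by (simp add: frame_def)
  define P N where "P = frame k a a" and "N = (mat 1 - P) ** Ms ** (mat 1 - frame k b b)"
  have Pt: "transpose (mat 1 - P) = mat 1 - P" by (simp add: P_def transpose_diff)
  \<comment> \<open>\<open>N\<close> is a compression of \<open>Ms\<close>, hence positive
    semidefinite with equal left and right singular vectors; the one-sided bound on the gradient
    then suffices.\<close>
  have NP: "N \<in> psd_mats"
  proof -
    have "transpose N = N"
      using Ms(1) by (simp add: N_def frames P_def[symmetric] matrix_transpose_mul Pt matrix_mul_assoc psd_mats_def)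
    moreover have "x \<bullet> (N *v x) = ((mat 1 - P) *v x) \<bullet> (Ms *v ((mat 1 - P) *v x))" for x
      unfolding N_def frames P_def[symmetric]
      by (metis Pt inner_transpose_mult matrix_vector_mul_assoc)
    ultimately show ?thesis using Ms(1) by (simp add: psd_mats_def)
  qed
  obtain k' n u v where svdN: "svd N k' n u v" using svd_exists by blast
  \<comment> \<open>Indices start at 0, so \<open>\<sigma> (k - 1)\<close> is the last of
    \<open>CARD('r)\<close> singular values; a rank-deficient \<open>M\<close> gets 0.\<close>
  define s where "s = (if k = CARD('r) then \<sigma> (k - 1) else 0)"
  have L2: "0 \<le> L2" and L: "\<mu> \<le> L" using rsc rsc2 by (auto simp: restricted_sc_smooth_def)
  have second: "0 \<le> L2 * (norm (U ** transpose h + h ** transpose U))\<^sup>2 + 2 * (G \<bullet> (h ** transpose h)) + 2 * l * (h \<bullet> h)"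
    if r: "rank (U ** transpose h + h ** transpose U) \<le> 2" for h
  proof -
    let ?E = "U ** transpose h + h ** transpose U"
    have "?E \<in> sym_mats" by (simp add: sym_mats_def transpose_add matrix_transpose_mul add.commute)
    then have "hess_on sym_mats psd_mats \<phi> M ?E ?E \<le> L2 * (norm ?E)\<^sup>2"
      using rsc2 r MP rank_M unfolding restricted_sc_smooth_def by auto
    then show ?thesis
      using second_order_critical_symmetric(2)[OF tw crit, of h] unfolding M_def G_def by linarith
  qed
  have corner: "- (G \<bullet> N) \<le> (l + L2 * s) * (\<Sum>i<k'. n i)"
  proof -
    have uv: "u i = v i" if "i < k'" for i by (rule svd_psd[OF NP svdN that])
    have "- (v i \<bullet> (G *v v i)) \<le> l + L2 * s" if i: "i < k'" for i
    proof -
      have orth: "a j \<bullet> v i = 0" if "j < k" for j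
        using corner_singular_vectors(2)[OF svd_orthonormal_left[OF svd] svd_orthonormal_right[OF svd]
            svdN[unfolded N_def P_def] i that] ab[OF that] by simp
      have "- (v i \<bullet> (G *v v i)) \<le> (l + L2 * s) * (norm (v i))\<^sup>2"
        unfolding s_def by (rule symmetric_corner_bound[OF svd' kr L2 l]) (erule second, erule orth)
      then show ?thesis using orthonormal_norm[OF svd_orthonormal_right[OF svdN] i] by simp
    qed
    then have "(\<Sum>i<k'. n i * (- (v i \<bullet> (G *v v i)))) \<le> (\<Sum>i<k'. n i * (l + L2 * s))"
      using svd_pos[OF svdN] by (intro sum_mono mult_left_mono) (auto intro: less_imp_le)
    also have "\<dots> = (l + L2 * s) * (\<Sum>i<k'. n i)" by (simp add: mult.commute flip: sum_distrib_right)
    finally have "(\<Sum>i<k'. n i * (- (v i \<bullet> (G *v v i)))) \<le> (l + L2 * s) * (\<Sum>i<k'. n i)" .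
    moreover have "- (G \<bullet> N) = (\<Sum>i<k'. n i * (- (v i \<bullet> (G *v v i))))"
      by (subst svd_eq[OF svdN]) (simp add: inner_sum_right inner_outer_right uv flip: sum_negf)
    ultimately show ?thesis by simp
  qed
  have "norm (M - Ms) \<le> (6 * sqrt (real rs) * l + sqrt (real (CARD('r) + rs)) *
      max (op_norm (grad_on sym_mats psd_mats \<phi> Ms) - l) 0) / mu_eff (CARD('r)) rs \<mu> L L2"
  proof (rule recovery_bound[OF svd kr rs Ms(2) \<mu> L L2 eff l, where G = G and s = s and k' = k' and n = n and u = u and v = v])
    show "G *v b i = - l *\<^sub>R a i" if "i < k" for i
      by (rule critical_singular_vectors[OF svd' that l GU GU'])
    show "transpose G *v a i = - l *\<^sub>R b i" if "i < k" for i
      using critical_singular_vectors[OF svd' that l GU GU'] unfolding Gt ab[OF that] .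
    show "0 \<le> s" using svd_pos[OF svd, of "k - 1"] by (auto simp: s_def intro: less_imp_le)
    show "s \<le> \<sigma> i" if "k = CARD('r)" "i < k" for i
      using that svd_mono[OF svd, of i "k - 1"] by (auto simp: s_def)
    show "s = 0" if "k < CARD('r)" using that by (simp add: s_def)
    show "svd ((mat 1 - frame k a a) ** Ms ** (mat 1 - frame k b b)) k' n u v"
      using svdN by (simp add: N_def P_def)
    show "- (G \<bullet> ((mat 1 - frame k a a) ** Ms ** (mat 1 - frame k b b))) \<le> (l + L2 * s) * (\<Sum>i<k'. n i)"
      using corner by (simp add: N_def P_def)
    fix d
    let ?Y = "M - Ms + d *\<^sub>R N"
    have "N \<in> sym_mats" "M \<in> sym_mats" "Ms \<in> sym_mats" using NP MP Ms(1) S_subset by auto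
    then have YT: "?Y \<in> sym_mats" using subspace_T by (simp add: subspace_add subspace_diff subspace_scale)
    have rank_Y: "rank (\<alpha> *\<^sub>R (M - Ms) + \<beta> *\<^sub>R ?Y) \<le> CARD('r) + rs" for \<alpha> \<beta>
    proof -
      have "\<alpha> *\<^sub>R (M - Ms) + \<beta> *\<^sub>R ?Y = (\<alpha> + \<beta>) *\<^sub>R M + (- (\<alpha> + \<beta>)) *\<^sub>R Ms + (\<beta> * d) *\<^sub>R N"
        by (simp add: algebra_simps)
      then have "rank (\<alpha> *\<^sub>R (M - Ms) + \<beta> *\<^sub>R ?Y) \<le> k + rank Ms"
        unfolding N_def P_def by (metis rank_corner_combination[OF svd])
      then show ?thesis using kr Ms(2) by simp
    qed
    have rank_sum: "rank M + rank Ms \<le> CARD('r) + rs" using rank_M Ms(2) by simp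
    show "(L + \<mu>) / 2 * ((M - Ms) \<bullet> (M - Ms + d *\<^sub>R ((mat 1 - frame k a a) ** Ms ** (mat 1 - frame k b b))))
        - (L - \<mu>) / 2 * norm (M - Ms) * norm (M - Ms + d *\<^sub>R ((mat 1 - frame k a a) ** Ms ** (mat 1 - frame k b b)))
      \<le> (G - grad_on sym_mats psd_mats \<phi> Ms) \<bullet> (M - Ms + d *\<^sub>R ((mat 1 - frame k a a) ** Ms ** (mat 1 - frame k b b)))"
      using restricted_monotone[OF cone_pair_psd rsc MP Ms(1) rank_sum YT rank_Y]
      by (simp add: N_def P_def G_def M_def)
  qed
  then show ?thesis by (simp add: M_def)
qed

lemma asymmetric_recovery:
  fixes \<phi> :: "real^'n^'m \<Rightarrow> real" and U :: "real^'r^'m" and V :: "real^'r^'n" and Ms :: "real^'n^'m"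
  assumes rs: "1 \<le> rs" "rs \<le> CARD('r)"
    and rsc: "restricted_sc_smooth UNIV UNIV (CARD('r) + rs) (CARD('r) + rs) \<mu> L \<phi>"
    and rsc2: "restricted_sc_smooth UNIV UNIV 2 (CARD('r) + rs) \<mu>2 L2 \<phi>"
    and \<mu>: "0 < \<mu>" and eff: "0 < mu_eff (CARD('r)) rs \<mu> L L2"
    and l: "0 \<le> l" and Ms: "rank Ms \<le> rs"
    and crit: "second_order_critical (\<lambda>(U :: real^'r^'m, V :: real^'r^'n).
      \<phi> (U ** transpose V) + l * (((norm U)\<^sup>2 + (norm V)\<^sup>2) / 2)) (U, V)"
  shows "norm (U ** transpose V - Ms)
    \<le> (6 * sqrt (real rs) * l
       + sqrt (real (CARD('r) + rs)) * max (op_norm (grad_on UNIV UNIV \<phi> Ms) - l) 0)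
      / mu_eff (CARD('r)) rs \<mu> L L2"
proof -
  define M G where "M = U ** transpose V" and "G = grad_on UNIV UNIV \<phi> (U ** transpose V)"
  have tw: "twice_differentiable_on UNIV UNIV \<phi>" using rsc by (simp add: restricted_sc_smooth_def)
  have rank_M: "rank M \<le> CARD('r)"
    unfolding M_def using rank_mul_le_left[of U "transpose V"] rank_bound[of U] by simp
  have GV: "G ** V = - l *\<^sub>R U" and GU: "transpose G ** U = - l *\<^sub>R V"
    unfolding G_def by (rule second_order_critical_asymmetric(1,2)[OF tw crit])+
  obtain k \<sigma> a b where svd: "svd M k \<sigma> a b" and k: "k \<le> rank M" using svd_exists by blast
  note svd' = svd[unfolded M_def]
  have kr: "k \<le> CARD('r)" using k rank_M by simp
  have svdT: "svd (V ** transpose U) k \<sigma> b a"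
    using svd_transpose[OF svd'] by (simp add: matrix_transpose_mul)
  define N where "N = (mat 1 - frame k a a) ** Ms ** (mat 1 - frame k b b)"
  obtain k' n u v where svdN: "svd N k' n u v" using svd_exists by blast
  define s where "s = (if k = CARD('r) then \<sigma> (k - 1) else 0)"
  have L2: "0 \<le> L2" and L: "\<mu> \<le> L" using rsc rsc2 by (auto simp: restricted_sc_smooth_def)
  have second: "0 \<le> L2 * (norm (U ** transpose B + A ** transpose V))\<^sup>2 + 2 * (G \<bullet> (A ** transpose B))
      + l * (A \<bullet> A + B \<bullet> B)"
    if r: "rank (U ** transpose B + A ** transpose V) \<le> 2" for A B
  proof -
    let ?E = "U ** transpose B + A ** transpose V"
    have "hess_on UNIV UNIV \<phi> M ?E ?E \<le> L2 * (norm ?E)\<^sup>2"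
      using rsc2 r rank_M unfolding restricted_sc_smooth_def by auto
    then show ?thesis
      using second_order_critical_asymmetric(3)[OF tw crit, of B A] unfolding M_def G_def by linarith
  qed
  have corner: "- (G \<bullet> N) \<le> (l + L2 * s) * (\<Sum>i<k'. n i)"
  proof -
    have "- (u i \<bullet> (G *v v i)) \<le> l + L2 * s" if i: "i < k'" for i
    proof -
      have orth: "a j \<bullet> u i = 0" if "j < k" for j
        by (rule corner_singular_vectors(1)[OF svd_orthonormal_left[OF svd] svd_orthonormal_right[OF svd]
            svdN[unfolded N_def] i that])
      have "- (u i \<bullet> (G *v v i)) \<le> (l + L2 * s) * (norm (u i) * norm (v i))"
        unfolding s_def by (rule asymmetric_corner_bound[OF svd' kr L2 l GV GU]) (erule second, erule orth)
      then show ?thesis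
        using orthonormal_norm[OF svd_orthonormal_right[OF svdN] i]
          orthonormal_norm[OF svd_orthonormal_left[OF svdN] i] by simp
    qed
    then have "(\<Sum>i<k'. n i * (- (u i \<bullet> (G *v v i)))) \<le> (\<Sum>i<k'. n i * (l + L2 * s))"
      using svd_pos[OF svdN] by (intro sum_mono mult_left_mono) (auto intro: less_imp_le)
    also have "\<dots> = (l + L2 * s) * (\<Sum>i<k'. n i)" by (simp add: mult.commute flip: sum_distrib_right)
    finally have "(\<Sum>i<k'. n i * (- (u i \<bullet> (G *v v i)))) \<le> (l + L2 * s) * (\<Sum>i<k'. n i)" .
    moreover have "- (G \<bullet> N) = (\<Sum>i<k'. n i * (- (u i \<bullet> (G *v v i))))"
      by (subst svd_eq[OF svdN]) (simp add: inner_sum_right inner_outer_right flip: sum_negf)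
    ultimately show ?thesis by simp
  qed
  have "norm (M - Ms) \<le> (6 * sqrt (real rs) * l + sqrt (real (CARD('r) + rs)) *
      max (op_norm (grad_on UNIV UNIV \<phi> Ms) - l) 0) / mu_eff (CARD('r)) rs \<mu> L L2"
  proof (rule recovery_bound[OF svd kr rs Ms \<mu> L L2 eff l, where G = G and s = s and k' = k' and n = n and u = u and v = v])
    show "G *v b i = - l *\<^sub>R a i" if "i < k" for i
      by (rule critical_singular_vectors[OF svd' that l GV GU])
    show "transpose G *v a i = - l *\<^sub>R b i" if "i < k" for i
      by (rule critical_singular_vectors[OF svdT that l GU]) (simp add: GV)
    show "0 \<le> s" using svd_pos[OF svd, of "k - 1"] by (auto simp: s_def intro: less_imp_le)
    show "s \<le> \<sigma> i" if "k = CARD('r)" "i < k" for i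
      using that svd_mono[OF svd, of i "k - 1"] by (auto simp: s_def)
    show "s = 0" if "k < CARD('r)" using that by (simp add: s_def)
    show "svd ((mat 1 - frame k a a) ** Ms ** (mat 1 - frame k b b)) k' n u v"
      using svdN by (simp add: N_def)
    show "- (G \<bullet> ((mat 1 - frame k a a) ** Ms ** (mat 1 - frame k b b))) \<le> (l + L2 * s) * (\<Sum>i<k'. n i)"
      using corner by (simp add: N_def)
    fix d
    let ?Y = "M - Ms + d *\<^sub>R N"
    have rank_Y: "rank (\<alpha> *\<^sub>R (M - Ms) + \<beta> *\<^sub>R ?Y) \<le> CARD('r) + rs" for \<alpha> \<beta>
    proof -
      have "\<alpha> *\<^sub>R (M - Ms) + \<beta> *\<^sub>R ?Y = (\<alpha> + \<beta>) *\<^sub>R M + (- (\<alpha> + \<beta>)) *\<^sub>R Ms + (\<beta> * d) *\<^sub>R N"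
        by (simp add: algebra_simps)
      then have "rank (\<alpha> *\<^sub>R (M - Ms) + \<beta> *\<^sub>R ?Y) \<le> k + rank Ms"
        unfolding N_def by (metis rank_corner_combination[OF svd])
      then show ?thesis using kr Ms by simp
    qed
    have rank_sum: "rank M + rank Ms \<le> CARD('r) + rs" using rank_M Ms by simp
    show "(L + \<mu>) / 2 * ((M - Ms) \<bullet> (M - Ms + d *\<^sub>R ((mat 1 - frame k a a) ** Ms ** (mat 1 - frame k b b))))
        - (L - \<mu>) / 2 * norm (M - Ms) * norm (M - Ms + d *\<^sub>R ((mat 1 - frame k a a) ** Ms ** (mat 1 - frame k b b)))
      \<le> (G - grad_on UNIV UNIV \<phi> Ms) \<bullet> (M - Ms + d *\<^sub>R ((mat 1 - frame k a a) ** Ms ** (mat 1 - frame k b b)))"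
      using restricted_monotone[OF cone_pair_UNIV rsc UNIV_I UNIV_I rank_sum UNIV_I rank_Y]
      by (simp add: N_def G_def M_def)
  qed
  then show ?thesis by (simp add: M_def)
qed

lemma restricted_sc_smooth_mono_rank:
  "restricted_sc_smooth T S k l a b \<phi> \<Longrightarrow> 1 \<le> k' \<Longrightarrow> k' \<le> k \<Longrightarrow> restricted_sc_smooth T S k' l a b \<phi>"
  unfolding restricted_sc_smooth_def by (meson le_trans)

text \<open>Supplies the nonzero direction that \<open>restricted_optima\<close> asks for in the
  symmetric case.\<close>

lemma rank_one_psd:
  fixes i :: "'d::finite"
  defines "E \<equiv> outer (axis i 1) (axis i 1)"
  shows "E \<in> psd_mats" "rank E \<le> 1" "E \<noteq> 0"
proof -
  have "norm E = 1" by (simp add: E_def norm_outer norm_axis_1)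
  then show "E \<noteq> 0" by auto
  show "E \<in> psd_mats" by (simp add: E_def psd_mats_def outer_mult_vec inner_commute)
  show "rank E \<le> 1" unfolding E_def by (rule rank_outer_le)
qed

text \<open>Since \<open>2 \<le> r + rs\<close>, bounds for directions of rank up to
  \<open>r + rs\<close> restrict to rank 2, so one hypothesis makes both pairs of optima well
  defined. The zero matrix serves as base point.\<close>

lemma optimal_constants:
  fixes \<phi> :: "real^'n^'m \<Rightarrow> real"
  assumes rs: "1 \<le> rs" "rs \<le> r"
    and T: "0 \<in> S" "E \<in> T" "rank E \<le> 1" "E \<noteq> 0"
    and rsc: "restricted_sc_smooth T S (r + rs) (r + rs) a b \<phi>"
    and thr: "rsc_L T S 2 (r + rs) \<phi> / (2 * sqrt (real r / real rs) + rsc_L T S 2 (r + rs) \<phi> / rsc_L T S (r + rs) (r + rs) \<phi>)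
      < rsc_mu T S (r + rs) (r + rs) \<phi>"
  shows "restricted_sc_smooth T S (r + rs) (r + rs) (rsc_mu T S (r + rs) (r + rs) \<phi>) (rsc_L T S (r + rs) (r + rs) \<phi>) \<phi>"
    and "restricted_sc_smooth T S 2 (r + rs) (rsc_mu T S 2 (r + rs) \<phi>) (rsc_L T S 2 (r + rs) \<phi>) \<phi>"
    and "0 < rsc_mu T S (r + rs) (r + rs) \<phi>"
    and "0 < mu_eff r rs (rsc_mu T S (r + rs) (r + rs) \<phi>) (rsc_L T S (r + rs) (r + rs) \<phi>) (rsc_L T S 2 (r + rs) \<phi>)"
proof -
  have two: "2 \<le> r + rs" using rs by simp
  show opt: "restricted_sc_smooth T S (r + rs) (r + rs) (rsc_mu T S (r + rs) (r + rs) \<phi>) (rsc_L T S (r + rs) (r + rs) \<phi>) \<phi>"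
    by (rule restricted_optima[OF rsc T(1) _ T(2)]) (use T two in auto)
  have "restricted_sc_smooth T S 2 (r + rs) a b \<phi>"
    using restricted_sc_smooth_mono_rank[OF rsc _ two] by simp
  then show opt2: "restricted_sc_smooth T S 2 (r + rs) (rsc_mu T S 2 (r + rs) \<phi>) (rsc_L T S 2 (r + rs) \<phi>) \<phi>"
    by (rule restricted_optima[OF _ T(1) _ T(2)]) (use T in auto)
  show "0 < rsc_mu T S (r + rs) (r + rs) \<phi>"
    and "0 < mu_eff r rs (rsc_mu T S (r + rs) (r + rs) \<phi>) (rsc_L T S (r + rs) (r + rs) \<phi>) (rsc_L T S 2 (r + rs) \<phi>)"
    using mu_eff_pos[OF rs _ _ _ thr] opt opt2 by (simp_all add: restricted_sc_smooth_def)
qed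

theorem theorem3:
  fixes rs :: nat
  assumes "1 \<le> rs" and "rs \<le> CARD('r::finite)"
  shows
    "(\<forall>\<phi> :: real^'d2^'d1 \<Rightarrow> real.
        let r = CARD('r);
            \<mu> = rsc_mu UNIV UNIV (r + rs) (r + rs) \<phi>;
            L = rsc_L UNIV UNIV (r + rs) (r + rs) \<phi>;
            L2 = rsc_L UNIV UNIV 2 (r + rs) \<phi>
        in
          convex_on UNIV \<phi> \<and> twice_differentiable_on UNIV UNIV \<phi> \<and>
          (\<exists>a b. restricted_sc_smooth UNIV UNIV (r + rs) (r + rs) a b \<phi>) \<and>
          \<mu> > L2 / (2 * sqrt (real r / real rs) + L2 / L)
          \<longrightarrow>
          mu_eff r rs \<mu> L L2 > 0 \<and>
          (\<forall>(lam :: real) (Ms :: real^'d2^'d1) (U :: real^'r^'d1) (V :: real^'r^'d2).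
             0 \<le> lam \<and> rank Ms \<le> rs \<and>
             second_order_critical
               (\<lambda>(U :: real^'r^'d1, V :: real^'r^'d2).
                  \<phi> (U ** transpose V) + lam * (((norm U)\<^sup>2 + (norm V)\<^sup>2) / 2)) (U, V)
             \<longrightarrow>
             norm (U ** transpose V - Ms)
               \<le> (6 * sqrt (real rs) * lam
                  + sqrt (real (r + rs)) * max (op_norm (grad_on UNIV UNIV \<phi> Ms) - lam) 0)
                 / mu_eff r rs \<mu> L L2))
     \<and>
     (\<forall>\<phi> :: real^'d^'d \<Rightarrow> real.
        let r = CARD('r);
            \<mu> = rsc_mu sym_mats psd_mats (r + rs) (r + rs) \<phi>;
            L = rsc_L sym_mats psd_mats (r + rs) (r + rs) \<phi>;
            L2 = rsc_L sym_mats psd_mats 2 (r + rs) \<phi>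
        in
          convex_on psd_mats \<phi> \<and> twice_differentiable_on sym_mats psd_mats \<phi> \<and>
          (\<exists>a b. restricted_sc_smooth sym_mats psd_mats (r + rs) (r + rs) a b \<phi>) \<and>
          \<mu> > L2 / (2 * sqrt (real r / real rs) + L2 / L)
          \<longrightarrow>
          mu_eff r rs \<mu> L L2 > 0 \<and>
          (\<forall>(lam :: real) (Ms :: real^'d^'d) (U :: real^'r^'d).
             0 \<le> lam \<and> Ms \<in> psd_mats \<and> rank Ms \<le> rs \<and>
             second_order_critical
               (\<lambda>U :: real^'r^'d. \<phi> (U ** transpose U) + lam * (norm U)\<^sup>2) U
             \<longrightarrow>
             norm (U ** transpose U - Ms)
               \<le> (6 * sqrt (real rs) * lam
                  + sqrt (real (r + rs)) * max (op_norm (grad_on sym_mats psd_mats \<phi> Ms) - lam) 0)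
                 / mu_eff r rs \<mu> L L2))"
  unfolding Let_def
proof ((rule conjI; intro allI impI; elim conjE exE), goal_cases)
  case (1 \<phi> a b)
  have "norm (outer (axis undefined 1) (axis undefined 1) :: real^'d2^'d1) = 1"
    by (simp add: norm_outer norm_axis_1)
  then have "(outer (axis undefined 1) (axis undefined 1) :: real^'d2^'d1) \<noteq> 0"
    by (metis norm_zero zero_neq_one)
  note c = optimal_constants[OF assms UNIV_I UNIV_I rank_outer_le this 1(4,3)]
  show ?case using c(4) asymmetric_recovery[OF assms c] by blast
next
  case (2 \<phi> a b)
  have zero: "(0 :: real^'d^'d) \<in> psd_mats" by (simp add: psd_mats_def transpose_zero)
  note E = rank_one_psd[of "undefined :: 'd"]
  have "outer (axis undefined 1) (axis undefined 1) \<in> (sym_mats :: (real^'d^'d) set)"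
    using E(1) by (simp add: psd_mats_def sym_mats_def)
  note c = optimal_constants[OF assms zero this E(2,3) 2(4,3)]
  show ?case using c(4) symmetric_recovery[OF assms c] by blast
qed

end
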